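(* For the zero-temperature Glauber (majority) dynamics on $\mathbb{T}_3$, and for $0\le r\le R<\infty$ and $p\in[0,1]$, let \[ \alpha_{r,R}(p)=\sup\{|\mathbb{P}_p(A\cap B)-\mathbb{P}_p(A)\mathbb{P}_p(B)|: A\in\Sigma_{\le r},\ B\in\Sigma_{\ge R}\}, \] where $\Sigma_{\le r}$ is the sigma-algebra generated by $\{\sigma_x(\infty):\mathrm{dist}(o,x)\le r\}$ and $\Sigma_{\ge R}$ is the sigma-algebra generated by $\{\sigma_x(\infty):\mathrm{dist}(o,x)\ge R\}$. Then for Lebesgue-a.e. $p\in[0,1]$ one has, for every fixed $r\ge 0$, \[ \lim_{R\to\infty}\alpha_{r,R}(p)=0. \]
   Context: $\mathbb{T}_3$ is the infinite $3$-regular tree with vertex set $\mathcal{V}$; $o\in\mathcal{V}$ is a distinguished vertex (the root); $\mathrm{dist}$ is the graph distance; $\partial x$ is the set of the three neighbors of $x$. Zero-temperature Glauber (majority vote) dynamics: under $\mathbb{P}_p$, $p\in[0,1]$, the initial spins $\sigma_x(0)\in\{-1,+1\}$, $x\in\mathcal{V}$, are i.i.d. with $\mathbb{P}_p(\sigma_x(0)=+1)=p=1-\mathbb{P}_p(\sigma_x(0)=-1)$, and, independently, each vertex carries an independent rate-one Poisson process (its clock). Spins are constant between clock rings; when the clock of $x$ rings at time $t$, $\sigma_x(t)$ is set equal to the majority value of $\{\sigma_y(t^-):y\in\partial x\}$. It is known (Nanda–Newman–Stein) that for every $p$, $\mathbb{P}_p$-a.s. every spin flips only finitely often, so $\sigma_x(\infty)=\lim_{t\to\infty}\sigma_x(t)$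 exists $\mathbb{P}_p$-a.s. for every $x$. *)

theory Defs
  imports "HOL-Probability.Probability"
begin

section \<open>Regular trees\<close>

text \<open>A graph is given by its adjacency relation; the vertex set is the whole type.\<close>

definition graph_cycle :: "('v \<Rightarrow> 'v \<Rightarrow> bool) \<Rightarrow> 'v list \<Rightarrow> bool" where
  "graph_cycle adj vs \<longleftrightarrow>
     length vs \<ge> 3 \<and> distinct vs \<and> successively adj vs \<and> adj (last vs) (hd vs)"

text \<open>Infiniteness is not listed, since a regular tree of degree at least 2 is automatically infinite.\<close>

locale regular_tree =
  fixes adj :: "'v \<Rightarrow> 'v \<Rightarrow> bool" and d :: nat
  assumes adj_sym: "adj x y \<Longrightarrow> adj y x"
    and adj_irrefl: "\<not> adj x x"
    and connected: "adj\<^sup>*\<^sup>* x y"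
    and no_cycle: "\<not> graph_cycle adj vs"
    and regular: "card {y. adj x y} = d"

definition graph_dist :: "('v \<Rightarrow> 'v \<Rightarrow> bool) \<Rightarrow> 'v \<Rightarrow> 'v \<Rightarrow> nat" where
  "graph_dist adj x y = (LEAST n. (adj ^^ n) x y)"


section \<open>Zero-temperature Glauber dynamics\<close>

definition generated_sigma :: "'a set \<Rightarrow> 'b measure \<Rightarrow> ('i \<Rightarrow> 'a \<Rightarrow> 'b) \<Rightarrow> 'i set \<Rightarrow> 'a set set" where
  "generated_sigma \<Omega> N X I = sigma_sets \<Omega> (\<Union>i\<in>I. {X i -` S \<inter> \<Omega> | S. S \<in> sets N})"

text \<open>The Poisson process of rate \<open>l\<close> is represented by its successive arrival times \<open>T 0 < T 1 < \<dots>\<close>.\<close>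

definition (in prob_space) poisson_arrivals :: "real \<Rightarrow> (nat \<Rightarrow> 'a \<Rightarrow> real) \<Rightarrow> bool" where
  "poisson_arrivals l T \<longleftrightarrow>
     (let gap = (\<lambda>n \<omega>. T n \<omega> - (if n = 0 then 0 else T (n - 1) \<omega>)) in
       indep_vars (\<lambda>_. borel) gap UNIV \<and>
       (\<forall>n. distributed M lborel (gap n) (exponential_density l)))"

text \<open>The value taken by more than half of the elements of \<open>A\<close>; it is unspecified if there is none,
  which cannot happen for two-valued \<open>f\<close> and \<open>card A\<close> odd.\<close>

definition majority :: "'v set \<Rightarrow> ('v \<Rightarrow> int) \<Rightarrow> int" where
  "majority A f = (THE s. 2 * card {y \<in> A. f y = s} > card A)"

text \<open>\<open>T x n\<close> is the time of the \<open>n\<close>-th ring (counted from 0) of the clock at \<open>x\<close>, and \<open>\<sigma> x t\<close> is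
  the spin at \<open>x\<close> at time \<open>t \<ge> 0\<close>; negative times carry no meaning. In \<open>independent\<close>, the index
  \<open>Inl x\<close> stands for the initial spin at \<open>x\<close> and \<open>Inr x\<close> for the whole clock at \<open>x\<close>.\<close>

locale glauber_dynamics = prob_space M
  for adj :: "'v \<Rightarrow> 'v \<Rightarrow> bool"
    and p :: real
    and M :: "'a measure"
    and T :: "'v \<Rightarrow> nat \<Rightarrow> 'a \<Rightarrow> real"
    and \<sigma> :: "'v \<Rightarrow> real \<Rightarrow> 'a \<Rightarrow> int" +
  assumes spin_measurable: "t \<ge> 0 \<Longrightarrow> random_variable (count_space UNIV) (\<sigma> x t)"
    and spin_values: "t \<ge> 0 \<Longrightarrow> \<omega> \<in> space M \<Longrightarrow> \<sigma> x t \<omega> \<in> {-1, 1}"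
    and initial_plus: "prob {\<omega> \<in> space M. \<sigma> x 0 \<omega> = 1} = p"
    and initial_minus: "prob {\<omega> \<in> space M. \<sigma> x 0 \<omega> = -1} = 1 - p"
    and clocks: "poisson_arrivals 1 (T x)"
    and independent:
      "indep_sets
         (case_sum (\<lambda>x. generated_sigma (space M) (count_space UNIV) (\<lambda>x. \<sigma> x 0) {x})
                   (\<lambda>x. generated_sigma (space M) borel (T x) UNIV))
         UNIV"
    and constant_between_rings:
      "AE \<omega> in M. \<forall>x s t. 0 \<le> s \<longrightarrow> s \<le> t \<longrightarrow> (\<forall>n. T x n \<omega> \<notin> {s<..t}) \<longrightarrow> \<sigma> x t \<omega> = \<sigma> x s \<omega>"
    and majority_at_rings:
      "AE \<omega> in M. \<forall>x n.
         \<sigma> x (T x n \<omega>) \<omega> = majority {y. adj x y} (\<lambda>y. Lim (at_left (T x n \<omega>)) (\<lambda>t. \<sigma> y t \<omega>))"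

text \<open>\<open>Lim\<close> returns a fixed unspecified value where the limit does not exist.\<close>

definition final_spin :: "('v \<Rightarrow> real \<Rightarrow> 'a \<Rightarrow> int) \<Rightarrow> 'v \<Rightarrow> 'a \<Rightarrow> int" where
  "final_spin \<sigma> x \<omega> = Lim at_top (\<lambda>t. \<sigma> x t \<omega>)"


section \<open>Mixing coefficients of the final configuration\<close>

definition Sigma_le :: "('v \<Rightarrow> 'v \<Rightarrow> bool) \<Rightarrow> 'v \<Rightarrow> 'a measure \<Rightarrow> ('v \<Rightarrow> real \<Rightarrow> 'a \<Rightarrow> int) \<Rightarrow> nat \<Rightarrow> 'a set set" where
  "Sigma_le adj v0 M \<sigma> r =
     generated_sigma (space M) (count_space UNIV) (final_spin \<sigma>) {x. graph_dist adj v0 x \<le> r}"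

definition Sigma_ge :: "('v \<Rightarrow> 'v \<Rightarrow> bool) \<Rightarrow> 'v \<Rightarrow> 'a measure \<Rightarrow> ('v \<Rightarrow> real \<Rightarrow> 'a \<Rightarrow> int) \<Rightarrow> nat \<Rightarrow> 'a set set" where
  "Sigma_ge adj v0 M \<sigma> R =
     generated_sigma (space M) (count_space UNIV) (final_spin \<sigma>) {x. graph_dist adj v0 x \<ge> R}"

text \<open>Since the paths obey the dynamics, and the limits exist, only almost surely, the final spins are
  measurable only up to null sets; hence probabilities are taken in the completion of \<open>M\<close>.\<close>

definition mixing_alpha :: "('v \<Rightarrow> 'v \<Rightarrow> bool) \<Rightarrow> 'v \<Rightarrow> 'a measure \<Rightarrow> ('v \<Rightarrow> real \<Rightarrow> 'a \<Rightarrow> int) \<Rightarrow> nat \<Rightarrow> nat \<Rightarrow> real" where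
  "mixing_alpha adj v0 M \<sigma> r R =
     Sup {\<bar>measure (completion M) (A \<inter> B) - measure (completion M) A * measure (completion M) B\<bar>
          | A B. A \<in> Sigma_le adj v0 M \<sigma> r \<and> B \<in> Sigma_ge adj v0 M \<sigma> R}"

end

theory Submission
  imports Defs
begin

text \<open>
  Given the initial spins and the clocks, the dynamics is determined by a recursion backwards in time
  with finite dependence. Realize all initial configurations at once by thresholding uniform variables
  \<open>U x\<close> at level \<open>p\<close>; the dynamics is monotone in \<open>p\<close>. For fixed \<open>y\<close> and \<open>t\<close> the spin of \<open>y\<close> at time
  \<open>t\<close> jumps at most once as \<open>p\<close> grows, at the level \<open>U x\<close> of a single vertex \<open>x\<close>; therefore the
  probability that \<open>x\<close> is pivotal for \<open>(y, t)\<close>, integrated over \<open>p\<close> and summed over \<open>x\<close>, is at most 1.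
  Automorphisms swapping two vertices turn the sum over \<open>x\<close> into a sum over \<open>y\<close>. Since all spins
  fixate (energy decreases with each flip, and swapping the ends of an edge controls the
  expected energy), Fatou's lemma shows that for almost every \<open>p\<close>, almost surely, a change of finitely many
  initial spins changes only finitely many final spins. The same holds when finitely many waiting
  times of a clock are permuted: one may first set all initial spins in a large ball to plus, after
  which the clocks near its centre do not matter until the permuted rings are over.

  An event of the final configuration near the root is almost a function of finitely many inputs.
  Exchanging these inputs with others produces many independent copies of the event; a far event hardly
  notices the exchanges, so it has nearly the same correlation with each copy, hence with their
  average, which is almost constant.
\<close>

section \<open>Symmetries of the tree\<close>

text \<open>The exceptional levels \<open>p\<close> enter only through the pivotality estimate: it
  bounds an integral over \<open>p\<close>, which says nothing about a single level. Two obstacles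
  shape the rest. The tree is not amenable, so the energy of a large ball is comparable to what
  crosses its boundary; the energy is therefore balanced edge by edge and in expectation, where both
  ends of an edge contribute equally. Moreover, no rate is available for how far an input reaches as
  time grows, only finiteness of the set that it influences. This suffices because the far event is
  never approximated: it only has to be insensitive to finitely many exchanges. These are chosen
  from the near event alone, so the estimate is uniform over far events, as the supremum demands.
  Inputs are exchanged within one clock rather than resampled, since a resampled waiting time would
  shift all later rings of that clock, whereas a permutation keeps their times.\<close>

lemma rtranclp_imp_distinct_path:
  assumes "r\<^sup>*\<^sup>* a b"
  shows "\<exists>vs. vs \<noteq> [] \<and> hd vs = a \<and> last vs = b \<and> distinct vs \<and> successively r vs"
  using assms
proof (induction rule: rtranclp_induct)
  case base
  show ?case by (intro exI[of _ "[a]"]) auto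
next
  case (step y z)
  then obtain vs where vs: "vs \<noteq> []" "hd vs = a" "last vs = y" "distinct vs" "successively r vs"
    by blast
  show ?case
  proof (cases "z \<in> set vs")
    case True
    then obtain us ws where "vs = us @ z # ws" by (meson split_list)
    then have "successively r (us @ [z])" "distinct (us @ [z])"
      using vs by (auto simp: successively_append_iff)
    moreover have "hd (us @ [z]) = a"
      using vs \<open>vs = _\<close> by (cases us) auto
    ultimately show ?thesis
      by (intro exI[of _ "us @ [z]"]) simp
  next
    case False
    with vs step(2) show ?thesis
      by (intro exI[of _ "vs @ [z]"]) (auto simp: successively_append_iff)
  qed
qed

locale cubic_tree = regular_tree adj 3 for adj :: "'v \<Rightarrow> 'v \<Rightarrow> bool"
begin

lemma finite_neighbours: "finite {y. adj x y}"
  by (rule card_ge_0_finite) (simp add: regular)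

lemma adj_commute: "adj x y \<longleftrightarrow> adj y x"
  using adj_sym by blast

definition adj_in :: "'v set \<Rightarrow> 'v \<Rightarrow> 'v \<Rightarrow> bool" where
  "adj_in D u v \<longleftrightarrow> adj u v \<and> u \<in> D \<and> v \<in> D"

text \<open>A one-vertex list is successive for every relation, hence the bound on the length: only
  an edge forces its ends into \<open>D\<close>.\<close>

lemma successively_adj_in:
  "successively (adj_in D) vs \<Longrightarrow> length vs \<ge> 2 \<Longrightarrow> set vs \<subseteq> D \<and> successively adj vs"
proof (induction vs rule: induct_list012)
  case (3 x y zs)
  then show ?case by (cases zs) (auto simp: adj_in_def)
qed auto

text \<open>Otherwise the new vertex would close a cycle.\<close>

lemma unique_attachment:
  assumes ab: "(adj_in D)\<^sup>*\<^sup>* a b" and w: "w \<notin> D" "adj w a" "adj w b"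
  shows "a = b"
proof (rule ccontr)
  assume ne: "a \<noteq> b"
  from rtranclp_imp_distinct_path[OF ab] obtain vs where
    vs: "vs \<noteq> []" "hd vs = a" "last vs = b" "distinct vs" "successively (adj_in D) vs"
    by blast
  have len: "length vs \<ge> 2"
    using vs ne by (cases vs; cases "tl vs") auto
  have *: "set vs \<subseteq> D" "successively adj vs"
    using successively_adj_in[OF vs(5) len] by auto
  have "graph_cycle adj (w # vs)"
    unfolding graph_cycle_def using vs * w len adj_commute
    by (auto simp: successively_Cons)
  with no_cycle show False by blast
qed

text \<open>A relation rather than a function, so that converses and unions of chains need no
  conversion. Both sides are kept connected, for then a vertex outside has at most one neighbour
  inside.\<close>

definition partial_iso :: "'v \<Rightarrow> 'v \<Rightarrow> ('v \<times> 'v) set \<Rightarrow> bool" where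
  "partial_iso x y R \<longleftrightarrow> (x, y) \<in> R
     \<and> (\<forall>a b a' b'. (a, b) \<in> R \<longrightarrow> (a', b') \<in> R \<longrightarrow> (a = a' \<longleftrightarrow> b = b') \<and> (adj a a' \<longleftrightarrow> adj b b'))
     \<and> (\<forall>a\<in>Domain R. (adj_in (Domain R))\<^sup>*\<^sup>* x a)
     \<and> (\<forall>b\<in>Range R. (adj_in (Range R))\<^sup>*\<^sup>* y b)"

lemma partial_isoD:
  assumes "partial_iso x y R"
  shows "(x, y) \<in> R"
    and "(a, b) \<in> R \<Longrightarrow> (a', b') \<in> R \<Longrightarrow> a = a' \<longleftrightarrow> b = b'"
    and "(a, b) \<in> R \<Longrightarrow> (a', b') \<in> R \<Longrightarrow> adj a a' \<longleftrightarrow> adj b b'"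
    and "a \<in> Domain R \<Longrightarrow> (adj_in (Domain R))\<^sup>*\<^sup>* x a"
    and "b \<in> Range R \<Longrightarrow> (adj_in (Range R))\<^sup>*\<^sup>* y b"
  using assms unfolding partial_iso_def by simp_all

lemma partial_iso_converse: "partial_iso x y R \<Longrightarrow> partial_iso y x (R\<inverse>)"
  unfolding partial_iso_def by simp

lemma adj_in_mono: "D \<subseteq> E \<Longrightarrow> (adj_in D)\<^sup>*\<^sup>* a b \<Longrightarrow> (adj_in E)\<^sup>*\<^sup>* a b"
  by (erule rtranclp_mono[THEN predicate2D, rotated]) (auto simp: adj_in_def)

lemma adj_in_sym: "(adj_in D)\<^sup>*\<^sup>* a b \<Longrightarrow> (adj_in D)\<^sup>*\<^sup>* b a"
proof -
  have "symp (adj_in D)" by (auto simp: symp_def adj_in_def adj_commute)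
  then show "(adj_in D)\<^sup>*\<^sup>* a b \<Longrightarrow> (adj_in D)\<^sup>*\<^sup>* b a"
    by (meson symp_rtranclp sympD)
qed

text \<open>Degrees are equal: as \<open>v\<close> has a neighbour outside the domain, its image has
  one outside the range. By connectedness each new vertex is attached at one point only, so its
  adjacency to all other pairs is automatically respected.\<close>

lemma partial_iso_extend:
  assumes R: "partial_iso x y R" and v: "v \<in> Domain R" and w: "w \<notin> Domain R" and vw: "adj v w"
  shows "\<exists>w'. partial_iso x y (insert (w, w') R)"
proof -
  let ?D = "Domain R" and ?E = "Range R"
  note R0 = partial_isoD(1)[OF R] and R1 = partial_isoD(2)[OF R] and R2 = partial_isoD(3)[OF R]
    and R3 = partial_isoD(4)[OF R] and R4 = partial_isoD(5)[OF R]
  obtain v' where v': "(v, v') \<in> R" using v by blast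
  let ?A = "{u \<in> ?D. adj v u}" and ?B = "{u \<in> ?E. adj v' u}"
  \<comment> \<open>The inverse of \<open>R\<close> sends the neighbours of \<open>v'\<close> in the
    range injectively to those of \<open>v\<close> in the domain, of which there are fewer than
    three.\<close>
  define g where "g u = (THE u'. (u', u) \<in> R)" for u
  have g: "g b = a" if "(a, b) \<in> R" for a b
    unfolding g_def using that R1 by blast
  have "inj_on g ?B"
  proof (rule inj_onI)
    fix b b' assume "b \<in> ?B" "b' \<in> ?B" "g b = g b'"
    moreover from this obtain a a' where "(a, b) \<in> R" "(a', b') \<in> R" by blast
    ultimately show "b = b'" using g R1 by metis
  qed
  moreover have "g ` ?B \<subseteq> ?A"
  proof
    fix a assume "a \<in> g ` ?B"
    then obtain b where b: "b \<in> ?E" "adj v' b" "a = g b" by blast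
    then obtain a' where "(a', b) \<in> R" by blast
    then show "a \<in> ?A" using g R2[OF v'] b by auto
  qed
  moreover have finA: "finite ?A" using finite_neighbours[of v] by (rule rev_finite_subset) auto
  ultimately have "card ?B \<le> card ?A" by (rule card_inj_on_le)
  also have "\<dots> < card {u. adj v u}"
    using w vw by (intro psubset_card_mono finite_neighbours) auto
  also have "\<dots> = card {u. adj v' u}" using regular by simp
  finally have "?B \<noteq> {u. adj v' u}" by auto
  then obtain w' where w': "adj v' w'" "w' \<notin> ?E" by blast
  have vE: "v' \<in> ?E" using v' by blast
  have a1: "adj w a \<longleftrightarrow> a = v" if "a \<in> ?D" for a
  proof
    assume "adj w a"
    moreover have "(adj_in ?D)\<^sup>*\<^sup>* a v"
      using R3[OF that] R3[OF v] adj_in_sym by (meson rtranclp_trans)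
    ultimately show "a = v" using unique_attachment[of ?D a v w] w vw adj_commute by blast
  qed (use vw adj_commute in auto)
  have a2: "adj w' b \<longleftrightarrow> b = v'" if "b \<in> ?E" for b
  proof
    assume "adj w' b"
    moreover have "(adj_in ?E)\<^sup>*\<^sup>* b v'"
      using R4[OF that] R4[OF vE] adj_in_sym by (meson rtranclp_trans)
    ultimately show "b = v'" using unique_attachment[of ?E b v' w'] w' adj_commute by blast
  qed (use w' adj_commute in auto)
  have new: "(a = w \<longleftrightarrow> b = w')" "(w = a \<longleftrightarrow> w' = b)" "(adj w a \<longleftrightarrow> adj w' b)" "(adj a w \<longleftrightarrow> adj b w')"
    if "(a, b) \<in> R" for a b
  proof -
    have "a \<in> ?D" "b \<in> ?E" using that by auto
    then show "(a = w \<longleftrightarrow> b = w')" "(w = a \<longleftrightarrow> w' = b)" using w w' by auto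
    show "(adj w a \<longleftrightarrow> adj w' b)" using a1[OF \<open>a \<in> ?D\<close>] a2[OF \<open>b \<in> ?E\<close>] R1[OF that v'] by simp
    then show "(adj a w \<longleftrightarrow> adj b w')" using adj_commute by blast
  qed
  have iso: "(a = a' \<longleftrightarrow> b = b') \<and> (adj a a' \<longleftrightarrow> adj b b')"
    if "(a, b) \<in> insert (w, w') R" "(a', b') \<in> insert (w, w') R" for a b a' b'
    using that new R1[of a b a' b'] R2[of a b a' b'] adj_irrefl by auto
  have xw: "(adj_in (insert w ?D))\<^sup>*\<^sup>* x w"
  proof (rule rtranclp.rtrancl_into_rtrancl)
    show "(adj_in (insert w ?D))\<^sup>*\<^sup>* x v" using adj_in_mono[OF _ R3[OF v]] by blast
    show "adj_in (insert w ?D) v w" using v vw by (auto simp: adj_in_def)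
  qed
  have yw: "(adj_in (insert w' ?E))\<^sup>*\<^sup>* y w'"
  proof (rule rtranclp.rtrancl_into_rtrancl)
    show "(adj_in (insert w' ?E))\<^sup>*\<^sup>* y v'" using adj_in_mono[OF _ R4[OF vE]] by blast
    show "adj_in (insert w' ?E) v' w'" using v' w' by (auto simp: adj_in_def)
  qed
  have xa: "(adj_in (insert w ?D))\<^sup>*\<^sup>* x a" if "a \<in> ?D" for a
    using adj_in_mono[OF _ R3[OF that]] by blast
  have ya: "(adj_in (insert w' ?E))\<^sup>*\<^sup>* y a" if "a \<in> ?E" for a
    using adj_in_mono[OF _ R4[OF that]] by blast
  have "partial_iso x y (insert (w, w') R)"
    unfolding partial_iso_def Domain_insert Range_insert fst_conv snd_conv
  proof (intro conjI allI ballI impI)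
    show "(x, y) \<in> insert (w, w') R" using R0 by simp
    show "(adj_in (insert w ?D))\<^sup>*\<^sup>* x a" if "a \<in> insert w ?D" for a
      using that xw xa by (elim insertE) simp_all
    show "(adj_in (insert w' ?E))\<^sup>*\<^sup>* y b" if "b \<in> insert w' ?E" for b
      using that yw ya by (elim insertE) simp_all
  qed (use iso in \<open>fast+\<close>)
  then show ?thesis ..
qed

text \<open>A walk from \<open>x\<close> to a missing vertex would leave the domain along some edge,
  and there \<open>R\<close> could be extended.\<close>

lemma partial_iso_maximal_total:
  assumes R: "partial_iso x y R" and max: "\<And>R'. partial_iso x y R' \<Longrightarrow> R \<subseteq> R' \<Longrightarrow> R' = R"
  shows "Domain R = UNIV"
proof -
  have "a \<in> Domain R" for a
    using connected[of x a]
  proof (induction rule: rtranclp_induct)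
    case base
    then show ?case using partial_isoD(1)[OF R] by blast
  next
    case (step v w)
    show ?case
    proof (rule ccontr)
      assume "w \<notin> Domain R"
      from partial_iso_extend[OF R step(3) this step(2)] obtain w' where
        "partial_iso x y (insert (w, w') R)" by blast
      then have "insert (w, w') R = R" by (rule max) blast
      then have "(w, w') \<in> R" by blast
      with \<open>w \<notin> Domain R\<close> show False by blast
    qed
  qed
  then show ?thesis by blast
qed

lemma partial_iso_Union:
  assumes "C \<noteq> {}" "subset.chain A C" "\<And>R. R \<in> C \<Longrightarrow> partial_iso x y R"
  shows "partial_iso x y (\<Union>C)"
proof -
  have *: "\<exists>R\<in>C. p \<in> R \<and> q \<in> R" if "p \<in> \<Union>C" "q \<in> \<Union>C" for p q
    using that assms(2) unfolding subset.chain_def by blast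
  have "(x, y) \<in> \<Union>C" using assms(1) partial_isoD(1)[OF assms(3)] by blast
  moreover have "(a = a' \<longleftrightarrow> b = b') \<and> (adj a a' \<longleftrightarrow> adj b b')"
    if ab: "(a, b) \<in> \<Union>C" "(a', b') \<in> \<Union>C" for a b a' b'
  proof -
    obtain R where R: "R \<in> C" "(a, b) \<in> R" "(a', b') \<in> R" using *[OF ab] by blast
    with partial_isoD(2,3)[OF assms(3)[OF R(1)], of a b a' b'] show ?thesis by blast
  qed
  moreover have "(adj_in (Domain (\<Union>C)))\<^sup>*\<^sup>* x a" if "a \<in> Domain (\<Union>C)" for a
  proof -
    from that obtain R where R: "R \<in> C" "a \<in> Domain R" by blast
    then have "(adj_in (Domain R))\<^sup>*\<^sup>* x a" using partial_isoD(4)[OF assms(3)] by blast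
    then show ?thesis by (rule adj_in_mono[rotated]) (use R in blast)
  qed
  moreover have "(adj_in (Range (\<Union>C)))\<^sup>*\<^sup>* y a" if "a \<in> Range (\<Union>C)" for a
  proof -
    from that obtain R where R: "R \<in> C" "a \<in> Range R" by blast
    then have "(adj_in (Range R))\<^sup>*\<^sup>* y a" using partial_isoD(5)[OF assms(3)] by blast
    then show ?thesis by (rule adj_in_mono[rotated]) (use R in blast)
  qed
  ultimately show ?thesis unfolding partial_iso_def by simp
qed

definition automorphism :: "('v \<Rightarrow> 'v) \<Rightarrow> bool" where
  "automorphism \<phi> \<longleftrightarrow> bij \<phi> \<and> (\<forall>a b. adj (\<phi> a) (\<phi> b) \<longleftrightarrow> adj a b)"

lemma partial_iso_extends_to_automorphism:
  assumes "partial_iso x y R0"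
  shows "\<exists>\<phi>. automorphism \<phi> \<and> (\<forall>a b. (a, b) \<in> R0 \<longrightarrow> \<phi> a = b)"
proof -
  let ?A = "{R. partial_iso x y R \<and> R0 \<subseteq> R}"
  have "\<exists>R\<in>?A. \<forall>X\<in>?A. R \<subseteq> X \<longrightarrow> X = R"
  proof (rule subset_Zorn_nonempty)
    show "?A \<noteq> {}" using assms by blast
    fix C assume C: "C \<noteq> {}" "subset.chain ?A C"
    then have "\<And>R. R \<in> C \<Longrightarrow> R \<in> ?A" unfolding subset.chain_def by blast
    then show "\<Union>C \<in> ?A"
      using partial_iso_Union[OF C, of x y] C(1) by blast
  qed
  then obtain R where R: "partial_iso x y R" "R0 \<subseteq> R"
    and max: "\<And>X. partial_iso x y X \<Longrightarrow> R \<subseteq> X \<Longrightarrow> X = R" by fastforce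
  have dom: "Domain R = UNIV" by (rule partial_iso_maximal_total[OF R(1) max])
  \<comment> \<open>Maximality passes to the converse, so surjectivity is totality of the
    converse.\<close>
  have "Domain (R\<inverse>) = UNIV"
  proof (rule partial_iso_maximal_total[OF partial_iso_converse[OF R(1)]])
    fix R' assume "partial_iso y x R'" "R\<inverse> \<subseteq> R'"
    then have "R'\<inverse> = R" by (intro max partial_iso_converse) auto
    then show "R' = R\<inverse>" by auto
  qed
  then have ran: "Range R = UNIV" by simp
  note R1 = partial_isoD(2)[OF R(1)]
  define \<phi> where "\<phi> a = (SOME b. (a, b) \<in> R)" for a
  have \<phi>: "(a, \<phi> a) \<in> R" for a
  proof -
    have "a \<in> Domain R" using dom by simp
    then show ?thesis unfolding \<phi>_def by (auto intro: someI)
  qed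
  have inR: "(a, b) \<in> R \<longleftrightarrow> \<phi> a = b" for a b
    using \<phi>[of a] R1[of a "\<phi> a" a b] by auto
  have "inj \<phi>"
    by (rule injI) (use R1[OF \<phi> \<phi>] in simp)
  moreover have "surj \<phi>"
  proof (rule surjI)
    fix b
    have "b \<in> Range R" using ran by simp
    then show "\<phi> (SOME a. (a, b) \<in> R) = b" using inR by (auto intro: someI)
  qed
  ultimately have "automorphism \<phi>" unfolding automorphism_def bij_def using partial_isoD(3)[OF R(1) \<phi> \<phi>] by blast
  moreover have "\<forall>a b. (a, b) \<in> R0 \<longrightarrow> \<phi> a = b" using R(2) inR by auto
  ultimately show ?thesis by blast
qed

section \<open>Paths and the automorphism that exchanges two vertices\<close>

lemma path_chord_free:
  assumes vs: "distinct vs" "successively adj vs" and ij: "i < j" "j < length vs"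
  shows "adj (vs ! i) (vs ! j) \<longleftrightarrow> j = Suc i"
proof
  assume a: "adj (vs ! i) (vs ! j)"
  show "j = Suc i"
  proof (rule ccontr)
    assume "j \<noteq> Suc i"
    \<comment> \<open>The segment between the two indices, which the chord would close into a
      cycle.\<close>
    let ?us = "take (j - i + 1) (drop i vs)"
    have len: "length ?us = j - i + 1" using ij by simp
    have "successively adj (drop i vs)"
      using vs(2) by (metis append_take_drop_id successively_append_iff)
    then have "successively adj ?us"
      by (metis append_take_drop_id successively_append_iff)
    moreover have "hd ?us = vs ! i" using ij by (simp add: hd_drop_conv_nth)
    moreover have "last ?us = vs ! j"
      using ij len by (subst last_conv_nth) (auto simp: nth_append)
    ultimately have "graph_cycle adj ?us"
      unfolding graph_cycle_def using len \<open>j \<noteq> Suc i\<close> ij a vs(1) adj_commute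
      by auto
    with no_cycle show False by blast
  qed
next
  assume "j = Suc i"
  then show "adj (vs ! i) (vs ! j)" using vs(2) ij by (simp add: successively_conv_nth)
qed

lemma adj_in_path:
  assumes "successively adj vs" "j < length vs" "i \<le> j"
  shows "(adj_in (set vs))\<^sup>*\<^sup>* (vs ! i) (vs ! j)"
  using assms(3,2)
proof (induction j rule: dec_induct)
  case (step n)
  have "adj_in (set vs) (vs ! n) (vs ! Suc n)"
    using assms(1) step by (auto simp: adj_in_def successively_conv_nth)
  with step show ?case by (meson Suc_lessD rtranclp.rtrancl_into_rtrancl)
qed auto

text \<open>A path has no chords, so its reversal is a partial isomorphism, and this extends to the
  whole tree. A true exchange, not merely a map taking \<open>x\<close> to \<open>y\<close>, is what
  makes expectations indexed by ordered pairs symmetric.\<close>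

lemma swapping_automorphism:
  obtains \<phi> where "automorphism \<phi>" "\<phi> x = y" "\<phi> y = x"
proof -
  from rtranclp_imp_distinct_path[OF connected[of x y]] obtain vs where
    vs: "vs \<noteq> []" "hd vs = x" "last vs = y" "distinct vs" "successively adj vs" by blast
  define n where "n = length vs - 1"
  have n: "length vs = Suc n" using vs(1) by (simp add: n_def)
  have x: "vs ! 0 = x" using vs by (simp add: hd_conv_nth)
  have y: "vs ! n = y" using vs by (simp add: last_conv_nth n_def)
  let ?R = "(\<lambda>i. (vs ! i, vs ! (n - i))) ` {..n}"
  have eq: "vs ! i = vs ! j \<longleftrightarrow> i = j" if "i \<le> n" "j \<le> n" for i j
    using that vs(4) n by (simp add: nth_eq_iff_index_eq)
  have ad: "adj (vs ! i) (vs ! j) \<longleftrightarrow> i = Suc j \<or> j = Suc i" if "i \<le> n" "j \<le> n" for i j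
    using path_chord_free[OF vs(4,5), of i j] path_chord_free[OF vs(4,5), of j i] that n
      adj_commute adj_irrefl by (cases i j rule: linorder_cases) auto
  have "fst ` ?R = set vs" "snd ` ?R = set vs"
  proof -
    have "set vs = (!) vs ` {..n}" using n
      by (auto simp: in_set_conv_nth image_iff less_Suc_eq_le Bex_def)
    moreover have "(\<lambda>i. vs ! (n - i)) ` {..n} = (!) vs ` {..n}"
    proof -
      have "(\<lambda>i. n - i) ` {..n} = {..n}"
        by (auto simp: image_iff) (metis atMost_iff diff_diff_cancel diff_le_self)
      then have "(!) vs ` (\<lambda>i. n - i) ` {..n} = (!) vs ` {..n}" by simp
      then show ?thesis by (simp only: image_image)
    qed
    ultimately show "fst ` ?R = set vs" "snd ` ?R = set vs" by (auto simp: image_image)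
  qed
  then have D: "Domain ?R = set vs" "Range ?R = set vs" by (auto simp: Domain_fst Range_snd)
  have "partial_iso x y ?R"
    unfolding partial_iso_def D
  proof (intro conjI ballI)
    show "(x, y) \<in> ?R" using x y by force
    fix a assume "a \<in> set vs"
    then obtain i where i: "i \<le> n" "a = vs ! i" using n by (metis in_set_conv_nth less_Suc_eq_le)
    show "(adj_in (set vs))\<^sup>*\<^sup>* x a" using adj_in_path[OF vs(5), of i 0] i n x by auto
    show "(adj_in (set vs))\<^sup>*\<^sup>* y a" using adj_in_sym[OF adj_in_path[OF vs(5), of n i]] i n y by auto
  next
    show "\<forall>a b a' b'. (a, b) \<in> ?R \<longrightarrow> (a', b') \<in> ?R \<longrightarrow> (a = a' \<longleftrightarrow> b = b') \<and> (adj a a' \<longleftrightarrow> adj b b')"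
      using eq ad by auto
  qed
  from partial_iso_extends_to_automorphism[OF this] obtain \<phi> where
    \<phi>: "automorphism \<phi>" "\<forall>a b. (a, b) \<in> ?R \<longrightarrow> \<phi> a = b" by (elim exE conjE)
  have "(x, y) \<in> ?R" "(y, x) \<in> ?R"
    using x y by (force intro: image_eqI[of _ _ 0], force intro: image_eqI[of _ _ n])
  with \<phi>(2) have "\<phi> x = y" "\<phi> y = x" by blast+
  then show ?thesis using that \<phi>(1) by blast
qed

section \<open>Finite balls and countability\<close>

lemma finite_walk_targets: "finite {y. (adj ^^ n) x y}"
proof (induction n)
  case (Suc n)
  have "{y. (adj ^^ Suc n) x y} = (\<Union>z\<in>{z. (adj ^^ n) x z}. {y. adj z y})"
    by auto
  then show ?case using Suc finite_neighbours by auto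
qed auto

lemma ex_walk: "\<exists>n. (adj ^^ n) x y"
  using connected[of x y] by (simp add: rtranclp_power)

lemma graph_dist_walk: "(adj ^^ graph_dist adj x y) x y"
  unfolding graph_dist_def using ex_walk by (rule LeastI_ex)

lemma countable_vertices: "countable (UNIV :: 'v set)"
proof -
  have "UNIV = (\<Union>n. {y. (adj ^^ n) undefined y})" using ex_walk by blast
  then show ?thesis
    using finite_walk_targets countable_finite by (metis countable_UN countableI_type)
qed

lemma finite_ball: "finite {y. graph_dist adj x y \<le> r}"
proof -
  have "{y. graph_dist adj x y \<le> r} \<subseteq> (\<Union>n\<le>r. {y. (adj ^^ n) x y})"
    using graph_dist_walk by blast
  then show ?thesis by (rule finite_subset) (simp add: finite_walk_targets)
qed

end

section \<open>The dynamics as a function of the initial spins and the clocks\<close>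

text \<open>Spins are Booleans, and a configuration of clocks lists the successive rings of each vertex.
  It suffices to follow left limits: \<open>left_spin \<xi> T x t\<close> is the spin of \<open>x\<close> just before time \<open>t\<close>.\<close>

definition last_ring :: "(nat \<Rightarrow> real) \<Rightarrow> real \<Rightarrow> nat" where
  "last_ring \<tau> t = (LEAST k. t \<le> \<tau> (Suc k))"

text \<open>The condition \<open>\<tau> 0 < t\<close> matters: for earlier times the least index is
  0 although no ring has happened yet.\<close>

lemma last_ring_bounds:
  assumes "strict_mono \<tau>" "filterlim \<tau> at_top sequentially" "\<tau> 0 < t"
  shows "\<tau> (last_ring \<tau> t) < t" "t \<le> \<tau> (Suc (last_ring \<tau> t))"
proof -
  from assms(2) have "eventually (\<lambda>n. t \<le> \<tau> n) sequentially"
    by (simp add: filterlim_at_top)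
  then obtain n where "t \<le> \<tau> (Suc n)"
    by (meson eventually_sequentially le_SucI order_refl)
  then show *: "t \<le> \<tau> (Suc (last_ring \<tau> t))"
    unfolding last_ring_def by (rule LeastI)
  show "\<tau> (last_ring \<tau> t) < t"
  proof (cases "last_ring \<tau> t")
    case (Suc k)
    then have "\<not> t \<le> \<tau> (Suc k)"
      unfolding last_ring_def by (metis lessI not_less_Least)
    with Suc show ?thesis by simp
  qed (use assms in auto)
qed

lemma last_ring_eqI:
  assumes "strict_mono \<tau>" "\<tau> k < t" "t \<le> \<tau> (Suc k)"
  shows "last_ring \<tau> t = k"
  unfolding last_ring_def
proof (rule Least_equality)
  fix j assume "t \<le> \<tau> (Suc j)"
  then have "\<tau> k < \<tau> (Suc j)" using assms by simp
  then have "k < Suc j" using strict_mono_less[OF assms(1)] by simp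
  then show "k \<le> j" by simp
qed fact

section \<open>The majority rule and its recursion backwards in time\<close>

context cubic_tree
begin

text \<open>Among three neighbours, two plus spins are a majority. In this form the rule is visibly
  monotone.\<close>

definition maj :: "'v \<Rightarrow> ('v \<Rightarrow> bool) \<Rightarrow> bool" where
  "maj x f \<longleftrightarrow> (\<exists>y z. adj x y \<and> adj x z \<and> y \<noteq> z \<and> f y \<and> f z)"

lemma maj_mono: "(\<And>y. adj x y \<Longrightarrow> f y \<Longrightarrow> g y) \<Longrightarrow> maj x f \<Longrightarrow> maj x g"
  unfolding maj_def by blast

lemma maj_cong: "(\<And>y. adj x y \<Longrightarrow> f y = g y) \<Longrightarrow> maj x f = maj x g"
  unfolding maj_def by blast

lemma neighbours_obtain:
  obtains a b c where "{y. adj x y} = {a, b, c}" "a \<noteq> b" "a \<noteq> c" "b \<noteq> c"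
  using regular[of x] by (auto simp: card_3_iff)

lemma maj_all: assumes "\<And>y. adj x y \<Longrightarrow> f y" shows "maj x f"
proof -
  obtain a b c where "{y. adj x y} = {a, b, c}" "a \<noteq> b" by (rule neighbours_obtain)
  then show ?thesis unfolding maj_def using assms by (metis insertCI mem_Collect_eq)
qed

lemma maj_iff_card: "maj x f \<longleftrightarrow> 2 * card {y. adj x y \<and> f y} > 3"
proof -
  obtain a b c where abc: "{y. adj x y} = {a, b, c}" "a \<noteq> b" "a \<noteq> c" "b \<noteq> c"
    by (rule neighbours_obtain)
  then have adj: "adj x y \<longleftrightarrow> y = a \<or> y = b \<or> y = c" for y by blast
  have "{y. adj x y \<and> f y} =
      (if f a then {a} else {}) \<union> (if f b then {b} else {}) \<union> (if f c then {c} else {})"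
    using adj by auto
  then show ?thesis unfolding maj_def adj using abc by (auto simp: card_insert_if)
qed

lemma maj_iff_card_not: "\<not> maj x f \<longleftrightarrow> 2 * card {y. adj x y \<and> \<not> f y} > 3"
proof -
  have "card {y. adj x y} = card {y. adj x y \<and> f y} + card {y. adj x y \<and> \<not> f y}"
    using finite_neighbours[of x]
    by (subst card_Un_disjoint[symmetric]) (auto intro: arg_cong[where f = card])
  then show ?thesis using regular[of x] unfolding maj_iff_card by presburger
qed

lemma maj_automorphism:
  assumes "automorphism \<phi>"
  shows "maj x (\<lambda>y. f (\<phi> y)) = maj (\<phi> x) f"
proof -
  have b: "bij \<phi>" and a: "\<And>a b. adj (\<phi> a) (\<phi> b) = adj a b"
    using assms by (auto simp: automorphism_def)
  have *: "\<And>y. \<exists>z. y = \<phi> z" using b by (metis bij_pointE)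
  have **: "\<And>y z. \<phi> y = \<phi> z \<longleftrightarrow> y = z" using b by (simp add: bij_is_inj inj_eq)
  show ?thesis unfolding maj_def using * ** a by metis
qed

text \<open>The recursion unrolled to depth \<open>n\<close> and cut off by the current initial
  spin. The cut-off value is harmless where no chain of length \<open>n\<close> exists, and it stays
  plus whenever the initial spins nearby are plus.\<close>

primrec approx :: "nat \<Rightarrow> ('v \<Rightarrow> bool) \<Rightarrow> ('v \<Rightarrow> nat \<Rightarrow> real) \<Rightarrow> 'v \<Rightarrow> real \<Rightarrow> bool" where
  "approx 0 \<xi> T x t = \<xi> x"
| "approx (Suc n) \<xi> T x t =
     (if t \<le> T x 0 then \<xi> x
      else maj x (\<lambda>y. approx n \<xi> T y (T x (last_ring (T x) t))))"

text \<open>The value at which the unrolled recursion settles. This makes a total function without a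
  termination argument; that it solves the recursion is shown later, for admissible clocks.\<close>

definition left_spin :: "('v \<Rightarrow> bool) \<Rightarrow> ('v \<Rightarrow> nat \<Rightarrow> real) \<Rightarrow> 'v \<Rightarrow> real \<Rightarrow> bool" where
  "left_spin \<xi> T x t \<longleftrightarrow> (\<exists>N. \<forall>n\<ge>N. approx n \<xi> T x t)"

text \<open>A chain traces the dependence of the spin of \<open>x\<close> before time \<open>t\<close> backwards in time.\<close>

primrec chain :: "('v \<Rightarrow> nat \<Rightarrow> real) \<Rightarrow> nat \<Rightarrow> 'v \<Rightarrow> real \<Rightarrow> bool" where
  "chain T 0 x t \<longleftrightarrow> True"
| "chain T (Suc n) x t \<longleftrightarrow> (\<exists>k. T x k < t \<and> (\<exists>y. adj x y \<and> chain T n y (T x k)))"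

text \<open>The absence of long chains makes the recursion well founded. Distinct rings at adjacent
  vertices are needed for the energy, where the rings at both ends of an edge have to be put in
  order.\<close>

definition admissible :: "('v \<Rightarrow> nat \<Rightarrow> real) \<Rightarrow> bool" where
  "admissible T \<longleftrightarrow>
     (\<forall>x. strict_mono (T x) \<and> 0 < T x 0 \<and> filterlim (T x) at_top sequentially)
     \<and> (\<forall>x y n m. adj x y \<longrightarrow> T x n \<noteq> T y m)
     \<and> (\<forall>x t. \<exists>n. \<not> chain T n x t)"

lemma admissibleD:
  assumes "admissible T"
  shows "strict_mono (T x)" "0 < T x 0" "filterlim (T x) at_top sequentially"
    "adj x y \<Longrightarrow> T x n \<noteq> T y m" "\<exists>n. \<not> chain T n x t"
  using assms unfolding admissible_def by blast+

lemma admissible_last_ring: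
  assumes "admissible T" "T x 0 < t"
  shows "T x (last_ring (T x) t) < t" "t \<le> T x (Suc (last_ring (T x) t))"
  using last_ring_bounds[OF admissibleD(1,3)[OF assms(1)]] assms(2) by blast+

lemma chain_time_mono: "chain T n x s \<Longrightarrow> s \<le> t \<Longrightarrow> chain T n x t"
  by (cases n) (auto intro: less_le_trans)

lemma chain_Suc: "chain T (Suc n) x t \<Longrightarrow> chain T n x t"
proof (induction n arbitrary: x t)
  case (Suc n)
  from Suc.prems obtain k y where "T x k < t" "adj x y" "chain T (Suc n) y (T x k)"
    unfolding chain.simps(2)[of T "Suc n"] by blast
  with Suc.IH[of y "T x k"] show ?case unfolding chain.simps(2) by blast
qed simp

lemma chain_antimono: "chain T n x t \<Longrightarrow> m \<le> n \<Longrightarrow> chain T m x t"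
  by (induction n) (auto simp: le_Suc_eq dest: chain_Suc simp del: chain.simps)

definition is_solution :: "('v \<Rightarrow> bool) \<Rightarrow> ('v \<Rightarrow> nat \<Rightarrow> real) \<Rightarrow> ('v \<Rightarrow> real \<Rightarrow> bool) \<Rightarrow> bool" where
  "is_solution \<xi> T f \<longleftrightarrow> (\<forall>x t. f x t =
     (if t \<le> T x 0 then \<xi> x else maj x (\<lambda>y. f y (T x (last_ring (T x) t)))))"

lemma solution_eq:
  assumes "is_solution \<xi> T f"
  shows "t \<le> T x 0 \<Longrightarrow> f x t = \<xi> x"
    "T x 0 < t \<Longrightarrow> f x t = maj x (\<lambda>y. f y (T x (last_ring (T x) t)))"
  using assms unfolding is_solution_def by auto

text \<open>If no chain of length \<open>n\<close> starts here, every branch of the recursion ends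
  in a genuine initial spin by depth \<open>n\<close>, so the cut-off is not felt.\<close>

lemma approx_stable:
  assumes T: "admissible T" and "\<not> chain T n x t" "n \<le> m"
  shows "approx m \<xi> T x t = approx n \<xi> T x t"
  using assms(2,3)
proof (induction n arbitrary: m x t)
  case (Suc n)
  then obtain m' where m: "m = Suc m'" "n \<le> m'" by (cases m) auto
  show ?case
  proof (cases "t \<le> T x 0")
    case False
    then have "\<not> chain T n y (T x (last_ring (T x) t))" if "adj x y" for y
      using Suc.prems(1) admissible_last_ring(1)[OF T, of x t] that by auto
    then have "maj x (\<lambda>y. approx m' \<xi> T y (T x (last_ring (T x) t)))
        = maj x (\<lambda>y. approx n \<xi> T y (T x (last_ring (T x) t)))"
      using Suc.IH m(2) by (intro maj_cong) blast
    then show ?thesis using False m by simp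
  qed (simp add: m)
qed simp

lemma solution_eq_approx:
  assumes T: "admissible T" and f: "is_solution \<xi> T f" and "\<not> chain T n x t"
  shows "f x t = approx n \<xi> T x t"
  using assms(3)
proof (induction n arbitrary: x t)
  case (Suc n)
  show ?case
  proof (cases "t \<le> T x 0")
    case False
    then have "\<not> chain T n y (T x (last_ring (T x) t))" if "adj x y" for y
      using Suc.prems(1) admissible_last_ring(1)[OF T, of x t] that by auto
    then have "maj x (\<lambda>y. f y (T x (last_ring (T x) t)))
        = maj x (\<lambda>y. approx n \<xi> T y (T x (last_ring (T x) t)))"
      using Suc.IH by (intro maj_cong) blast
    then show ?thesis using False solution_eq(2)[OF f, of x t] by simp
  next
    case True
    then show ?thesis using solution_eq(1)[OF f, of t x] by simp
  qed
qed simp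

lemma left_spin_eq_approx:
  assumes "admissible T" "\<not> chain T n x t"
  shows "left_spin \<xi> T x t = approx n \<xi> T x t"
proof
  assume "left_spin \<xi> T x t"
  then obtain N where "\<forall>m\<ge>N. approx m \<xi> T x t" unfolding left_spin_def by blast
  then have "approx (max N n) \<xi> T x t" by simp
  then show "approx n \<xi> T x t" using approx_stable[OF assms, of "max N n" \<xi>] by simp
next
  assume "approx n \<xi> T x t"
  then have "approx m \<xi> T x t" if "m \<ge> n" for m
    by (simp only: approx_stable[OF assms that])
  then show "left_spin \<xi> T x t" unfolding left_spin_def by blast
qed

lemma left_spin_solution:
  assumes T: "admissible T"
  shows "is_solution \<xi> T (left_spin \<xi> T)"
  unfolding is_solution_def
proof (intro allI)
  fix x t
  obtain n where n: "\<not> chain T n x t" using admissibleD(5)[OF T] by blast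
  then obtain m where m: "n = Suc m" by (cases n) auto
  have "left_spin \<xi> T x t = approx n \<xi> T x t" using T n by (rule left_spin_eq_approx)
  also have "\<dots> = (if t \<le> T x 0 then \<xi> x
      else maj x (\<lambda>y. left_spin \<xi> T y (T x (last_ring (T x) t))))"
  proof (cases "t \<le> T x 0")
    case False
    then have "\<not> chain T m y (T x (last_ring (T x) t))" if "adj x y" for y
      using n m admissible_last_ring(1)[OF T, of x t] that by auto
    then have "maj x (\<lambda>y. left_spin \<xi> T y (T x (last_ring (T x) t)))
        = maj x (\<lambda>y. approx m \<xi> T y (T x (last_ring (T x) t)))"
      using left_spin_eq_approx[OF T] by (intro maj_cong) blast
    then show ?thesis using False m by simp
  qed (simp add: m)
  finally show "left_spin \<xi> T x t = \<dots>" .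
qed

lemma left_spin_initial: "admissible T \<Longrightarrow> t \<le> T x 0 \<Longrightarrow> left_spin \<xi> T x t = \<xi> x"
  by (rule solution_eq(1)[OF left_spin_solution])

lemma left_spin_rec:
  assumes T: "admissible T" and "T x k < t" "t \<le> T x (Suc k)"
  shows "left_spin \<xi> T x t = maj x (\<lambda>y. left_spin \<xi> T y (T x k))"
proof -
  have "T x 0 \<le> T x k" using admissibleD(1)[OF T] by (simp add: strict_mono_less_eq)
  moreover have "last_ring (T x) t = k" using admissibleD(1)[OF T] assms(2,3) by (rule last_ring_eqI)
  ultimately show ?thesis
    using solution_eq(2)[OF left_spin_solution[OF T], of x t \<xi>] assms(2) by simp
qed

text \<open>Serves twice: to see that a change of clocks leaves a path unchanged, and to identify
  the paths of an arbitrary Glauber process with this construction.\<close>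

lemma solution_unique:
  assumes "admissible T" "is_solution \<xi> T f"
  shows "f = left_spin \<xi> T"
proof (intro ext)
  fix x t
  obtain n where "\<not> chain T n x t" using admissibleD(5)[OF assms(1)] by blast
  then show "f x t = left_spin \<xi> T x t"
    using solution_eq_approx[OF assms] left_spin_eq_approx[OF assms(1)] by simp
qed

section \<open>Monotonicity, symmetry and locality of the dynamics\<close>

lemma approx_mono:
  "(\<And>y. \<xi> y \<Longrightarrow> \<xi>' y) \<Longrightarrow> approx n \<xi> T x t \<Longrightarrow> approx n \<xi>' T x t"
proof (induction n arbitrary: x t)
  case (Suc n)
  then show ?case by (auto split: if_splits elim!: maj_mono[rotated])
qed simp

lemma left_spin_mono:
  "(\<And>y. \<xi> y \<Longrightarrow> \<xi>' y) \<Longrightarrow> left_spin \<xi> T x t \<Longrightarrow> left_spin \<xi>' T x t"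
  unfolding left_spin_def using approx_mono by blast

lemma approx_automorphism:
  assumes "automorphism \<phi>"
  shows "approx n (\<lambda>x. \<xi> (\<phi> x)) (\<lambda>x. T (\<phi> x)) x t = approx n \<xi> T (\<phi> x) t"
proof (induction n arbitrary: x t)
  case (Suc n)
  show ?case
    using maj_automorphism[OF assms, of x "\<lambda>y. approx n \<xi> T y (T (\<phi> x) (last_ring (T (\<phi> x)) t))"]
    by (simp add: Suc.IH)
qed simp

lemma left_spin_automorphism:
  assumes "automorphism \<phi>"
  shows "left_spin (\<lambda>x. \<xi> (\<phi> x)) (\<lambda>x. T (\<phi> x)) x t = left_spin \<xi> T (\<phi> x) t"
  unfolding left_spin_def approx_automorphism[OF assms] ..

text \<open>Three plus neighbours yield plus, and the cut-off reads initial spins at most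
  \<open>n\<close> steps away; so plus on this ball is enough, whatever the clocks do.\<close>

lemma approx_all_plus:
  "(\<And>m y. m \<le> n \<Longrightarrow> (adj ^^ m) x y \<Longrightarrow> \<xi> y) \<Longrightarrow> approx n \<xi> T x t"
proof (induction n arbitrary: x t)
  case (Suc n x t)
  have "\<xi> x" using Suc.prems[where m = 0 and y = x] by simp
  moreover have "approx n \<xi> T y s" if "adj x y" for y s
  proof (rule Suc.IH)
    fix m z assume "m \<le> n" "(adj ^^ m) y z"
    with that have "Suc m \<le> Suc n" "(adj ^^ Suc m) x z"
      by (simp, intro relpowp_Suc_I2[of adj x y])
    then show "\<xi> z" by (rule Suc.prems)
  qed
  ultimately show ?case by (auto intro: maj_all)
qed simp

lemma left_spin_plus_near:
  assumes T: "admissible T"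
  shows "\<exists>B. finite B \<and> (\<forall>\<xi>. (\<forall>y\<in>B. \<xi> y) \<longrightarrow> (\<forall>s\<le>t. left_spin \<xi> T x s))"
proof -
  obtain n where n: "\<not> chain T n x t" using admissibleD(5)[OF T] by blast
  let ?B = "\<Union>m\<le>n. {y. (adj ^^ m) x y}"
  have "left_spin \<xi> T x s" if "\<forall>y\<in>?B. \<xi> y" "s \<le> t" for \<xi> s
  proof -
    \<comment> \<open>Chains from an earlier time are chains from \<open>t\<close>, so a single
      depth, hence a single ball, serves all times up to \<open>t\<close>.\<close>
    have "\<not> chain T n x s" using n that(2) chain_time_mono by blast
    moreover have "approx n \<xi> T x s" using that(1) by (intro approx_all_plus) auto
    ultimately show ?thesis using left_spin_eq_approx[OF T] by simp
  qed
  then show ?thesis using finite_walk_targets by (intro exI[of _ ?B]) auto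
qed

text \<open>The solution for \<open>T\<close> also solves the recursion for \<open>T'\<close>, because before time \<open>t\<close> the rings in
  \<open>F\<close> only ever see plus spins.\<close>

lemma left_spin_clock_change:
  assumes T: "admissible T" and T': "admissible T'"
    and outside: "\<And>x. x \<notin> F \<Longrightarrow> T' x = T x"
    and late: "\<And>x k. x \<in> F \<Longrightarrow> k \<ge> n0 \<Longrightarrow> T' x k = T x k"
    and t: "\<And>x. x \<in> F \<Longrightarrow> T x n0 \<le> t"
    and plus: "\<And>x s. x \<in> F \<Longrightarrow> s \<le> t \<Longrightarrow> left_spin \<xi> T x s"
    and plus': "\<And>x y s. x \<in> F \<Longrightarrow> adj x y \<Longrightarrow> s \<le> t \<Longrightarrow> left_spin \<xi> T y s"
  shows "left_spin \<xi> T' = left_spin \<xi> T"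
proof (rule solution_unique[OF T', symmetric])
  show "is_solution \<xi> T' (left_spin \<xi> T)"
    unfolding is_solution_def
  proof (intro allI)
    fix x :: 'v and s :: real
    let ?rhs = "\<lambda>T'. if s \<le> T' x 0 then \<xi> x
      else maj x (\<lambda>y. left_spin \<xi> T y (T' x (last_ring (T' x) s)))"
    have eq: "left_spin \<xi> T x s = ?rhs T"
      using solution_eq[OF left_spin_solution[OF T, of \<xi>], where x = x and t = s] by simp
    show "left_spin \<xi> T x s = ?rhs T'"
    proof (cases "x \<in> F")
      case False
      then have "T' x = T x" by (rule outside)
      then show ?thesis unfolding eq by simp
    next
      case True
      have le: "T x 0 \<le> T x n0" "T' x 0 \<le> T' x n0"
        using admissibleD(1)[OF T] admissibleD(1)[OF T'] by (auto simp: strict_mono_less_eq)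
      show ?thesis
      proof (cases "s \<le> t")
        case s: True
        have "T x 0 \<le> t" using le t[OF True] by simp
        then have "\<xi> x" using plus[OF True] left_spin_initial[OF T, where t = "T x 0" and x = x] by blast
        moreover have "maj x (\<lambda>y. left_spin \<xi> T y (T' x (last_ring (T' x) s)))" if "\<not> s \<le> T' x 0"
        proof (rule maj_all)
          fix y assume "adj x y"
          moreover have "T' x (last_ring (T' x) s) \<le> t"
            using admissible_last_ring(1)[OF T', of x s] that s by simp
          ultimately show "left_spin \<xi> T y (T' x (last_ring (T' x) s))" using plus' True by blast
        qed
        ultimately show ?thesis using plus True s by simp
      next
        case False
        then have s: "T x n0 < s" using t[OF True] by simp
        let ?k = "last_ring (T x) s"
        have k: "T x ?k < s" "s \<le> T x (Suc ?k)"
          using admissible_last_ring[OF T, of x s] s le by auto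
        \<comment> \<open>The last ring before \<open>s\<close> therefore has index at least
          \<open>n0\<close>, where the two clocks agree.\<close>
        have "T x n0 < T x (Suc ?k)" using s k by simp
        then have "n0 \<le> ?k" using strict_mono_less[OF admissibleD(1)[OF T]] by simp
        then have *: "T' x ?k = T x ?k" "T' x (Suc ?k) = T x (Suc ?k)" using late[OF True] by auto
        then have "last_ring (T' x) s = ?k"
          using k admissibleD(1)[OF T'] by (intro last_ring_eqI) auto
        moreover have "\<not> s \<le> T x 0" "\<not> s \<le> T' x 0" using le s late[OF True, of n0] by auto
        ultimately show ?thesis using eq * by simp
      qed
    qed
  qed
qed

section \<open>Flips and energy\<close>

text \<open>Sampling just before each ring loses nothing, because a spin is constant between its
  rings.\<close>

definition fixates :: "('v \<Rightarrow> bool) \<Rightarrow> ('v \<Rightarrow> nat \<Rightarrow> real) \<Rightarrow> 'v \<Rightarrow> bool" where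
  "fixates \<xi> T x \<longleftrightarrow> (\<exists>N. \<forall>n\<ge>N. left_spin \<xi> T x (T x n) = left_spin \<xi> T x (T x N))"

text \<open>A spin that does not fixate gets the default minus.\<close>

definition final :: "('v \<Rightarrow> bool) \<Rightarrow> ('v \<Rightarrow> nat \<Rightarrow> real) \<Rightarrow> 'v \<Rightarrow> bool" where
  "final \<xi> T x \<longleftrightarrow> (\<exists>N. \<forall>n\<ge>N. left_spin \<xi> T x (T x n))"

text \<open>The spin just before ring \<open>n + 1\<close> is the one set by ring \<open>n\<close>,
  so this is a flip at ring \<open>n\<close>.\<close>

definition flips :: "('v \<Rightarrow> bool) \<Rightarrow> ('v \<Rightarrow> nat \<Rightarrow> real) \<Rightarrow> 'v \<Rightarrow> nat \<Rightarrow> bool" where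
  "flips \<xi> T x n \<longleftrightarrow> left_spin \<xi> T x (T x (Suc n)) \<noteq> left_spin \<xi> T x (T x n)"

lemma finite_flips_fixates:
  assumes "finite {n. flips \<xi> T x n}"
  shows "fixates \<xi> T x"
proof -
  obtain N where N: "\<And>n. flips \<xi> T x n \<Longrightarrow> n < N"
    using assms by (metis (mono_tags) bounded_nat_set_is_finite finite_nat_set_iff_bounded mem_Collect_eq)
  have "left_spin \<xi> T x (T x n) = left_spin \<xi> T x (T x N)" if "n \<ge> N" for n
    using that
  proof (induction n rule: dec_induct)
    case (step n)
    then have "\<not> flips \<xi> T x n" using N[of n] by auto
    then show ?case using step by (simp add: flips_def)
  qed simp
  then show ?thesis unfolding fixates_def by blast
qed

lemma fixates_final:
  assumes T: "admissible T" and "fixates \<xi> T x"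
  shows "\<exists>t0. \<forall>t>t0. left_spin \<xi> T x t = final \<xi> T x"
proof -
  obtain N where N: "\<And>n. n \<ge> N \<Longrightarrow> left_spin \<xi> T x (T x n) = left_spin \<xi> T x (T x N)"
    using assms unfolding fixates_def by blast
  then have fin: "final \<xi> T x = left_spin \<xi> T x (T x N)"
    unfolding final_def by (metis nle_le)
  have "left_spin \<xi> T x t = final \<xi> T x" if "t > T x N" for t
  proof -
    let ?k = "last_ring (T x) t"
    have m: "strict_mono (T x)" using T by (rule admissibleD)
    have "T x 0 < t" using m that by (meson le_less_trans strict_mono_less_eq zero_le)
    note k = admissible_last_ring[OF T this]
    have "T x N < T x (Suc ?k)" using k that by simp
    then have "N < Suc ?k" using strict_mono_less[OF m] by simp
    have "left_spin \<xi> T x t = left_spin \<xi> T x (T x (Suc ?k))"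
      using left_spin_rec[OF T k] left_spin_rec[OF T, of x ?k "T x (Suc ?k)"] m
      by (simp add: strict_mono_less)
    then show ?thesis using N[of "Suc ?k"] \<open>N < Suc ?k\<close> fin by simp
  qed
  then show ?thesis by blast
qed

text \<open>The energy is the number of disagreeing edges. Since the degree is odd, each flip lowers it.\<close>

definition gain :: "('v \<Rightarrow> bool) \<Rightarrow> ('v \<Rightarrow> nat \<Rightarrow> real) \<Rightarrow> 'v \<Rightarrow> 'v \<Rightarrow> nat \<Rightarrow> bool" where
  "gain \<xi> T x y n \<longleftrightarrow> left_spin \<xi> T x (T x (Suc n)) \<noteq> left_spin \<xi> T y (T x n)
     \<and> left_spin \<xi> T x (T x n) = left_spin \<xi> T y (T x n)"

definition loss :: "('v \<Rightarrow> bool) \<Rightarrow> ('v \<Rightarrow> nat \<Rightarrow> real) \<Rightarrow> 'v \<Rightarrow> 'v \<Rightarrow> nat \<Rightarrow> bool" where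
  "loss \<xi> T x y n \<longleftrightarrow> left_spin \<xi> T x (T x (Suc n)) = left_spin \<xi> T y (T x n)
     \<and> left_spin \<xi> T x (T x n) \<noteq> left_spin \<xi> T y (T x n)"

text \<open>A spin that flips disagreed with at least two of its three neighbours, so at least two
  disagreements vanish and at most one appears. A ring without a flip changes no edge.\<close>

lemma flip_gain_loss:
  assumes T: "admissible T"
  shows "(\<Sum>y | adj x y. of_bool (gain \<xi> T x y n)) + of_bool (flips \<xi> T x n)
    \<le> (\<Sum>y | adj x y. of_bool (loss \<xi> T x y n) :: nat)"
proof -
  obtain a b c where abc: "{y. adj x y} = {a, b, c}" "a \<noteq> b" "a \<noteq> c" "b \<noteq> c"
    by (rule neighbours_obtain)
  have "T x n < T x (Suc n)" using admissibleD(1)[OF T] by (simp add: strict_mono_less)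
  then have "left_spin \<xi> T x (T x (Suc n)) = maj x (\<lambda>y. left_spin \<xi> T y (T x n))"
    by (intro left_spin_rec[OF T]) auto
  also have "\<dots> = (let u = left_spin \<xi> T a (T x n); v = left_spin \<xi> T b (T x n);
      w = left_spin \<xi> T c (T x n) in (u \<and> v) \<or> (u \<and> w) \<or> (v \<and> w))"
  proof -
    have "adj x y \<longleftrightarrow> y = a \<or> y = b \<or> y = c" for y using abc by blast
    then show ?thesis unfolding maj_def Let_def using abc by metis
  qed
  finally have m: "left_spin \<xi> T x (T x (Suc n)) = \<dots>" .
  have sum3: "(\<Sum>y\<in>{a, b, c}. h y) = h a + h b + h c" for h :: "'v \<Rightarrow> nat"
    using abc(2-4) by simp
  show ?thesis
    unfolding abc(1) sum3 gain_def loss_def flips_def m Let_def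
    by (cases "left_spin \<xi> T x (T x n)"; cases "left_spin \<xi> T a (T x n)";
        cases "left_spin \<xi> T b (T x n)"; cases "left_spin \<xi> T c (T x n)"; simp)
qed

section \<open>Bookkeeping of disagreements along one edge\<close>

definition rings_before :: "('v \<Rightarrow> nat \<Rightarrow> real) \<Rightarrow> 'v \<Rightarrow> real \<Rightarrow> nat set" where
  "rings_before T x t = {n. T x n < t}"

lemma finite_rings_before: assumes "admissible T" shows "finite (rings_before T x t)"
proof -
  have "eventually (\<lambda>n. t \<le> T x n) sequentially"
    using admissibleD(3)[OF assms, of x] by (simp add: filterlim_at_top)
  then obtain N where "\<And>n. n \<ge> N \<Longrightarrow> t \<le> T x n" by (auto simp: eventually_sequentially)
  then have "rings_before T x t \<subseteq> {..<N}" by (force simp: rings_before_def not_le[symmetric])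
  then show ?thesis by (rule finite_subset) simp
qed

lemma rings_before_step:
  assumes T: "admissible T" and "T x k < t" "t \<le> T x (Suc k)"
  shows "rings_before T x t = insert k (rings_before T x (T x k))"
proof -
  have m: "strict_mono (T x)" using T by (rule admissibleD)
  have "T x n < t \<longleftrightarrow> n \<le> k" for n
    using assms(2,3) strict_mono_less_eq[OF m, of n k] strict_mono_less_eq[OF m, of "Suc k" n]
    by (cases "n \<le> k") auto
  then show ?thesis using strict_mono_less[OF m, of _ k] by (auto simp: rings_before_def)
qed

text \<open>A conservation law: the present disagreement is the initial one plus gains minus losses,
  over the rings of both ends. The losses stand on the left so that natural numbers suffice.\<close>

lemma edge_balance:
  assumes T: "admissible T" and xy: "adj x y"
  shows "of_bool (left_spin \<xi> T x t \<noteq> left_spin \<xi> T y t)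
      + card {n \<in> rings_before T x t. loss \<xi> T x y n} + card {n \<in> rings_before T y t. loss \<xi> T y x n}
    = of_bool (\<xi> x \<noteq> \<xi> y)
      + card {n \<in> rings_before T x t. gain \<xi> T x y n} + (card {n \<in> rings_before T y t. gain \<xi> T y x n} :: nat)"
    (is "?P x y t")
  using xy
proof (induction "card (rings_before T x t) + card (rings_before T y t)" arbitrary: x y t
    rule: less_induct)
  case less
  \<comment> \<open>Undo the last ring before \<open>t\<close>, here one of \<open>x\<close>; since
    that ring \<open>y\<close> has not rung, so its spin and its ring count are unchanged.\<close>
  have step: "?P x y t"
    if yx: "rings_before T y t \<noteq> {} \<Longrightarrow> T y (last_ring (T y) t) < T x (last_ring (T x) t)"
      and rx: "rings_before T x t \<noteq> {}" and xy: "adj x y"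
      and IH: "\<And>t'. card (rings_before T x t') + card (rings_before T y t')
        < card (rings_before T x t) + card (rings_before T y t) \<Longrightarrow>
        ?P x y t'"
    for x y
  proof -
    let ?k = "last_ring (T x) t"
    let ?s = "T x ?k"
    have m: "strict_mono (T x)" and my: "strict_mono (T y)" using T by (auto intro: admissibleD)
    obtain n0 where "T x n0 < t" using rx by (auto simp: rings_before_def)
    then have "T x 0 < t" using strict_mono_less_eq[OF m, of 0 n0] by simp
    note k = admissible_last_ring[OF T this]
    have Rx: "rings_before T x t = insert ?k (rings_before T x ?s)"
      using rings_before_step[OF T k] .
    have nin: "?k \<notin> rings_before T x ?s" by (simp add: rings_before_def)
    have Ry: "rings_before T y t = rings_before T y ?s \<and> left_spin \<xi> T y t = left_spin \<xi> T y ?s"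
    proof (cases "rings_before T y t = {}")
      case True
      then have "\<not> T y 0 < t" unfolding rings_before_def by blast
      then have ts: "t \<le> T y 0" "?s \<le> T y 0" using k(1) by simp_all
      have "?s \<le> T y n" for n
        using ts(2) strict_mono_less_eq[OF my, of 0 n] by simp
      then have "rings_before T y ?s = {}" by (simp add: rings_before_def not_less)
      then show ?thesis
        using True left_spin_initial[OF T ts(1)] left_spin_initial[OF T ts(2)] by simp
    next
      case False
      let ?j = "last_ring (T y) t"
      obtain n0 where "T y n0 < t" using False by (auto simp: rings_before_def)
      then have "T y 0 < t" using strict_mono_less_eq[OF my, of 0 n0] by simp
      note j = admissible_last_ring[OF T this]
      have j': "T y ?j < ?s" "?s \<le> T y (Suc ?j)" using yx[OF False] k j by auto
      show ?thesis
        by (intro conjI trans[OF rings_before_step[OF T j] rings_before_step[OF T j', symmetric]]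
            trans[OF left_spin_rec[OF T j] left_spin_rec[OF T j', symmetric]])
    qed
    have sx: "left_spin \<xi> T x t = left_spin \<xi> T x (T x (Suc ?k))"
      using left_spin_rec[OF T k] left_spin_rec[OF T, of x ?k "T x (Suc ?k)"] k by simp
    have "card (rings_before T x ?s) + card (rings_before T y ?s)
        < card (rings_before T x t) + card (rings_before T y t)"
      using Rx Ry nin finite_rings_before[OF T, of x ?s] by simp
    note IH = IH[OF this]
    have fin: "finite {n \<in> rings_before T x ?s. P n}" for P using finite_rings_before[OF T] by simp
    have c: "card {n \<in> rings_before T x t. P n} = card {n \<in> rings_before T x ?s. P n} + of_bool (P ?k)" for P
    proof (cases "P ?k")
      case True
      then have "{n \<in> rings_before T x t. P n} = insert ?k {n \<in> rings_before T x ?s. P n}"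
        using Rx by auto
      then show ?thesis using True nin fin[of P] by simp
    next
      case False
      then have "{n \<in> rings_before T x t. P n} = {n \<in> rings_before T x ?s. P n}"
        using Rx by auto
      then show ?thesis using False by simp
    qed
    have "of_bool (left_spin \<xi> T x t \<noteq> left_spin \<xi> T y t) + of_bool (loss \<xi> T x y ?k)
      = of_bool (left_spin \<xi> T x ?s \<noteq> left_spin \<xi> T y ?s) + (of_bool (gain \<xi> T x y ?k) :: nat)"
      using sx Ry by (auto simp: gain_def loss_def)
    then show ?thesis unfolding c using IH Ry by simp
  qed
  show ?case
  proof (cases "rings_before T x t = {} \<and> rings_before T y t = {}")
    case True
    then have "\<not> T x 0 < t" "\<not> T y 0 < t" unfolding rings_before_def by blast+
    then have "t \<le> T x 0" "t \<le> T y 0" by simp_all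
    then show ?thesis using True left_spin_initial[OF T] by simp
  next
    case False
    \<comment> \<open>Adjacent clocks never ring simultaneously, so one end rang strictly
      last.\<close>
    consider "rings_before T x t \<noteq> {}"
        "rings_before T y t \<noteq> {} \<longrightarrow> T y (last_ring (T y) t) < T x (last_ring (T x) t)"
      | "rings_before T y t \<noteq> {}"
        "rings_before T x t \<noteq> {} \<longrightarrow> T x (last_ring (T x) t) < T y (last_ring (T y) t)"
      using False admissibleD(4)[OF T less.prems, of "last_ring (T x) t" "last_ring (T y) t"]
      by (meson linorder_less_linear)
    then show ?thesis
    proof cases
      case 1
      then show ?thesis using less by (intro step) blast+
    next
      case 2
      have "adj y x" using less.prems adj_commute by blast
      have "?P y x t"
        using 2 \<open>adj y x\<close> less.hyps[of y _ x] by (intro step) (auto simp: add.commute)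
      then show ?thesis by (simp add: eq_commute add_ac)
    qed
  qed
qed

end

section \<open>Infinite products of probability laws on the real line\<close>

definition depends_on :: "'i set \<Rightarrow> ('i \<Rightarrow> real) set \<Rightarrow> bool" where
  "depends_on J C \<longleftrightarrow> (\<forall>\<omega> \<omega>'. (\<forall>i\<in>J. \<omega> i = \<omega>' i) \<longrightarrow> \<omega> \<in> C \<longleftrightarrow> \<omega>' \<in> C)"

lemma depends_onD: "depends_on J C \<Longrightarrow> (\<And>i. i \<in> J \<Longrightarrow> \<omega> i = \<omega>' i) \<Longrightarrow> \<omega> \<in> C \<longleftrightarrow> \<omega>' \<in> C"
  unfolding depends_on_def by blast

lemma depends_on_mono: "depends_on J C \<Longrightarrow> J \<subseteq> K \<Longrightarrow> depends_on K C"
  unfolding depends_on_def by blast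

lemma depends_on_Compl: "depends_on J C \<Longrightarrow> depends_on J (- C)"
  unfolding depends_on_def by blast

lemma depends_on_INT: "(\<And>a. a \<in> A \<Longrightarrow> depends_on J (C a)) \<Longrightarrow> depends_on J (\<Inter>a\<in>A. C a)"
  unfolding depends_on_def by blast

lemma depends_on_UN: "(\<And>a. a \<in> A \<Longrightarrow> depends_on J (C a)) \<Longrightarrow> depends_on J (\<Union>a\<in>A. C a)"
  unfolding depends_on_def by blast

lemma depends_on_vimage:
  "depends_on J C \<Longrightarrow> depends_on (\<pi> ` J) {\<omega>. (\<lambda>i. \<omega> (\<pi> i)) \<in> C}"
  unfolding depends_on_def by auto

locale real_product =
  fixes law :: "'i \<Rightarrow> real measure"
  assumes prob_space_law: "prob_space (law i)"
    and sets_law: "sets (law i) = sets borel"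
begin

definition joint :: "('i \<Rightarrow> real) measure" where
  "joint = PiM UNIV law"

sublocale prob_space joint
  unfolding joint_def by (rule prob_space_PiM) (rule prob_space_law)

lemma space_law: "space (law i) = UNIV"
  using sets_eq_imp_space_eq[OF sets_law] by simp

lemma space_joint [simp]: "space joint = UNIV"
  by (simp add: joint_def space_PiM space_law)

lemma measurable_law: "measurable N (law i) = borel_measurable N"
  by (rule measurable_cong_sets[OF refl sets_law])

lemma coord_measurable: "(\<lambda>\<omega>. \<omega> i) \<in> borel_measurable joint"
proof -
  have "(\<lambda>\<omega>. \<omega> i) \<in> measurable joint (law i)"
    unfolding joint_def by (rule measurable_component_singleton) simp
  then show ?thesis by (simp add: measurable_law)
qed

lemma measurable_jointI:
  assumes "\<And>i. (\<lambda>\<omega>. f \<omega> i) \<in> borel_measurable N"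
  shows "f \<in> measurable N joint"
  unfolding joint_def
proof (rule measurable_PiM_single')
  show "f \<in> space N \<rightarrow> (\<Pi>\<^sub>E i\<in>UNIV. space (law i))" by (simp add: space_law)
  show "\<And>i. (\<lambda>\<omega>. f \<omega> i) \<in> measurable N (law i)"
    using assms by (simp add: measurable_law)
qed

lemma distr_reindex:
  assumes "inj \<pi>" "\<And>i. law (\<pi> i) = law i"
  shows "distr joint joint (\<lambda>\<omega> i. \<omega> (\<pi> i)) = joint"
proof -
  have "distr (PiM UNIV law) (PiM UNIV (\<lambda>i. law (\<pi> i))) (\<lambda>\<omega>. \<lambda>n\<in>UNIV. \<omega> (\<pi> n)) = PiM UNIV (\<lambda>i. law (\<pi> i))"
    using assms(1) prob_space_law by (intro distr_PiM_reindex) auto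
  then show ?thesis using assms(2) by (simp add: joint_def restrict_def)
qed

lemma reindex_measurable [measurable]: "(\<lambda>\<omega> i. \<omega> (\<pi> i)) \<in> measurable joint joint"
  by (rule measurable_jointI) (rule coord_measurable)

lemma AE_reindex:
  assumes "inj \<pi>" "\<And>i. law (\<pi> i) = law i" "AE \<omega> in joint. Q \<omega>"
  shows "AE \<omega> in joint. Q (\<lambda>i. \<omega> (\<pi> i))"
  by (rule AE_distrD[OF reindex_measurable]) (subst distr_reindex[OF assms(1,2)], rule assms(3))

lemma prob_reindex:
  assumes "inj \<pi>" "\<And>i. law (\<pi> i) = law i" "C \<in> sets joint"
  shows "prob {\<omega>. (\<lambda>i. \<omega> (\<pi> i)) \<in> C} = prob C"
proof -
  have "prob C = measure (distr joint joint (\<lambda>\<omega> i. \<omega> (\<pi> i))) C"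
    using distr_reindex[OF assms(1,2)] by simp
  also have "\<dots> = prob {\<omega>. (\<lambda>i. \<omega> (\<pi> i)) \<in> C}"
    using assms(3) by (subst measure_distr) (auto simp: vimage_def)
  finally show ?thesis ..
qed

lemma resample_measurable [measurable]:
  "(\<lambda>(u, \<omega>). fun_upd \<omega> i u) \<in> measurable (law i \<Otimes>\<^sub>M joint) joint"
proof (rule measurable_jointI)
  fix j
  have "(\<lambda>p. fst p) \<in> borel_measurable (law i \<Otimes>\<^sub>M joint)"
    using measurable_fst[of "law i" joint] unfolding measurable_law .
  moreover have "(\<lambda>p. snd p j) \<in> borel_measurable (law i \<Otimes>\<^sub>M joint)"
    by (rule measurable_compose[OF measurable_snd coord_measurable])
  ultimately show "(\<lambda>p. (case p of (u, \<omega>) \<Rightarrow> fun_upd \<omega> i u) j) \<in> borel_measurable (law i \<Otimes>\<^sub>M joint)"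
    by (cases "j = i") (auto simp: case_prod_beta)
qed

text \<open>Overwriting a coordinate by an independent sample preserves the product law. Together
  with Fubini this plays the part of conditioning on all other coordinates.\<close>

lemma distr_resample: "distr (law i \<Otimes>\<^sub>M joint) joint (\<lambda>(u, \<omega>). fun_upd \<omega> i u) = joint"
  using distr_pair_PiM_eq_PiM[of UNIV law i] prob_space_law by (simp add: joint_def)

lemma pair_sigma_finite_law_joint: "pair_sigma_finite (law i) joint"
  using prob_space_law[of i] prob_space_axioms
  by (intro pair_sigma_finite.intro) (simp_all add: prob_space_imp_sigma_finite)

lemma AE_resample:
  assumes "AE \<omega> in joint. Q \<omega>"
  shows "AE \<omega> in joint. AE u in law i. Q (fun_upd \<omega> i u)"
proof -
  interpret pair_sigma_finite "law i" joint by (rule pair_sigma_finite_law_joint)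
  interpret sw: pair_sigma_finite joint "law i" ..
  have "AE p in law i \<Otimes>\<^sub>M joint. Q (case p of (u, \<omega>) \<Rightarrow> fun_upd \<omega> i u)"
    by (rule AE_distrD[OF resample_measurable]) (subst distr_resample, rule assms)
  then have "AE p in distr (joint \<Otimes>\<^sub>M law i) (law i \<Otimes>\<^sub>M joint) (\<lambda>(x, y). (y, x)).
      Q (case p of (u, \<omega>) \<Rightarrow> fun_upd \<omega> i u)"
    by (subst distr_pair_swap[symmetric])
  then have "AE p in joint \<Otimes>\<^sub>M law i. Q (fun_upd (fst p) i (snd p))"
    by (drule_tac AE_distrD[rotated]) (simp_all add: case_prod_beta measurable_pair_swap')
  then show ?thesis by (auto dest: sw.AE_pair)
qed

lemma nn_integral_resample:
  assumes [measurable]: "f \<in> borel_measurable joint"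
  shows "(\<integral>\<^sup>+u. \<integral>\<^sup>+\<omega>. f (fun_upd \<omega> i u) \<partial>joint \<partial>law i) = (\<integral>\<^sup>+\<omega>. f \<omega> \<partial>joint)"
proof -
  interpret pair_sigma_finite "law i" joint by (rule pair_sigma_finite_law_joint)
  have m: "(\<lambda>p. f (case p of (u, \<omega>) \<Rightarrow> fun_upd \<omega> i u)) \<in> borel_measurable (law i \<Otimes>\<^sub>M joint)"
    using measurable_compose[OF resample_measurable assms] .
  have "(\<integral>\<^sup>+\<omega>. f \<omega> \<partial>joint) = (\<integral>\<^sup>+p. f (case p of (u, \<omega>) \<Rightarrow> fun_upd \<omega> i u) \<partial>(law i \<Otimes>\<^sub>M joint))"
  proof -
    have "(\<integral>\<^sup>+\<omega>. f \<omega> \<partial>distr (law i \<Otimes>\<^sub>M joint) joint (\<lambda>(u, \<omega>). fun_upd \<omega> i u))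
      = (\<integral>\<^sup>+p. f (case p of (u, \<omega>) \<Rightarrow> fun_upd \<omega> i u) \<partial>(law i \<Otimes>\<^sub>M joint))"
      by (rule nn_integral_distr[OF resample_measurable]) simp
    then show ?thesis by (simp only: distr_resample)
  qed
  also have "\<dots> = (\<integral>\<^sup>+u. \<integral>\<^sup>+\<omega>. f (fun_upd \<omega> i u) \<partial>joint \<partial>law i)"
    using sigma_finite_measure.nn_integral_fst[OF prob_space_imp_sigma_finite[OF prob_space_axioms] m]
    by simp
  finally show ?thesis ..
qed

section \<open>Coordinates and independence of disjoint blocks\<close>

lemma distr_component: "distr joint (law i) (\<lambda>\<omega>. \<omega> i) = law i"
proof -
  interpret product_prob_space law UNIV
    using prob_space_law
    by (intro product_prob_space.intro product_prob_space_axioms.intro product_sigma_finite.intro)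
      (simp_all add: prob_space_imp_sigma_finite)
  show ?thesis unfolding joint_def by (rule PiM_component) simp
qed

lemma indep_vars_coords: "indep_vars law (\<lambda>i \<omega>. \<omega> i) UNIV"
proof (subst indep_vars_iff_distr_eq_PiM')
  show "(\<lambda>\<omega>. \<omega> i) \<in> measurable joint (law i)" for i
    unfolding measurable_law by (rule coord_measurable)
  show "distr joint (PiM UNIV law) (\<lambda>\<omega>. \<lambda>i\<in>UNIV. \<omega> i) = PiM UNIV (\<lambda>i. distr joint (law i) (\<lambda>\<omega>. \<omega> i))"
    unfolding distr_component by (simp add: joint_def[symmetric] distr_id restrict_def)
qed simp

lemma indep_vars_coords_borel: "indep_vars (\<lambda>_. borel) (\<lambda>i \<omega>. \<omega> i) UNIV"
  using indep_vars_compose[OF indep_vars_coords, of "\<lambda>_ x. x" "\<lambda>_. borel"]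
  by (simp add: measurable_cong_sets[OF sets_law refl] comp_def)

lemma distr_coord: "distr joint borel (\<lambda>\<omega>. \<omega> i) = law i"
proof -
  have "distr joint borel (\<lambda>\<omega>. \<omega> i) = distr joint (law i) (\<lambda>\<omega>. \<omega> i)"
    by (rule distr_cong) (simp_all add: sets_law)
  then show ?thesis by (simp only: distr_component)
qed

lemma prob_Int_depends_on:
  assumes C: "C \<in> sets joint" "depends_on J C" and D: "D \<in> sets joint" "depends_on K D"
    and JK: "J \<inter> K = {}"
  shows "prob (C \<inter> D) = prob C * prob D"
proof -
  \<comment> \<open>Padding with 0 turns a partial configuration into a full one. An event that
    depends only on \<open>J\<close> does not see the padding, so it becomes a preimage under
    restriction to \<open>J\<close>.\<close>
  define ext where "ext J f = (\<lambda>i. if i \<in> J then f i else (0::real))" for J :: "'i set" and f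
  have ext [measurable]: "ext J \<in> measurable (PiM J law) joint" for J
  proof (rule measurable_jointI)
    fix i show "(\<lambda>f. ext J f i) \<in> borel_measurable (PiM J law)"
    proof (cases "i \<in> J")
      case True
      have "(\<lambda>f. f i) \<in> measurable (PiM J law) (law i)"
        by (rule measurable_component_singleton) fact
      then show ?thesis using True by (simp add: ext_def measurable_cong_sets[OF refl sets_law])
    qed (simp add: ext_def)
  qed
  let ?X = "\<lambda>J C. ext J -` C \<inter> space (PiM J law)"
  have iv: "indep_var (PiM J law) (\<lambda>\<omega>. restrict (\<lambda>i. \<omega> i) J) (PiM K law) (\<lambda>\<omega>. restrict (\<lambda>i. \<omega> i) K)"
    using indep_var_restrict[OF indep_vars_coords JK] by simp
  have 1: "(\<lambda>\<omega>. restrict (\<lambda>i. \<omega> i) J) -` ?X J C \<inter> space joint = C"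
    if "depends_on J C" for J C
  proof -
    have "ext J (restrict \<omega> J) \<in> C \<longleftrightarrow> \<omega> \<in> C" for \<omega>
      by (rule depends_onD[OF that]) (simp add: ext_def)
    then show ?thesis by (auto simp: space_PiM space_law)
  qed
  have "prob ((\<lambda>\<omega>. (restrict (\<lambda>i. \<omega> i) J, restrict (\<lambda>i. \<omega> i) K)) -` (?X J C \<times> ?X K D) \<inter> space joint)
     = prob ((\<lambda>\<omega>. restrict (\<lambda>i. \<omega> i) J) -` ?X J C \<inter> space joint)
      * prob ((\<lambda>\<omega>. restrict (\<lambda>i. \<omega> i) K) -` ?X K D \<inter> space joint)"
    by (intro indep_varD[OF iv] measurable_sets[OF ext] C(1) D(1))
  moreover have "(\<lambda>\<omega>. (restrict (\<lambda>i. \<omega> i) J, restrict (\<lambda>i. \<omega> i) K)) -` (?X J C \<times> ?X K D) \<inter> space joint = C \<inter> D"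
  proof -
    have "(\<lambda>\<omega>. (restrict (\<lambda>i. \<omega> i) J, restrict (\<lambda>i. \<omega> i) K)) -` (?X J C \<times> ?X K D) \<inter> space joint
      = ((\<lambda>\<omega>. restrict (\<lambda>i. \<omega> i) J) -` ?X J C \<inter> space joint)
        \<inter> ((\<lambda>\<omega>. restrict (\<lambda>i. \<omega> i) K) -` ?X K D \<inter> space joint)"
      by auto
    then show ?thesis unfolding 1[OF C(2)] 1[OF D(2)] .
  qed
  ultimately show ?thesis unfolding 1[OF C(2)] 1[OF D(2)] by simp
qed

lemma prob_INT_depends_on:
  assumes "finite A" and C: "\<And>a. a \<in> A \<Longrightarrow> C a \<in> sets joint" "\<And>a. a \<in> A \<Longrightarrow> depends_on (J a) (C a)"
    and "disjoint_family_on J A"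
  shows "prob (\<Inter>a\<in>A. C a) = (\<Prod>a\<in>A. prob (C a))"
  using assms
proof (induction A rule: finite_induct)
  case empty
  then show ?case using prob_space by simp
next
  case (insert a A)
  show ?case
  proof (cases "A = {}")
    case False
    have "J a \<inter> (\<Union>b\<in>A. J b) = {}"
      using insert.prems(3) insert.hyps(2) by (auto simp: disjoint_family_on_def)
    moreover have "depends_on (\<Union>b\<in>A. J b) (\<Inter>b\<in>A. C b)"
    proof (rule depends_on_INT)
      fix b assume "b \<in> A"
      then show "depends_on (\<Union>b\<in>A. J b) (C b)"
        by (intro depends_on_mono[OF insert.prems(2)[of b]]) blast+
    qed
    moreover have "(\<Inter>b\<in>A. C b) \<in> sets joint"
      using insert.prems(1) by (intro sets.finite_INT insert.hyps(1) False) simp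
    ultimately have "prob (C a \<inter> (\<Inter>b\<in>A. C b)) = prob (C a) * prob (\<Inter>b\<in>A. C b)"
      using insert.prems(1,2) by (intro prob_Int_depends_on[of _ "J a" _ "\<Union>b\<in>A. J b"]) simp_all
    moreover have "prob (\<Inter>b\<in>A. C b) = (\<Prod>b\<in>A. prob (C b))"
      using insert.prems by (intro insert.IH) (auto simp: disjoint_family_on_def)
    ultimately show ?thesis using insert.hyps by simp
  qed (use insert in simp)
qed

text \<open>Once the other coordinates are fixed, \<open>g\<close> is a constant, and an atomless
  coordinate avoids a constant almost surely.\<close>

lemma AE_coord_neq:
  assumes g [measurable]: "g \<in> borel_measurable joint"
    and indep: "\<And>\<omega> u. g (fun_upd \<omega> i u) = g \<omega>"
    and atomless: "\<And>c. emeasure (law i) {c} = 0"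
  shows "AE \<omega> in joint. \<omega> i \<noteq> g \<omega>"
proof -
  have N: "{\<omega>. \<omega> i = g \<omega>} \<in> sets joint"
    using borel_measurable_eq[OF coord_measurable g, of i] by simp
  then have m: "(\<lambda>\<omega>. indicator {\<omega>. \<omega> i = g \<omega>} \<omega> :: ennreal) \<in> borel_measurable joint"
    by (rule borel_measurable_indicator)
  interpret pair_sigma_finite "law i" joint by (rule pair_sigma_finite_law_joint)
  have "emeasure joint {\<omega>. \<omega> i = g \<omega>} = (\<integral>\<^sup>+\<omega>. indicator {\<omega>. \<omega> i = g \<omega>} \<omega> \<partial>joint)"
    using N by simp
  also have "\<dots> = (\<integral>\<^sup>+u. \<integral>\<^sup>+\<omega>. indicator {\<omega>. \<omega> i = g \<omega>} (fun_upd \<omega> i u) \<partial>joint \<partial>law i)"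
    using nn_integral_resample[OF m] by simp
  also have "\<dots> = (\<integral>\<^sup>+\<omega>. \<integral>\<^sup>+u. indicator {\<omega>. \<omega> i = g \<omega>} (fun_upd \<omega> i u) \<partial>law i \<partial>joint)"
    using measurable_compose[OF resample_measurable m, of i]
    by (intro Fubini'[symmetric]) (simp only: case_prod_beta case_prod_beta')
  also have "\<dots> = (\<integral>\<^sup>+\<omega>. \<integral>\<^sup>+u. indicator {g \<omega>} u \<partial>law i \<partial>joint)"
    by (intro nn_integral_cong) (auto simp: indicator_def indep)
  also have "\<dots> = (\<integral>\<^sup>+\<omega>. 0 \<partial>joint)"
    by (intro nn_integral_cong) (simp add: sets_law atomless)
  also have "\<dots> = 0" by simp
  finally have "emeasure joint {\<omega>. \<omega> i = g \<omega>} = 0" .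
  with N show ?thesis by (intro AE_I[of _ _ "{\<omega>. \<omega> i = g \<omega>}"]) auto
qed

text \<open>The events that can be approximated in this way contain the one-coordinate events and
  are closed under complements and countable unions.\<close>

lemma cylinder_approx:
  assumes "A \<in> sets joint" "\<epsilon> > 0"
  shows "\<exists>J C. finite J \<and> C \<in> sets joint \<and> depends_on J C \<and> prob (A - C \<union> (C - A)) < \<epsilon>"
proof -
  have gen: "sets joint = sigma_sets UNIV {{\<omega>. \<omega> i \<in> S} | i S. S \<in> sets borel}"
    unfolding joint_def sets_PiM_single by (simp add: space_law sets_law)
  from assms(1) have "A \<in> sigma_sets UNIV {{\<omega>. \<omega> i \<in> S} | i S. S \<in> sets borel}"
    unfolding gen .
  then show ?thesis using assms(2)
  proof (induction arbitrary: \<epsilon> rule: sigma_sets.induct)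
    case (Basic a)
    then obtain i S where a: "a = {\<omega>. \<omega> i \<in> S}" "S \<in> sets borel" by blast
    have "a \<in> sets joint" unfolding gen using Basic(1) by (rule sigma_sets.Basic)
    moreover have "depends_on {i} a" using a by (auto simp: depends_on_def)
    ultimately show ?case using Basic(2) by (intro exI[of _ "{i}"] exI[of _ a]) simp
  next
    case Empty
    then show ?case by (intro exI[of _ "{}"] exI[of _ "{}"]) (simp add: depends_on_def)
  next
    case (Compl a)
    from Compl.IH[OF Compl.prems] obtain J C where C: "finite J" "C \<in> sets joint"
      "depends_on J C" "prob (a - C \<union> (C - a)) < \<epsilon>" by blast
    have "(UNIV - a) - (- C) \<union> (- C - (UNIV - a)) = a - C \<union> (C - a)" by blast
    with C show ?case
      by (intro exI[of _ J] exI[of _ "- C"])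
        (simp add: depends_on_Compl sets.compl_sets[of C joint, unfolded space_joint, folded Compl_eq_Diff_UNIV])
  next
    case (Union a)
    have aM [measurable]: "a n \<in> sets joint" for n unfolding gen using Union(1) .
    have "(\<lambda>n. prob (\<Union>i\<le>n. a i)) \<longlonglongrightarrow> prob (\<Union>n. \<Union>i\<le>n. a i)"
      by (intro finite_Lim_measure_incseq) (auto simp: incseq_def intro: order_trans)
    moreover have "(\<Union>n. \<Union>i\<le>n. a i) = (\<Union>n. a n)" by auto
    ultimately have "(\<lambda>n. prob (\<Union>i\<le>n. a i)) \<longlonglongrightarrow> prob (\<Union>n. a n)" by simp
    then have "eventually (\<lambda>n. dist (prob (\<Union>i\<le>n. a i)) (prob (\<Union>n. a n)) < \<epsilon> / 2) sequentially"
      using Union.prems by (intro tendstoD) auto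
    then obtain n where n: "dist (prob (\<Union>i\<le>n. a i)) (prob (\<Union>n. a n)) < \<epsilon> / 2"
      by (auto simp: eventually_sequentially)
    \<comment> \<open>Half of the error pays for truncating the union; the other half is shared by
      the \<open>n + 1\<close> remaining sets.\<close>
    let ?\<delta> = "\<epsilon> / (2 * (real n + 1))"
    have "?\<delta> > 0" using Union.prems by simp
    then have "\<forall>i. \<exists>J C. finite J \<and> C \<in> sets joint \<and> depends_on J C \<and> prob (a i - C \<union> (C - a i)) < ?\<delta>"
      using Union.IH by blast
    then obtain J C where JC: "\<And>i. finite (J i)" "\<And>i. C i \<in> sets joint"
      "\<And>i. depends_on (J i) (C i)" "\<And>i. prob (a i - C i \<union> (C i - a i)) < ?\<delta>" by metis
    note [measurable] = JC(2)
    let ?U = "\<Union>n. a n" and ?V = "\<Union>i\<le>n. a i" and ?W = "\<Union>i\<le>n. C i"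
    have "prob (?U - ?W \<union> (?W - ?U)) \<le> prob ((?U - ?V) \<union> (\<Union>i\<le>n. a i - C i \<union> (C i - a i)))"
      by (intro finite_measure_mono) auto
    also have "\<dots> \<le> prob (?U - ?V) + prob (\<Union>i\<le>n. a i - C i \<union> (C i - a i))"
      by (intro measure_Un_le) auto
    also have "prob (?U - ?V) = prob ?U - prob ?V" by (intro finite_measure_Diff) auto
    also have "\<dots> < \<epsilon> / 2" using n unfolding dist_real_def by linarith
    also have "prob (\<Union>i\<le>n. a i - C i \<union> (C i - a i)) \<le> (\<Sum>i\<le>n. prob (a i - C i \<union> (C i - a i)))"
      by (intro finite_measure_subadditive_finite) auto
    also have "\<dots> \<le> (\<Sum>i\<le>n. ?\<delta>)" using JC(4) by (intro sum_mono less_imp_le)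
    also have "\<dots> = \<epsilon> / 2" by (simp add: field_simps)
    finally have "prob (?U - ?W \<union> (?W - ?U)) < \<epsilon>" by simp
    moreover have "depends_on (\<Union>i\<le>n. J i) ?W"
    proof (rule depends_on_UN)
      fix b assume "b \<in> {..n}"
      then show "depends_on (\<Union>i\<le>n. J i) (C b)"
        by (intro depends_on_mono[OF JC(3)[of b]]) blast
    qed
    ultimately show ?case using JC(1)
      by (intro exI[of _ "\<Union>i\<le>n. J i"] exI[of _ ?W]) auto
  qed
qed

end

section \<open>Measurability of the dynamics\<close>

context cubic_tree
begin

lemma measurable_maj:
  assumes "\<And>y. Measurable.pred M (\<lambda>\<omega>. f \<omega> y)"
  shows "Measurable.pred M (\<lambda>\<omega>. maj x (f \<omega>))"
proof -
  have "(\<lambda>\<omega>. maj x (f \<omega>)) = (\<lambda>\<omega>. \<exists>y\<in>{y. adj x y}. \<exists>z\<in>{y. adj x y}. y \<noteq> z \<and> f \<omega> y \<and> f \<omega> z)"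
    unfolding maj_def by auto
  then show ?thesis
    using assms by (simp only:) (intro pred_intros_finite finite_neighbours pred_intros_logic; simp)
qed

lemma measurable_last_ring_time:
  assumes T: "\<And>n. (\<lambda>\<omega>. T \<omega> n) \<in> borel_measurable M" and t: "t \<in> borel_measurable M"
  shows "(\<lambda>\<omega>. T \<omega> (last_ring (T \<omega>) (t \<omega>))) \<in> borel_measurable M"
proof -
  have "(\<lambda>\<omega>. last_ring (T \<omega>) (t \<omega>)) \<in> measurable M (count_space UNIV)"
    unfolding last_ring_def using T t by measurable
  then show ?thesis by (rule measurable_compose_countable[OF T])
qed

text \<open>The time must be allowed to be random, because the recursion evaluates neighbours at
  ring times.\<close>

lemma measurable_approx:
  assumes \<xi>: "\<And>x. Measurable.pred M (\<lambda>\<omega>. \<xi> \<omega> x)"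
    and T: "\<And>x n. (\<lambda>\<omega>. T \<omega> x n) \<in> borel_measurable M"
    and "t \<in> borel_measurable M"
  shows "Measurable.pred M (\<lambda>\<omega>. approx n (\<xi> \<omega>) (T \<omega>) x (t \<omega>))"
  using assms(3)
proof (induction n arbitrary: x t)
  case 0
  then show ?case using \<xi> by simp
next
  case (Suc n)
  have s: "(\<lambda>\<omega>. T \<omega> x (last_ring (T \<omega> x) (t \<omega>))) \<in> borel_measurable M"
    using T Suc.prems by (rule measurable_last_ring_time)
  have [measurable]: "Measurable.pred M (\<lambda>\<omega>. maj x (\<lambda>y. approx n (\<xi> \<omega>) (T \<omega>) y (T \<omega> x (last_ring (T \<omega> x) (t \<omega>)))))"
    by (rule measurable_maj) (rule Suc.IH[OF s])
  have [measurable]: "Measurable.pred M (\<lambda>\<omega>. t \<omega> \<le> T \<omega> x 0)"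
    using T[of x 0] Suc.prems by measurable
  note [measurable] = \<xi>[of x]
  show ?case unfolding approx.simps by measurable
qed

lemma measurable_left_spin:
  assumes "\<And>x. Measurable.pred M (\<lambda>\<omega>. \<xi> \<omega> x)"
    and "\<And>x n. (\<lambda>\<omega>. T \<omega> x n) \<in> borel_measurable M"
    and "t \<in> borel_measurable M"
  shows "Measurable.pred M (\<lambda>\<omega>. left_spin (\<xi> \<omega>) (T \<omega>) x (t \<omega>))"
proof -
  note [measurable] = measurable_approx[OF assms]
  show ?thesis unfolding left_spin_def by measurable
qed

lemma measurable_chain:
  assumes T: "\<And>x n. (\<lambda>\<omega>. T \<omega> x n) \<in> borel_measurable M"
    and "t \<in> borel_measurable M"
  shows "Measurable.pred M (\<lambda>\<omega>. chain (T \<omega>) n x (t \<omega>))"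
  using assms(2)
proof (induction n arbitrary: x t)
  case (Suc n)
  have [measurable]: "Measurable.pred M (\<lambda>\<omega>. \<exists>y\<in>{y. adj x y}. chain (T \<omega>) n y (T \<omega> x k))" for k
    by (intro pred_intros_finite finite_neighbours Suc.IH T)
  have [measurable]: "Measurable.pred M (\<lambda>\<omega>. T \<omega> x k < t \<omega>)" for k
    using T[of x k] Suc.prems by measurable
  have "(\<lambda>\<omega>. chain (T \<omega>) (Suc n) x (t \<omega>))
      = (\<lambda>\<omega>. \<exists>k. T \<omega> x k < t \<omega> \<and> (\<exists>y\<in>{y. adj x y}. chain (T \<omega>) n y (T \<omega> x k)))"
    by simp
  then show ?case by (simp only:) measurable
qed simp

lemma strict_mono_at_top_iff:
  assumes "strict_mono (\<tau> :: nat \<Rightarrow> real)"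
  shows "filterlim \<tau> at_top sequentially \<longleftrightarrow> (\<forall>m::nat. \<exists>n. real m \<le> \<tau> n)"
proof
  assume L: "filterlim \<tau> at_top sequentially"
  show "\<forall>m::nat. \<exists>n. real m \<le> \<tau> n"
  proof
    fix m :: nat
    from L have "eventually (\<lambda>n. real m \<le> \<tau> n) sequentially" by (simp add: filterlim_at_top)
    then show "\<exists>n. real m \<le> \<tau> n" by (auto simp: eventually_sequentially)
  qed
next
  assume *: "\<forall>m::nat. \<exists>n. real m \<le> \<tau> n"
  show "filterlim \<tau> at_top sequentially"
    unfolding filterlim_at_top
  proof
    fix Z :: real
    obtain m :: nat where "Z \<le> real m" using real_arch_simple by blast
    moreover obtain n where "real m \<le> \<tau> n" using * by blast
    ultimately have "Z \<le> \<tau> k" if "k \<ge> n" for k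
      using strict_mono_less_eq[OF assms, of n k] that by linarith
    then show "eventually (\<lambda>n. Z \<le> \<tau> n) sequentially" by (auto simp: eventually_sequentially)
  qed
qed

text \<open>Chains are monotone in time, so natural times suffice; only countable quantifiers
  remain, which is what measurability needs.\<close>

lemma admissible_countable_iff:
  "admissible T \<longleftrightarrow>
     (\<forall>x. (\<forall>n. T x n < T x (Suc n)) \<and> 0 < T x 0 \<and> (\<forall>m::nat. \<exists>n. real m \<le> T x n)
        \<and> (\<forall>m::nat. \<exists>n. \<not> chain T n x (real m)))
     \<and> (\<forall>x. \<forall>y\<in>{y. adj x y}. \<forall>n m. T x n \<noteq> T y m)"
proof -
  have 1: "strict_mono (T x) \<longleftrightarrow> (\<forall>n. T x n < T x (Suc n))" for x
    by (rule strict_mono_Suc_iff)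
  have 2: "(\<forall>t. \<exists>n. \<not> chain T n x t) \<longleftrightarrow> (\<forall>m::nat. \<exists>n. \<not> chain T n x (real m))" for x
  proof
    assume *: "\<forall>m::nat. \<exists>n. \<not> chain T n x (real m)"
    show "\<forall>t. \<exists>n. \<not> chain T n x t"
    proof
      fix t
      obtain m :: nat where "t \<le> real m" using real_arch_simple by blast
      then show "\<exists>n. \<not> chain T n x t" using * chain_time_mono by blast
    qed
  qed blast
  show ?thesis unfolding admissible_def using strict_mono_at_top_iff[of "T _"] 1 2 by auto
qed

lemma pred_all_vertices:
  assumes "\<And>x :: 'v. Measurable.pred M (\<lambda>\<omega>. P \<omega> x)"
  shows "Measurable.pred M (\<lambda>\<omega>. \<forall>x. P \<omega> x)"
proof -
  have "(\<Inter>x\<in>UNIV. {\<omega> \<in> space M. P \<omega> x}) \<in> sets M"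
    using assms by (intro sets.countable_INT' countable_vertices) (auto simp: pred_def)
  moreover have "(\<Inter>x\<in>UNIV. {\<omega> \<in> space M. P \<omega> x}) = {\<omega> \<in> space M. \<forall>x. P \<omega> x}" by auto
  ultimately show ?thesis by (simp add: pred_def)
qed

lemma measurable_admissible:
  assumes [measurable]: "\<And>x n. (\<lambda>\<omega>. T \<omega> x n) \<in> borel_measurable M"
  shows "Measurable.pred M (\<lambda>\<omega>. admissible (T \<omega>))"
proof -
  have [measurable]: "Measurable.pred M (\<lambda>\<omega>. chain (T \<omega>) n x (real m))" for n x m
    by (rule measurable_chain) simp_all
  have [measurable]: "Measurable.pred M (\<lambda>\<omega>. \<forall>x. (\<forall>n. T \<omega> x n < T \<omega> x (Suc n)) \<and> 0 < T \<omega> x 0 \<and> (\<forall>m::nat. \<exists>n. real m \<le> T \<omega> x n)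
        \<and> (\<forall>m::nat. \<exists>n. \<not> chain (T \<omega>) n x (real m)))"
    by (rule pred_all_vertices) measurable
  have [measurable]: "Measurable.pred M (\<lambda>\<omega>. \<forall>n m. T \<omega> x n \<noteq> T \<omega> y m)" for x y
    by measurable
  have [measurable]: "Measurable.pred M (\<lambda>\<omega>. \<forall>x. \<forall>y\<in>{y. adj x y}. \<forall>n m. T \<omega> x n \<noteq> T \<omega> y m)"
    by (rule pred_all_vertices, rule pred_intros_finite(3)[OF finite_neighbours]) measurable
  show ?thesis
    unfolding admissible_countable_iff by measurable
qed

lemma measurable_fixates:
  assumes "\<And>x. Measurable.pred M (\<lambda>\<omega>. \<xi> \<omega> x)"
    and T: "\<And>x n. (\<lambda>\<omega>. T \<omega> x n) \<in> borel_measurable M"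
  shows "Measurable.pred M (\<lambda>\<omega>. fixates (\<xi> \<omega>) (T \<omega>) x)"
proof -
  note [measurable] = measurable_left_spin[OF assms T]
  show ?thesis unfolding fixates_def by measurable
qed

lemma measurable_final:
  assumes "\<And>x. Measurable.pred M (\<lambda>\<omega>. \<xi> \<omega> x)"
    and T: "\<And>x n. (\<lambda>\<omega>. T \<omega> x n) \<in> borel_measurable M"
  shows "Measurable.pred M (\<lambda>\<omega>. final (\<xi> \<omega>) (T \<omega>) x)"
proof -
  note [measurable] = measurable_left_spin[OF assms T]
  show ?thesis unfolding final_def by measurable
qed

section \<open>Almost sure properties of the clocks\<close>

lemma walk_of_path: "vs \<noteq> [] \<Longrightarrow> successively adj vs \<Longrightarrow> (adj ^^ (length vs - 1)) (hd vs) (last vs)"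
proof (induction vs rule: induct_list012)
  case (3 x y zs)
  then have "(adj ^^ Suc (length zs)) x (last (y # zs))"
    by (intro relpowp_Suc_I2[of adj x y]) auto
  then show ?case by simp
qed auto

text \<open>A chain crosses each time window inside a finite cluster of vertices that ring in the window.\<close>

lemma chain_bounded_by_windows:
  assumes pos: "\<And>x n. 0 < T x n" and fin: "\<And>x t. finite {n. T x n < t}"
    and cluster: "\<And>k x. finite {y. (\<lambda>u v. (\<exists>n. T u n \<in> {real k * \<delta>..<real (Suc k) * \<delta>}) \<and> adj u v)\<^sup>*\<^sup>* x y}"
  shows "\<exists>n. \<not> chain T n x (real k * \<delta>)"
proof (induction k arbitrary: x)
  case 0
  have "\<not> T x n < 0" for n using pos[of x n] by linarith
  then have "\<not> chain T (Suc 0) x (real 0 * \<delta>)" by simp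
  then show ?case by blast
next
  case (Suc k)
  let ?a = "real k * \<delta>" and ?b = "real (Suc k) * \<delta>"
  let ?r = "\<lambda>u v. (\<exists>n. T u n \<in> {?a..<?b}) \<and> adj u v"
  let ?C = "{y. ?r\<^sup>*\<^sup>* x y}"
  from Suc have "\<forall>y. \<exists>n. \<not> chain T n y ?a" by blast
  then obtain N0 where N0: "\<And>y. \<not> chain T (N0 y) y ?a" by metis
  define N where "N = Max (N0 ` ?C)"
  have N: "\<not> chain T N y ?a" if "y \<in> ?C" for y
  proof -
    have "N0 y \<le> N" unfolding N_def using that cluster by (intro Max_ge) auto
    then show ?thesis using N0[of y] chain_antimono by blast
  qed
  \<comment> \<open>The rings that a chain starting at time \<open>s\<close> can still use inside
    the window. Each step inside the window consumes at least one of them, and \<open>N\<close>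
    bounds the chain once it has left the window.\<close>
  define W where "W s = {(y, n). y \<in> ?C \<and> ?a \<le> T y n \<and> T y n < s}" for s
  have finW: "finite (W s)" for s
  proof (rule finite_subset)
    show "W s \<subseteq> Sigma ?C (\<lambda>y. {n. T y n < s})" by (auto simp: W_def)
    show "finite (Sigma ?C (\<lambda>y. {n. T y n < s}))"
      using cluster fin by (intro finite_SigmaI) auto
  qed
  have "\<not> chain T (N + Suc (card (W s))) y s" if "y \<in> ?C" "s \<le> ?b" for y s
    using that
  proof (induction "card (W s)" arbitrary: y s rule: less_induct)
    case less
    show ?case
    proof
      assume "chain T (N + Suc (card (W s))) y s"
      then obtain n z where n: "T y n < s" "adj y z" "chain T (N + card (W s)) z (T y n)" by auto
      show False
      proof (cases "T y n < ?a")
        case True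
        have "chain T (Suc (N + card (W s))) y ?a" using n True by auto
        then have "chain T N y ?a" by (rule chain_antimono) simp
        with N less.prems show False by blast
      next
        case False
        have "T y n \<in> {?a..<?b}" using False n less.prems by (simp only: atLeastLessThan_iff) linarith
        with n(2) have rz: "?r y z" by blast
        then have z: "z \<in> ?C" using less.prems by (auto intro: rtranclp.rtrancl_into_rtrancl)
        have "(y, n) \<in> W s" "(y, n) \<notin> W (T y n)" "W (T y n) \<subseteq> W s"
          using False n less.prems by (auto simp: W_def)
        then have "W (T y n) \<subset> W s" by blast
        then have lt: "card (W (T y n)) < card (W s)" by (rule psubset_card_mono[OF finW])
        have "\<not> chain T (N + Suc (card (W (T y n)))) z (T y n)"
          using less.hyps[OF lt z] n less.prems by simp
        moreover have "chain T (N + Suc (card (W (T y n)))) z (T y n)"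
          using n(3) by (rule chain_antimono) (use lt in simp)
        ultimately show False by blast
      qed
    qed
  qed
  from this[of x ?b] show ?case by blast
qed

text \<open>A cluster vertex not reached within \<open>n\<close> steps would be the end of a path
  whose first \<open>n + 1\<close> vertices all satisfy \<open>R\<close>. The final vertex itself
  need not satisfy \<open>R\<close>, which is why a proper prefix is taken.\<close>

lemma finite_cluster:
  assumes "\<And>vs. length vs = Suc n \<Longrightarrow> hd vs = x \<Longrightarrow> distinct vs \<Longrightarrow> successively adj vs \<Longrightarrow> \<exists>v\<in>set vs. \<not> R v"
  shows "finite {y. (\<lambda>u v. R u \<and> adj u v)\<^sup>*\<^sup>* x y}"
proof (rule finite_subset)
  show "{y. (\<lambda>u v. R u \<and> adj u v)\<^sup>*\<^sup>* x y} \<subseteq> (\<Union>m\<le>n. {y. (adj ^^ m) x y})"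
  proof
    fix y assume "y \<in> {y. (\<lambda>u v. R u \<and> adj u v)\<^sup>*\<^sup>* x y}"
    then obtain vs where vs: "vs \<noteq> []" "hd vs = x" "last vs = y" "distinct vs"
      "successively (\<lambda>u v. R u \<and> adj u v) vs"
      using rtranclp_imp_distinct_path by (metis (no_types, lifting) mem_Collect_eq)
    have adj: "successively adj vs" using vs(5) by (rule successively_mono) auto
    have "length vs \<le> Suc n"
    proof (rule ccontr)
      assume "\<not> length vs \<le> Suc n"
      then have len: "Suc n < length vs" by simp
      let ?us = "take (Suc n) vs"
      have "successively adj ?us"
        using adj by (metis append_take_drop_id successively_append_iff)
      moreover have "hd ?us = x" using vs by simp
      ultimately obtain v where v: "v \<in> set ?us" "\<not> R v"
        using assms[of ?us] vs(4) len by auto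
      then obtain i where i: "i < Suc n" "v = vs ! i"
        using len by (auto simp: in_set_conv_nth)
      have "R (vs ! i)" using vs(5) i len by (simp add: successively_conv_nth)
      with v i show False by simp
    qed
    then show "y \<in> (\<Union>m\<le>n. {y. (adj ^^ m) x y})"
      using walk_of_path[OF vs(1) adj] vs by (auto intro!: bexI[of _ "length vs - 1"])
  qed
qed (simp add: finite_walk_targets)

text \<open>The crude count \<open>3 ^ n\<close>, with backtracking allowed, is good enough for
  windows of length 1/4.\<close>

lemma card_paths:
  "finite {vs. length vs = Suc n \<and> hd vs = x \<and> successively adj vs}
   \<and> card {vs. length vs = Suc n \<and> hd vs = x \<and> successively adj vs} \<le> 3 ^ n"
proof (induction n arbitrary: x)
  case 0
  have "{vs. length vs = Suc 0 \<and> hd vs = x \<and> successively adj vs} = {[x]}"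
    by (auto simp: length_Suc_conv)
  then show ?case by simp
next
  case (Suc n x)
  let ?P = "\<lambda>n x. {vs. length vs = Suc n \<and> hd vs = x \<and> successively adj vs}"
  have sub: "?P (Suc n) x \<subseteq> (\<Union>y\<in>{y. adj x y}. (#) x ` ?P n y)"
  proof
    fix vs assume "vs \<in> ?P (Suc n) x"
    then obtain y ws where "vs = x # y # ws" "length ws = n" "adj x y" "successively adj (y # ws)"
      by (auto simp: length_Suc_conv)
    then show "vs \<in> (\<Union>y\<in>{y. adj x y}. (#) x ` ?P n y)" by force
  qed
  have fin: "finite (\<Union>y\<in>{y. adj x y}. (#) x ` ?P n y)"
    using Suc finite_neighbours by blast
  have "card (?P (Suc n) x) \<le> card (\<Union>y\<in>{y. adj x y}. (#) x ` ?P n y)"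
    using fin sub by (rule card_mono)
  also have "\<dots> \<le> (\<Sum>y\<in>{y. adj x y}. card ((#) x ` ?P n y))"
    by (rule card_UN_le[OF finite_neighbours])
  also have "\<dots> \<le> (\<Sum>y\<in>{y. adj x y}. 3 ^ n)"
  proof (rule sum_mono)
    fix y show "card ((#) x ` ?P n y) \<le> 3 ^ n"
      using Suc[of y] card_image_le[of "?P n y" "(#) x"] by linarith
  qed
  also have "\<dots> = 3 ^ Suc n" by (simp add: regular)
  finally have "card (?P (Suc n) x) \<le> 3 ^ Suc n" .
  with finite_subset[OF sub fin] show ?case by blast
qed

end

text \<open>Coordinate \<open>(True, x, 0)\<close> determines the initial spin of \<open>x\<close>, and \<open>(False, x, n)\<close> is the waiting
  time before ring \<open>n\<close> of \<open>x\<close>. The coordinates \<open>(True, x, n)\<close> with \<open>n > 0\<close> are spare copies, with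
  which an initial spin can be exchanged.\<close>

definition coord_law :: "bool \<times> 'v \<times> nat \<Rightarrow> real measure" where
  "coord_law i = (if fst i then uniform_measure lborel {0..1} else density lborel (exponential_density 1))"

definition spin :: "real \<Rightarrow> (bool \<times> 'v \<times> nat \<Rightarrow> real) \<Rightarrow> 'v \<Rightarrow> bool" where
  "spin p \<omega> x \<longleftrightarrow> \<omega> (True, x, 0) \<le> p"

definition clock :: "(bool \<times> 'v \<times> nat \<Rightarrow> real) \<Rightarrow> 'v \<Rightarrow> nat \<Rightarrow> real" where
  "clock \<omega> x n = (\<Sum>k\<le>n. \<omega> (False, x, k))"

lemma prob_space_coord_law: "prob_space (coord_law i)"
  unfolding coord_law_def by (auto intro: prob_space_uniform_measure prob_space_exponential_density)

interpretation inputs: real_product "coord_law :: bool \<times> 'v \<times> nat \<Rightarrow> real measure"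
  by (rule real_product.intro) (rule prob_space_coord_law, simp add: coord_law_def)

abbreviation inputs :: "(bool \<times> 'v \<times> nat \<Rightarrow> real) measure" where
  "inputs \<equiv> inputs.joint"

lemma emeasure_coord_law_atom: "emeasure (coord_law i) {c} = 0"
proof (cases "fst i")
  case True
  have "emeasure lborel ({0..1} \<inter> {c}) \<le> emeasure lborel {c}"
    by (intro emeasure_mono) auto
  then show ?thesis using True by (simp add: coord_law_def)
next
  case False
  have "AE x in lborel. x \<in> {c} \<longrightarrow> ennreal (exponential_density 1 x) = 0"
    using AE_lborel_singleton[of c] by eventually_elim simp
  then have "{c} \<in> null_sets (density lborel (exponential_density 1))"
    by (subst null_sets_density_iff) auto
  then show ?thesis using False null_setsD1 by (auto simp: coord_law_def)
qed

section \<open>Ring times and their intensity\<close>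

lemma clock_measurable [measurable]: "(\<lambda>\<omega>. clock \<omega> x n) \<in> borel_measurable inputs"
  unfolding clock_def by (intro borel_measurable_sum inputs.coord_measurable)

lemma spin_pred_measurable [measurable]: "Measurable.pred inputs (\<lambda>\<omega>. spin p \<omega> x)"
proof -
  have [measurable]: "(\<lambda>\<omega>. \<omega> (True, x, 0)) \<in> borel_measurable inputs"
    by (rule inputs.coord_measurable)
  show ?thesis unfolding spin_def by measurable
qed

lemma distributed_gap: "distributed inputs lborel (\<lambda>\<omega>. \<omega> (False, x, k)) (exponential_density 1)"
proof -
  have "distr inputs lborel (\<lambda>\<omega>. \<omega> (False, x, k)) = coord_law (False, x, k)"
    by (rule trans[OF distr_cong inputs.distr_coord]) simp_all
  also have "\<dots> = density lborel (exponential_density 1)" by (simp add: coord_law_def)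
  finally have "distr inputs lborel (\<lambda>\<omega>. \<omega> (False, x, k)) = density lborel (exponential_density 1)" .
  moreover have "(\<lambda>\<omega>. \<omega> (False, x, k)) \<in> measurable inputs lborel"
    unfolding measurable_lborel1 by (rule inputs.coord_measurable)
  moreover have "(\<lambda>u. ennreal (exponential_density 1 u)) \<in> borel_measurable lborel" by measurable
  ultimately show ?thesis unfolding distributed_def by (intro conjI)
qed

lemma distributed_clock:
  "distributed inputs lborel (\<lambda>\<omega>. clock \<omega> x n) (erlang_density n 1)"
proof -
  let ?I = "(\<lambda>k. (False, x, k)) ` {..n}"
  have inj: "inj_on (\<lambda>k. (False, x, k)) {..n}" by (auto simp: inj_on_def)
  have "distributed inputs lborel (\<lambda>\<omega>. \<Sum>i\<in>?I. \<omega> i) (erlang_density (card ?I - 1) 1)"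
  proof (rule inputs.exponential_distributed_sum)
    show "distributed inputs lborel (\<lambda>\<omega>. \<omega> i) (exponential_density 1)" if "i \<in> ?I" for i
      using that distributed_gap by auto
    show "inputs.indep_vars (\<lambda>i. borel) (\<lambda>i \<omega>. \<omega> i) ?I"
      using inputs.indep_vars_coords_borel by (rule inputs.indep_vars_subset) simp
  qed auto
  moreover have "(\<Sum>i\<in>?I. \<omega> i) = clock \<omega> x n" for \<omega> :: "bool \<times> 'a \<times> nat \<Rightarrow> real"
    unfolding clock_def using inj by (simp add: sum.reindex)
  ultimately show ?thesis using card_image[OF inj] by simp
qed

text \<open>The sum is the exponential series times \<open>exp (- s)\<close>.\<close>

lemma suminf_erlang: "(\<Sum>n. ennreal (erlang_density n 1 s)) = indicator {0..} s"
proof (cases "s \<ge> 0")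
  case True
  have "(\<lambda>n. s ^ n /\<^sub>R fact n) sums exp s" by (rule exp_converges)
  then have "(\<lambda>n. s ^ n /\<^sub>R fact n * exp (- s)) sums (exp s * exp (- s))" by (rule sums_mult2)
  moreover have "exp s * exp (- s) = 1" by (simp add: exp_minus_inverse)
  moreover have "s ^ n /\<^sub>R fact n * exp (- s) = erlang_density n 1 s" for n
    using True by (simp add: erlang_density_def field_simps)
  ultimately have "(\<lambda>n. erlang_density n 1 s) sums 1" by simp
  then have "(\<lambda>n. ennreal (erlang_density n 1 s)) sums ennreal 1"
    by (subst sums_ennreal) (auto intro!: erlang_density_nonneg)
  from sums_unique[OF this] show ?thesis using True by simp
qed (simp add: erlang_density_def)

text \<open>The expected number of rings in a set is its length: a Poisson process of rate one has
  Lebesgue intensity. All first moment bounds on clocks come from here.\<close>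

lemma suminf_ring_probability:
  assumes [measurable]: "A \<in> sets borel"
  shows "(\<Sum>n. emeasure inputs {\<omega>. clock \<omega> x n \<in> A}) = emeasure lborel (A \<inter> {0..})"
proof -
  have "emeasure inputs {\<omega>. clock \<omega> x n \<in> A} = (\<integral>\<^sup>+s. ennreal (erlang_density n 1 s) * indicator A s \<partial>lborel)" for n
    using distributed_emeasure[OF distributed_clock, of A x n] assms by (simp add: vimage_def)
  then have "(\<Sum>n. emeasure inputs {\<omega>. clock \<omega> x n \<in> A})
      = (\<Sum>n. \<integral>\<^sup>+s. ennreal (erlang_density n 1 s) * indicator A s \<partial>lborel)" by simp
  also have "\<dots> = (\<integral>\<^sup>+s. (\<Sum>n. ennreal (erlang_density n 1 s) * indicator A s) \<partial>lborel)"
    by (intro nn_integral_suminf[symmetric]) measurable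
  also have "\<dots> = (\<integral>\<^sup>+s. indicator (A \<inter> {0..}) s \<partial>lborel)"
    by (intro nn_integral_cong) (simp add: ennreal_suminf_multc suminf_erlang split: split_indicator)
  also have "\<dots> = emeasure lborel (A \<inter> {0..})" using assms by simp
  finally show ?thesis .
qed

context cubic_tree
begin

lemma AE_gap_pos: "AE \<omega> in inputs. \<forall>x\<in>UNIV. \<forall>k. 0 < \<omega> (False, x :: 'v, k)"
proof (subst AE_ball_countable[OF countable_vertices], intro ballI)
  fix x :: 'v
  show "AE \<omega> in inputs. \<forall>k. 0 < \<omega> (False, x, k)"
  proof (subst AE_all_countable, intro allI)
    fix k
    have "AE u in lborel. 0 < ennreal (exponential_density 1 u) \<longrightarrow> 0 < u"
      using AE_lborel_singleton[of 0]
      by eventually_elim (auto simp: exponential_density_def split: if_splits)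
    then have "AE u in density lborel (\<lambda>u. ennreal (exponential_density 1 u)). 0 < u"
      by (subst AE_density) (auto intro: measurable_compose)
    moreover have "coord_law (False, x, k) = density lborel (\<lambda>u. ennreal (exponential_density 1 u))"
      by (simp add: coord_law_def)
    ultimately have "AE u in coord_law (False, x, k). 0 < u" by (simp only:)
    then have "AE u in distr inputs borel (\<lambda>\<omega>. \<omega> (False, x, k)). 0 < u"
      by (simp only: inputs.distr_coord)
    then show "AE \<omega> in inputs. 0 < \<omega> (False, x, k)"
      by (rule AE_distrD[OF inputs.coord_measurable])
  qed
qed

text \<open>The first waiting time of \<open>x\<close> has no atoms, and it occurs neither in the
  later waiting times of \<open>x\<close> nor in the clock of \<open>y\<close>.\<close>

lemma AE_rings_distinct:
  assumes "x \<noteq> y"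
  shows "AE \<omega> in inputs. clock \<omega> x n \<noteq> clock \<omega> y m"
proof -
  let ?g = "\<lambda>\<omega>. clock \<omega> y m - (\<Sum>k\<in>{1..n}. \<omega> (False, x, k))"
  have "AE \<omega> in inputs. \<omega> (False, x, 0) \<noteq> ?g \<omega>"
  proof (rule inputs.AE_coord_neq)
    show "?g \<in> borel_measurable inputs"
      by (intro borel_measurable_diff borel_measurable_sum inputs.coord_measurable clock_measurable)
    show "?g (fun_upd \<omega> (False, x, 0) u) = ?g \<omega>" for \<omega> u
      using assms by (simp add: clock_def)
  qed (rule emeasure_coord_law_atom)
  moreover have "clock \<omega> x n = \<omega> (False, x, 0) + (\<Sum>k\<in>{1..n}. \<omega> (False, x, k))" for \<omega>
  proof -
    have "{..n} = insert 0 {1..n}" by auto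
    then show ?thesis by (simp add: clock_def)
  qed
  ultimately show ?thesis by (auto elim: AE_mp)
qed

lemma AE_finite_rings: "AE \<omega> in inputs. \<forall>m::nat. finite {n. clock \<omega> x n < real m}"
proof (subst AE_all_countable, intro allI)
  fix m :: nat
  let ?A = "\<lambda>n. {\<omega>. clock \<omega> x n \<in> {..<real m}}"
  have A: "?A n \<in> sets inputs" for n
    using measurable_sets[OF clock_measurable, of "{..<real m}" x n] by (simp add: vimage_def)
  have "(\<Sum>n. emeasure inputs (?A n)) = emeasure lborel {0..<real m}"
  proof -
    have "{..<real m} \<inter> {0..} = {0..<real m}" by auto
    then show ?thesis by (subst suminf_ring_probability) simp_all
  qed
  also have "\<dots> < \<infinity>" by simp
  finally have "(\<Sum>n. emeasure inputs (?A n)) \<noteq> \<infinity>" by simp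
  then have "summable (\<lambda>n. measure inputs (?A n))"
    by (intro summable_suminf_not_top) (simp_all add: inputs.emeasure_eq_measure)
  then have "AE \<omega> in inputs. eventually (\<lambda>n. \<omega> \<in> space inputs - ?A n) sequentially"
    by (intro borel_cantelli_AE1 A) (simp_all add: inputs.emeasure_eq_measure)
  then show "AE \<omega> in inputs. finite {n. clock \<omega> x n < real m}"
  proof (rule AE_mp, intro AE_I2 impI)
    fix \<omega> assume "eventually (\<lambda>n. \<omega> \<in> space inputs - ?A n) sequentially"
    then obtain N where "\<And>n. n \<ge> N \<Longrightarrow> \<not> clock \<omega> x n < real m"
      by (auto simp: eventually_sequentially)
    then have "{n. clock \<omega> x n < real m} \<subseteq> {..<N}" by (auto simp: not_less[symmetric])
    then show "finite {n. clock \<omega> x n < real m}" by (rule finite_subset) simp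
  qed
qed

section \<open>Clusters of vertices that ring in a short window\<close>

definition rings_in :: "real \<Rightarrow> real \<Rightarrow> (bool \<times> 'v \<times> nat \<Rightarrow> real) \<Rightarrow> 'v \<Rightarrow> bool" where
  "rings_in a b \<omega> x \<longleftrightarrow> (\<exists>n. clock \<omega> x n \<in> {a..<b})"

lemma rings_in_sets: "{\<omega>. rings_in a b \<omega> x} \<in> sets inputs"
proof -
  have "Measurable.pred inputs (\<lambda>\<omega>. rings_in a b \<omega> x)" unfolding rings_in_def by measurable
  then show ?thesis by (simp add: pred_def)
qed

lemma prob_rings_in:
  assumes "a \<le> b"
  shows "inputs.prob {\<omega>. rings_in a b \<omega> x} \<le> b - a"
proof -
  have A: "{\<omega>. clock \<omega> x n \<in> {a..<b}} \<in> sets inputs" for n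
    using measurable_sets[OF clock_measurable, of "{a..<b}" x n] by (simp add: vimage_def)
  have "{\<omega>. rings_in a b \<omega> x} = (\<Union>n. {\<omega>. clock \<omega> x n \<in> {a..<b}})"
    by (auto simp: rings_in_def)
  then have "emeasure inputs {\<omega>. rings_in a b \<omega> x} \<le> (\<Sum>n. emeasure inputs {\<omega>. clock \<omega> x n \<in> {a..<b}})"
    using A by (simp only:) (intro emeasure_subadditive_countably, auto)
  also have "\<dots> = emeasure lborel ({a..<b} \<inter> {0..})" by (rule suminf_ring_probability) simp
  also have "\<dots> \<le> emeasure lborel {a..<b}" by (intro emeasure_mono) auto
  finally show ?thesis using assms by (simp add: inputs.emeasure_eq_measure)
qed

text \<open>Subcritical percolation: each of at most \<open>3 ^ n\<close> paths rings entirely with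
  probability at most \<open>(1/4) ^ (n + 1)\<close>. The window length 1/4 is chosen below 1/3 so
  that the product decays.\<close>

lemma AE_finite_cluster:
  "AE \<omega> in inputs. finite {y. (\<lambda>u v. rings_in (real k * (1/4)) (real (Suc k) * (1/4)) \<omega> u \<and> adj u v)\<^sup>*\<^sup>* x y}"
proof -
  let ?R = "rings_in (real k * (1/4)) (real (Suc k) * (1/4))"
  let ?P = "\<lambda>n. {vs. length vs = Suc n \<and> hd vs = x \<and> distinct vs \<and> successively adj vs}"
  let ?E = "\<lambda>n. \<Union>vs\<in>?P n. \<Inter>v\<in>set vs. {\<omega>. ?R \<omega> v}"
  have finP: "finite (?P n)" for n
    using card_paths[of n x] by (auto elim: finite_subset[rotated])
  have cardP: "card (?P n) \<le> 3 ^ n" for n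
    using card_paths[of n x] card_mono[of "{vs. length vs = Suc n \<and> hd vs = x \<and> successively adj vs}" "?P n"]
    by fastforce
  have Es: "(\<Inter>v\<in>set vs. {\<omega>. ?R \<omega> v}) \<in> sets inputs" if "vs \<in> ?P n" for vs n
    using that by (intro sets.finite_INT rings_in_sets) auto
  then have E: "?E n \<in> sets inputs" for n using finP by (intro sets.finite_UN) auto
  have "inputs.prob (?E n) \<le> (3/4) ^ n" for n
  proof -
    have "inputs.prob (?E n) \<le> (\<Sum>vs\<in>?P n. inputs.prob (\<Inter>v\<in>set vs. {\<omega>. ?R \<omega> v}))"
      using finP Es by (intro inputs.finite_measure_subadditive_finite) auto
    also have "\<dots> \<le> (\<Sum>vs\<in>?P n. (1/4) ^ Suc n)"
    proof (rule sum_mono)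
      fix vs assume vs: "vs \<in> ?P n"
      have "inputs.prob (\<Inter>v\<in>set vs. {\<omega>. ?R \<omega> v}) = (\<Prod>v\<in>set vs. inputs.prob {\<omega>. ?R \<omega> v})"
      proof (rule inputs.prob_INT_depends_on[where J = "\<lambda>v. {False} \<times> {v} \<times> UNIV"])
        show "disjoint_family_on (\<lambda>v. {False} \<times> {v} \<times> UNIV) (set vs)"
          by (auto simp: disjoint_family_on_def)
        show "depends_on ({False} \<times> {v} \<times> UNIV) {\<omega>. ?R \<omega> v}" for v
          by (auto simp: depends_on_def rings_in_def clock_def)
      qed (auto intro: rings_in_sets)
      also have "\<dots> \<le> (\<Prod>v\<in>set vs. 1/4)"
        using prob_rings_in[of "real k * (1/4)" "real (Suc k) * (1/4)"]
        by (intro prod_mono) (auto simp: field_simps)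
      also have "\<dots> = (1/4) ^ Suc n" using vs by (auto simp: distinct_card)
      finally show "inputs.prob (\<Inter>v\<in>set vs. {\<omega>. ?R \<omega> v}) \<le> (1/4) ^ Suc n" .
    qed
    also have "\<dots> = real (card (?P n)) * (1/4) ^ Suc n" by simp
    also have "\<dots> \<le> 3 ^ n * (1/4) ^ Suc n"
    proof (rule mult_right_mono)
      show "real (card (?P n)) \<le> 3 ^ n" using of_nat_mono[OF cardP[of n], where ?'a = real] by simp
    qed simp
    also have "\<dots> \<le> (3/4) ^ n" by (simp add: power_divide field_simps)
    finally show ?thesis .
  qed
  then have le: "inputs.prob (\<Inter>n. ?E n) \<le> (3/4) ^ n" for n
    using inputs.finite_measure_mono[of "\<Inter>n. ?E n" "?E n"] E by (meson INT_lower UNIV_I order_trans)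
  have "inputs.prob (\<Inter>n. ?E n) \<le> 0"
    by (rule LIMSEQ_le_const[OF LIMSEQ_realpow_zero[of "3/4"]]) (use le in auto)
  then have "emeasure inputs (\<Inter>n. ?E n) = 0"
    by (simp only: inputs.emeasure_eq_measure measure_le_0_iff ennreal_0)
  moreover have "(\<Inter>n. ?E n) \<in> sets inputs" using E by auto
  ultimately have "AE \<omega> in inputs. \<omega> \<notin> (\<Inter>n. ?E n)"
    by (intro AE_not_in) (auto simp: null_sets_def)
  then show ?thesis
  proof (rule AE_mp, intro AE_I2 impI)
    fix \<omega> assume "\<omega> \<notin> (\<Inter>n. ?E n)"
    then obtain n where "\<omega> \<notin> ?E n" by blast
    then show "finite {y. (\<lambda>u v. ?R \<omega> u \<and> adj u v)\<^sup>*\<^sup>* x y}"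
      by (intro finite_cluster[of n]) blast
  qed
qed

theorem AE_admissible: "AE \<omega> in inputs. admissible (clock \<omega>)"
proof -
  have 1: "AE \<omega> in inputs. \<forall>x\<in>UNIV. \<forall>m::nat. finite {n. clock \<omega> (x :: 'v) n < real m}"
    by (subst AE_ball_countable[OF countable_vertices]) (intro ballI AE_finite_rings)
  have 2: "AE \<omega> in inputs. \<forall>x\<in>UNIV. \<forall>k. finite {y. (\<lambda>u v. rings_in (real k * (1/4)) (real (Suc k) * (1/4)) \<omega> u \<and> adj u v)\<^sup>*\<^sup>* x y}"
    using AE_finite_cluster by (subst AE_ball_countable[OF countable_vertices]) (simp add: AE_all_countable)
  have 3: "AE \<omega> in inputs. \<forall>x\<in>UNIV. \<forall>y\<in>UNIV. \<forall>n m. adj x y \<longrightarrow> clock \<omega> x n \<noteq> clock \<omega> y m"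
  proof (subst AE_ball_countable[OF countable_vertices], intro ballI,
      subst AE_ball_countable[OF countable_vertices], intro ballI,
      subst AE_all_countable, intro allI, subst AE_all_countable, intro allI)
    fix x y :: 'v and n m
    show "AE \<omega> in inputs. adj x y \<longrightarrow> clock \<omega> x n \<noteq> clock \<omega> y m"
      using AE_rings_distinct[of x y n m] adj_irrefl by (cases "adj x y") auto
  qed
  from 1 2 3 AE_gap_pos show ?thesis
  proof eventually_elim
    case (elim \<omega>)
    let ?T = "clock \<omega>"
    have step: "?T x (Suc n) = ?T x n + \<omega> (False, x, Suc n)" for x n by (simp add: clock_def)
    have mono: "strict_mono (?T x)" for x
      unfolding strict_mono_Suc_iff using elim(4) by (simp add: step)
    have pos: "0 < ?T x n" for x n
      unfolding clock_def using elim(4) by (intro sum_pos) auto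
    have fin: "finite {n. ?T x n < t}" for x t
    proof -
      obtain m :: nat where "t \<le> real m" using real_arch_simple by blast
      then have "{n. ?T x n < t} \<subseteq> {n. ?T x n < real m}" by auto
      then show ?thesis using elim(1) finite_subset by blast
    qed
    have top: "\<exists>n. real m \<le> ?T x n" for x m
    proof (rule ccontr)
      assume "\<not> (\<exists>n. real m \<le> ?T x n)"
      then have "{n. ?T x n < real m} = UNIV" by (auto simp: not_le)
      with fin[of x "real m"] show False by simp
    qed
    have "\<exists>n. \<not> chain ?T n x (real m)" for x and m :: nat
    proof -
      \<comment> \<open>Every natural time is the end of a window.\<close>
      have "\<exists>n. \<not> chain ?T n x (real (4 * m) * (1/4))"
        using elim(2) by (intro chain_bounded_by_windows pos fin) (simp add: rings_in_def)
      then show ?thesis by simp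
    qed
    moreover have "clock \<omega> x n < clock \<omega> x (Suc n)" for x n
      using mono[of x] by (simp add: strict_mono_Suc_iff)
    ultimately show ?case
      unfolding admissible_countable_iff using pos top elim(3) by blast
  qed
qed

end

section \<open>Fixation\<close>

lemma (in real_product) nn_integral_reindex:
  assumes "inj \<pi>" "\<And>i. law (\<pi> i) = law i" "f \<in> borel_measurable joint"
  shows "(\<integral>\<^sup>+\<omega>. f (\<lambda>i. \<omega> (\<pi> i)) \<partial>joint) = (\<integral>\<^sup>+\<omega>. f \<omega> \<partial>joint)"
proof -
  have "(\<integral>\<^sup>+\<omega>. f \<omega> \<partial>distr joint joint (\<lambda>\<omega> i. \<omega> (\<pi> i))) = (\<integral>\<^sup>+\<omega>. f (\<lambda>i. \<omega> (\<pi> i)) \<partial>joint)"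
    using assms(3) by (intro nn_integral_distr reindex_measurable) simp
  then show ?thesis by (simp only: distr_reindex[OF assms(1,2)])
qed

lemma (in real_product) emeasure_joint_UNIV [simp]: "emeasure joint UNIV = 1"
  using emeasure_space_1 by simp

lemma ennreal_eq_infinityI:
  assumes "\<And>K. of_nat K \<le> (x :: ennreal)"
  shows "x = \<infinity>"
proof -
  have "(SUP K. of_nat K) \<le> x" using assms by (rule SUP_least)
  then show ?thesis by (simp add: ennreal_SUP_of_nat_eq_top top_unique)
qed

lemma suminf_of_bool:
  assumes "finite {n. P n}"
  shows "(\<Sum>n. of_bool (P n) :: ennreal) = of_nat (card {n. P n})"
proof -
  have "(\<Sum>n. of_bool (P n) :: ennreal) = (\<Sum>n\<in>{n. P n}. of_bool (P n))"
    using assms by (intro suminf_finite) auto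
  also have "\<dots> = of_nat (card {n. P n})" by simp
  finally show ?thesis .
qed

context cubic_tree
begin

section \<open>Invariance under automorphisms and expected flips\<close>

definition relabel :: "('v \<Rightarrow> 'v) \<Rightarrow> bool \<times> 'v \<times> nat \<Rightarrow> bool \<times> 'v \<times> nat" where
  "relabel \<phi> = (\<lambda>(b, x, n). (b, \<phi> x, n))"

lemma inj_relabel: "automorphism \<phi> \<Longrightarrow> inj (relabel \<phi>)"
  unfolding automorphism_def relabel_def bij_def inj_def by auto

lemma coord_law_relabel: "coord_law (relabel \<phi> i) = coord_law i"
  by (simp add: coord_law_def relabel_def case_prod_beta)

lemma spin_relabel: "spin p (\<lambda>i. \<omega> (relabel \<phi> i)) = (\<lambda>x. spin p \<omega> (\<phi> x))"
  by (intro ext) (simp add: spin_def relabel_def)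

lemma clock_relabel: "clock (\<lambda>i. \<omega> (relabel \<phi> i)) = (\<lambda>x. clock \<omega> (\<phi> x))"
  by (intro ext) (simp add: clock_def relabel_def)

lemma gain_relabel:
  assumes "automorphism \<phi>"
  shows "gain (spin p (\<lambda>i. \<omega> (relabel \<phi> i))) (clock (\<lambda>i. \<omega> (relabel \<phi> i))) x y n
    = gain (spin p \<omega>) (clock \<omega>) (\<phi> x) (\<phi> y) n"
  unfolding gain_def spin_relabel clock_relabel left_spin_automorphism[OF assms] ..

lemma loss_relabel:
  assumes "automorphism \<phi>"
  shows "loss (spin p (\<lambda>i. \<omega> (relabel \<phi> i))) (clock (\<lambda>i. \<omega> (relabel \<phi> i))) x y n
    = loss (spin p \<omega>) (clock \<omega>) (\<phi> x) (\<phi> y) n"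
  unfolding loss_def spin_relabel clock_relabel left_spin_automorphism[OF assms] ..

lemma left_spin_at_ring_measurable [measurable]:
  "Measurable.pred inputs (\<lambda>\<omega>. left_spin (spin p \<omega>) (clock \<omega>) y (clock \<omega> x n))"
  by (rule measurable_left_spin) measurable

text \<open>Only rings before \<open>t\<close> count, so the expectation is finite and can later be
  cancelled; the bound obtained afterwards does not depend on \<open>t\<close>.\<close>

definition gains :: "real \<Rightarrow> real \<Rightarrow> 'v \<Rightarrow> 'v \<Rightarrow> (bool \<times> 'v \<times> nat \<Rightarrow> real) \<Rightarrow> ennreal" where
  "gains p t x y \<omega> = (\<Sum>n. of_bool (clock \<omega> x n < t \<and> gain (spin p \<omega>) (clock \<omega>) x y n))"

definition losses :: "real \<Rightarrow> real \<Rightarrow> 'v \<Rightarrow> 'v \<Rightarrow> (bool \<times> 'v \<times> nat \<Rightarrow> real) \<Rightarrow> ennreal" where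
  "losses p t x y \<omega> = (\<Sum>n. of_bool (clock \<omega> x n < t \<and> loss (spin p \<omega>) (clock \<omega>) x y n))"

definition flip_count :: "real \<Rightarrow> real \<Rightarrow> 'v \<Rightarrow> (bool \<times> 'v \<times> nat \<Rightarrow> real) \<Rightarrow> ennreal" where
  "flip_count p t x \<omega> = (\<Sum>n. of_bool (clock \<omega> x n < t \<and> flips (spin p \<omega>) (clock \<omega>) x n))"

lemma measurable_of_bool [measurable (raw)]:
  assumes "Measurable.pred M P"
  shows "(\<lambda>\<omega>. of_bool (P \<omega>) :: ennreal) \<in> borel_measurable M"
proof -
  have "(\<lambda>\<omega>. of_bool (P \<omega>) :: ennreal) = (\<lambda>\<omega>. if P \<omega> then 1 else 0)" by auto
  then show ?thesis using assms by simp
qed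

lemma gains_measurable [measurable]: "gains p t x y \<in> borel_measurable inputs"
  unfolding gains_def[abs_def] gain_def by measurable

lemma losses_measurable [measurable]: "losses p t x y \<in> borel_measurable inputs"
  unfolding losses_def[abs_def] loss_def by measurable

lemma flip_count_measurable [measurable]: "flip_count p t x \<in> borel_measurable inputs"
  unfolding flip_count_def[abs_def] flips_def by measurable

text \<open>Relabelling by an automorphism that exchanges the two ends preserves the law of the
  inputs.\<close>

lemma gains_swap: "(\<integral>\<^sup>+\<omega>. gains p t x y \<omega> \<partial>inputs) = (\<integral>\<^sup>+\<omega>. gains p t y x \<omega> \<partial>inputs)"
proof -
  obtain \<phi> where \<phi>: "automorphism \<phi>" "\<phi> x = y" "\<phi> y = x" by (rule swapping_automorphism)
  have "gains p t x y (\<lambda>i. \<omega> (relabel \<phi> i)) = gains p t y x \<omega>" for \<omega>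
    unfolding gains_def gain_relabel[OF \<phi>(1)] by (simp add: clock_relabel \<phi>)
  then show ?thesis
    using inputs.nn_integral_reindex[OF inj_relabel[OF \<phi>(1)] coord_law_relabel gains_measurable[of p t x y]]
    by simp
qed

lemma losses_swap: "(\<integral>\<^sup>+\<omega>. losses p t x y \<omega> \<partial>inputs) = (\<integral>\<^sup>+\<omega>. losses p t y x \<omega> \<partial>inputs)"
proof -
  obtain \<phi> where \<phi>: "automorphism \<phi>" "\<phi> x = y" "\<phi> y = x" by (rule swapping_automorphism)
  have "losses p t x y (\<lambda>i. \<omega> (relabel \<phi> i)) = losses p t y x \<omega>" for \<omega>
    unfolding losses_def loss_relabel[OF \<phi>(1)] by (simp add: clock_relabel \<phi>)
  then show ?thesis
    using inputs.nn_integral_reindex[OF inj_relabel[OF \<phi>(1)] coord_law_relabel losses_measurable[of p t x y]]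
    by simp
qed

lemma nn_integral_gains_finite: "(\<integral>\<^sup>+\<omega>. gains p t x y \<omega> \<partial>inputs) < \<infinity>"
proof -
  have A: "{\<omega>. clock \<omega> x n \<in> {..<t}} \<in> sets inputs" for n
    using measurable_sets[OF clock_measurable, of "{..<t}" x n] by (simp add: vimage_def)
  have "gains p t x y \<omega> \<le> (\<Sum>n. indicator {\<omega>. clock \<omega> x n \<in> {..<t}} \<omega>)" for \<omega>
    unfolding gains_def by (intro suminf_le) (auto split: split_indicator)
  then have "(\<integral>\<^sup>+\<omega>. gains p t x y \<omega> \<partial>inputs) \<le> (\<integral>\<^sup>+\<omega>. (\<Sum>n. indicator {\<omega>. clock \<omega> x n \<in> {..<t}} \<omega>) \<partial>inputs)"
    by (intro nn_integral_mono) simp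
  also have "\<dots> = (\<Sum>n. \<integral>\<^sup>+\<omega>. indicator {\<omega>. clock \<omega> x n \<in> {..<t}} \<omega> \<partial>inputs)"
    using A by (intro nn_integral_suminf borel_measurable_indicator)
  also have "\<dots> = (\<Sum>n. emeasure inputs {\<omega>. clock \<omega> x n \<in> {..<t}})"
    using A by (simp only: nn_integral_indicator)
  also have "\<dots> = emeasure lborel ({..<t} \<inter> {0..})" by (rule suminf_ring_probability) simp
  also have "\<dots> \<le> emeasure lborel {0..max 0 t}" by (intro emeasure_mono) auto
  also have "\<dots> < \<infinity>" by simp
  finally show ?thesis .
qed

text \<open>The balance of an edge involves the rings of both ends, which contribute equally in
  expectation; hence the factor 2. The summand 1 bounds the initial disagreement.\<close>

lemma losses_le_gains:
  assumes xy: "adj x y"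
  shows "2 * (\<integral>\<^sup>+\<omega>. losses p t x y \<omega> \<partial>inputs) \<le> 1 + 2 * (\<integral>\<^sup>+\<omega>. gains p t x y \<omega> \<partial>inputs)"
proof -
  have "2 * (\<integral>\<^sup>+\<omega>. losses p t x y \<omega> \<partial>inputs) = (\<integral>\<^sup>+\<omega>. losses p t x y \<omega> + losses p t y x \<omega> \<partial>inputs)"
    by (subst nn_integral_add) (simp_all add: losses_swap[of p t y x] mult_2)
  also have "\<dots> \<le> (\<integral>\<^sup>+\<omega>. 1 + (gains p t x y \<omega> + gains p t y x \<omega>) \<partial>inputs)"
  proof (rule nn_integral_mono_AE)
    from AE_admissible show "AE \<omega> in inputs. losses p t x y \<omega> + losses p t y x \<omega>
        \<le> 1 + (gains p t x y \<omega> + gains p t y x \<omega>)"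
    proof eventually_elim
      case (elim \<omega>)
      let ?T = "clock \<omega>"
      have fin: "finite {n. ?T x n < t \<and> P n}" for x P
        by (rule finite_subset[OF _ finite_rings_before[OF elim, of x t]]) (auto simp: rings_before_def)
      have eq: "{n \<in> rings_before ?T x t. P n} = {n. ?T x n < t \<and> P n}" for x P
        by (auto simp: rings_before_def)
      have "card {n. ?T x n < t \<and> loss (spin p \<omega>) ?T x y n} + card {n. ?T y n < t \<and> loss (spin p \<omega>) ?T y x n}
        \<le> 1 + (card {n. ?T x n < t \<and> gain (spin p \<omega>) ?T x y n} + card {n. ?T y n < t \<and> gain (spin p \<omega>) ?T y x n})"
      proof -
        have "of_bool (spin p \<omega> x \<noteq> spin p \<omega> y) \<le> (1 :: nat)" by simp
        with edge_balance[OF elim xy, of "spin p \<omega>" t] show ?thesis unfolding eq by linarith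
      qed
      then have "of_nat (card {n. ?T x n < t \<and> loss (spin p \<omega>) ?T x y n} + card {n. ?T y n < t \<and> loss (spin p \<omega>) ?T y x n})
        \<le> (of_nat (1 + (card {n. ?T x n < t \<and> gain (spin p \<omega>) ?T x y n} + card {n. ?T y n < t \<and> gain (spin p \<omega>) ?T y x n})) :: ennreal)"
        by (simp only: of_nat_le_iff)
      then show ?case
        unfolding losses_def gains_def suminf_of_bool[OF fin] by simp
    qed
  qed
  also have "\<dots> = 1 + 2 * (\<integral>\<^sup>+\<omega>. gains p t x y \<omega> \<partial>inputs)"
    by (simp add: nn_integral_add inputs.emeasure_space_1 gains_swap[of p t y x] mult_2)
  finally show ?thesis .
qed

lemma flip_count_le:
  assumes "admissible (clock \<omega>)"
  shows "(\<Sum>y | adj x y. gains p t x y \<omega>) + flip_count p t x \<omega> \<le> (\<Sum>y | adj x y. losses p t x y \<omega>)"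
proof -
  let ?g = "\<lambda>y n. of_bool (clock \<omega> x n < t \<and> gain (spin p \<omega>) (clock \<omega>) x y n) :: ennreal"
  let ?l = "\<lambda>y n. of_bool (clock \<omega> x n < t \<and> loss (spin p \<omega>) (clock \<omega>) x y n) :: ennreal"
  let ?f = "\<lambda>n. of_bool (clock \<omega> x n < t \<and> flips (spin p \<omega>) (clock \<omega>) x n) :: ennreal"
  have *: "(\<Sum>y | adj x y. ?g y n) + ?f n \<le> (\<Sum>y | adj x y. ?l y n)" for n
  proof (cases "clock \<omega> x n < t")
    case True
    have "of_nat ((\<Sum>y | adj x y. of_bool (gain (spin p \<omega>) (clock \<omega>) x y n)) + of_bool (flips (spin p \<omega>) (clock \<omega>) x n))
      \<le> (of_nat (\<Sum>y | adj x y. of_bool (loss (spin p \<omega>) (clock \<omega>) x y n)) :: ennreal)"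
      by (simp only: of_nat_le_iff flip_gain_loss[OF assms])
    then show ?thesis using True by (simp only: of_nat_add of_nat_sum of_nat_of_bool simp_thms)
  qed simp
  have "(\<Sum>y | adj x y. gains p t x y \<omega>) + flip_count p t x \<omega> = (\<Sum>n. (\<Sum>y | adj x y. ?g y n) + ?f n)"
    unfolding gains_def flip_count_def
    by (subst suminf_add[symmetric]) (simp_all add: suminf_sum)
  also have "\<dots> \<le> (\<Sum>n. \<Sum>y | adj x y. ?l y n)" using * by (intro suminf_le) auto
  also have "\<dots> = (\<Sum>y | adj x y. losses p t x y \<omega>)"
    unfolding losses_def by (rule suminf_sum) simp
  finally show ?thesis .
qed

text \<open>Summed over the three edges at \<open>x\<close>, losses exceed gains by at least the
  number of flips, but in expectation by no more than the initial disagreement allows. The bound 3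
  is the degree.\<close>

lemma nn_integral_flip_count: "(\<integral>\<^sup>+\<omega>. flip_count p t x \<omega> \<partial>inputs) \<le> 3"
proof -
  let ?G = "\<Sum>y | adj x y. \<integral>\<^sup>+\<omega>. gains p t x y \<omega> \<partial>inputs"
  let ?L = "\<Sum>y | adj x y. \<integral>\<^sup>+\<omega>. losses p t x y \<omega> \<partial>inputs"
  let ?F = "\<integral>\<^sup>+\<omega>. flip_count p t x \<omega> \<partial>inputs"
  have fin: "?G < \<infinity>"
    using nn_integral_gains_finite by (simp add: finite_neighbours)
  have "?G + ?F = (\<integral>\<^sup>+\<omega>. (\<Sum>y | adj x y. gains p t x y \<omega>) + flip_count p t x \<omega> \<partial>inputs)"
    by (simp add: nn_integral_add nn_integral_sum)
  also have "\<dots> \<le> (\<integral>\<^sup>+\<omega>. (\<Sum>y | adj x y. losses p t x y \<omega>) \<partial>inputs)"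
    using AE_admissible by (intro nn_integral_mono_AE) (auto elim!: AE_mp intro!: flip_count_le)
  also have "\<dots> = ?L" by (simp add: nn_integral_sum)
  finally have "?G + ?F \<le> ?L" .
  then have "2 * (?G + ?F) \<le> 2 * ?L" by (rule mult_left_mono) simp
  also have "\<dots> = (\<Sum>y | adj x y. 2 * (\<integral>\<^sup>+\<omega>. losses p t x y \<omega> \<partial>inputs))" by (rule sum_distrib_left)
  also have "\<dots> \<le> (\<Sum>y | adj x y. 1 + 2 * (\<integral>\<^sup>+\<omega>. gains p t x y \<omega> \<partial>inputs))"
    using losses_le_gains by (intro sum_mono) simp
  also have "\<dots> = 2 * ?G + 3"
    by (simp add: sum.distrib sum_distrib_left regular add.commute)
  finally have "2 * ?G + 2 * ?F \<le> 2 * ?G + 3" by (simp add: distrib_left)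
  moreover have "2 * ?G \<noteq> \<infinity>" using fin by (simp add: ennreal_mult_eq_top_iff)
  ultimately have "2 * ?F \<le> 3" by (simp add: ennreal_add_left_cancel_le)
  moreover have "?F \<le> 2 * ?F" by (simp add: mult_2)
  ultimately show ?thesis by simp
qed

theorem AE_fixates: "AE \<omega> in inputs. \<forall>x. fixates (spin p \<omega>) (clock \<omega>) x"
proof -
  have "AE \<omega> in inputs. \<forall>x\<in>UNIV. fixates (spin p \<omega>) (clock \<omega>) x"
  proof (subst AE_ball_countable[OF countable_vertices], intro ballI)
    fix x :: 'v
    have mono: "flip_count p s x \<omega> \<le> flip_count p t x \<omega>" if "s \<le> t" for s t \<omega>
      unfolding flip_count_def using that by (intro suminf_le) auto
    \<comment> \<open>The bound is uniform in time, so monotone convergence carries it over to the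
      total number of flips.\<close>
    have "(\<integral>\<^sup>+\<omega>. (SUP m. flip_count p (real m) x \<omega>) \<partial>inputs) = (SUP m. \<integral>\<^sup>+\<omega>. flip_count p (real m) x \<omega> \<partial>inputs)"
      by (intro nn_integral_monotone_convergence_SUP) (auto simp: incseq_def le_fun_def intro: mono)
    also have "\<dots> \<le> 3" by (intro SUP_least nn_integral_flip_count)
    also have "\<dots> < \<infinity>" by simp
    finally have "AE \<omega> in inputs. (SUP m. flip_count p (real m) x \<omega>) \<noteq> \<infinity>"
      by (intro nn_integral_PInf_AE) auto
    then show "AE \<omega> in inputs. fixates (spin p \<omega>) (clock \<omega>) x"
    proof eventually_elim
      case (elim \<omega>)
      let ?P = "flips (spin p \<omega>) (clock \<omega>) x"
      have "finite {n. ?P n}"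
      proof (rule ccontr)
        assume inf: "infinite {n. ?P n}"
        have "of_nat K \<le> (SUP m. flip_count p (real m) x \<omega>)" for K
        proof -
          obtain F where F: "F \<subseteq> {n. ?P n}" "finite F" "card F = K"
            using infinite_arbitrarily_large[OF inf] by blast
          obtain m :: nat where "Max (insert 0 ((clock \<omega> x) ` F)) < real m" using reals_Archimedean2 by blast
          then have m: "clock \<omega> x n < real m" if "n \<in> F" for n
            using that F(2) by (subst (asm) Max_less_iff) auto
          have "(of_nat K :: ennreal) = (\<Sum>n\<in>F. of_bool (clock \<omega> x n < real m \<and> ?P n))"
            using F m by (subst sum.cong[OF refl, of F _ "\<lambda>_. 1"]) auto
          also have "\<dots> \<le> flip_count p (real m) x \<omega>"
            unfolding flip_count_def using F(2) by (intro sum_le_suminf) auto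
          also have "\<dots> \<le> (SUP m. flip_count p (real m) x \<omega>)" by (rule SUP_upper) simp
          finally show ?thesis .
        qed
        then have "(SUP m. flip_count p (real m) x \<omega>) = \<infinity>"
          by (rule ennreal_eq_infinityI)
        with elim show False by blast
      qed
      then show ?case by (rule finite_flips_fixates)
    qed
  qed
  then show ?thesis by simp
qed

section \<open>Changing one initial spin\<close>

text \<open>For \<open>0 < p < 1\<close> a resampled initial spin takes each value with positive
  probability, so what holds almost surely must hold for both values. The clocks are
  untouched.\<close>

lemma AE_set_spin:
  assumes p: "0 < p" "p < 1" and Q: "AE \<omega> in inputs. Q (spin p \<omega>) (clock \<omega>)"
  shows "AE \<omega> in inputs. \<forall>b. Q (fun_upd (spin p \<omega>) (x :: 'v) b) (clock \<omega>)"
  using inputs.AE_resample[OF Q, of "(True, x, 0)"]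
proof eventually_elim
  case (elim \<omega>)
  have 1: "spin p (fun_upd \<omega> (True, x, 0) u) = fun_upd (spin p \<omega>) x (u \<le> p)" for u
    by (intro ext) (simp add: spin_def)
  have 2: "clock (fun_upd \<omega> (True, x, 0) u) = clock \<omega>" for u
    by (intro ext) (simp add: clock_def)
  have 3: "coord_law (True, x, 0 :: nat) = uniform_measure lborel {0..1}"
    by (simp add: coord_law_def)
  have "AE u in uniform_measure lborel {0..1}. Q (fun_upd (spin p \<omega>) x (u \<le> p)) (clock \<omega>)"
    using elim unfolding 1 2 3 .
  then have AE: "AE u in lborel. u \<in> {0..1} \<longrightarrow> Q (fun_upd (spin p \<omega>) x (u \<le> p)) (clock \<omega>)"
    by (subst (asm) AE_uniform_measure) auto
  have "Q (fun_upd (spin p \<omega>) x b) (clock \<omega>)" for b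
  proof (rule ccontr)
    assume not: "\<not> Q (fun_upd (spin p \<omega>) x b) (clock \<omega>)"
    \<comment> \<open>An interval of positive length whose levels all produce the spin
      \<open>b\<close>.\<close>
    let ?I = "if b then {0<..<p} else {p<..<1}"
    from AE have "AE u in lborel. u \<notin> ?I"
    proof eventually_elim
      case (elim u)
      then show ?case using not p by (cases b) auto
    qed
    then have "emeasure lborel ?I = 0"
      by (subst (asm) AE_iff_measurable[of ?I]) auto
    with p show False by (cases b) auto
  qed
  then show ?case by blast
qed

text \<open>One direction is enough: by monotonicity, making \<open>x\<close> plus never turns
  \<open>y\<close> to minus.\<close>

definition pivotal :: "real \<Rightarrow> (bool \<times> 'v \<times> nat \<Rightarrow> real) \<Rightarrow> 'v \<Rightarrow> 'v \<Rightarrow> real \<Rightarrow> bool" where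
  "pivotal p \<omega> x y t \<longleftrightarrow> left_spin (fun_upd (spin p \<omega>) x True) (clock \<omega>) y t
     \<and> \<not> left_spin (fun_upd (spin p \<omega>) x False) (clock \<omega>) y t"

lemma measurable_pivotal:
  assumes f: "f \<in> measurable M inputs" and q: "q \<in> borel_measurable M"
  shows "Measurable.pred M (\<lambda>z. pivotal (q z) (f z) x y t)"
proof -
  have T: "(\<lambda>z. clock (f z) x n) \<in> borel_measurable M" for x n
    using f clock_measurable by (rule measurable_compose)
  have [measurable]: "(\<lambda>z. f z i) \<in> borel_measurable M" for i
    using f inputs.coord_measurable by (rule measurable_compose)
  note [measurable] = q
  have s: "Measurable.pred M (\<lambda>z. fun_upd (spin (q z) (f z)) x b w)" for b w
  proof (cases "w = x")
    case False
    have "Measurable.pred M (\<lambda>z. f z (True, w, 0) \<le> q z)" by measurable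
    with False show ?thesis by (simp add: spin_def)
  qed simp
  have [measurable]: "Measurable.pred M (\<lambda>z. left_spin (fun_upd (spin (q z) (f z)) x b) (clock (f z)) y t)" for b
    by (rule measurable_left_spin[OF s T]) simp
  show ?thesis unfolding pivotal_def by measurable
qed

text \<open>The event that \<open>x\<close> is pivotal at the level of its own uniform variable. At most one vertex can
  have this property, because \<open>p \<mapsto> left_spin (spin p \<omega>)\<close> is monotone and jumps only once; this
  replaces Russo's formula.\<close>

definition trace_at :: "'v \<Rightarrow> 'v \<Rightarrow> real \<Rightarrow> (bool \<times> 'v \<times> nat \<Rightarrow> real) set" where
  "trace_at x y t = {\<omega>. pivotal (\<omega> (True, x, 0)) \<omega> x y t}"

lemma trace_at_sets: "trace_at x y t \<in> sets inputs"
proof -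
  have "Measurable.pred inputs (\<lambda>\<omega>. pivotal (\<omega> (True, x, 0)) \<omega> x y t)"
    by (rule measurable_pivotal) (simp_all add: inputs.coord_measurable)
  then show ?thesis by (simp add: pred_def trace_at_def)
qed

lemma trace_at_unique:
  assumes "\<omega> \<in> trace_at x y t" "\<omega> \<in> trace_at z y t" "\<omega> (True, x, 0) < \<omega> (True, z, 0)"
  shows False
proof -
  let ?u = "\<omega> (True, x, 0)" and ?v = "\<omega> (True, z, 0)"
  have "left_spin (fun_upd (spin ?u \<omega>) x True) (clock \<omega>) y t"
    using assms(1) by (simp add: trace_at_def pivotal_def)
  then have "left_spin (fun_upd (spin ?v \<omega>) z False) (clock \<omega>) y t"
    \<comment> \<open>Every vertex that is plus at the lower level, and also \<open>x\<close>, is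
      plus at the higher level and differs from \<open>z\<close>, whose own level is too high. So
      the first configuration lies below the second.\<close>
    by (rule left_spin_mono[rotated]) (use assms(3) in \<open>auto simp: spin_def split: if_splits\<close>)
  with assms(2) show False by (simp add: trace_at_def pivotal_def)
qed

lemma sum_trace_at:
  assumes F: "finite F"
  shows "(\<Sum>x\<in>F. emeasure inputs (trace_at x y t)) \<le> 1"
proof -
  \<comment> \<open>Uniqueness compares levels strictly, so ties have to be excluded first.\<close>
  have "AE \<omega> in inputs. \<forall>x\<in>F. \<forall>z\<in>F. x \<noteq> z \<longrightarrow> \<omega> (True, x, 0) \<noteq> \<omega> (True, z, 0 :: nat)"
  proof (intro AE_finite_allI F)
    fix x z
    show "AE \<omega> in inputs. x \<noteq> z \<longrightarrow> \<omega> (True, x, 0) \<noteq> \<omega> (True, z, 0 :: nat)"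
    proof (cases "x = z")
      case False
      have "AE \<omega> in inputs. \<omega> (True, x, 0) \<noteq> \<omega> (True, z, 0 :: nat)"
        using False by (intro inputs.AE_coord_neq inputs.coord_measurable emeasure_coord_law_atom) simp
      then show ?thesis by auto
    qed simp
  qed
  then have "AE \<omega> in inputs. (\<Sum>x\<in>F. indicator (trace_at x y t) \<omega>) \<le> (1 :: ennreal)"
  proof eventually_elim
    case (elim \<omega>)
    have "card {x \<in> F. \<omega> \<in> trace_at x y t} \<le> 1"
    proof (rule ccontr)
      assume "\<not> card {x \<in> F. \<omega> \<in> trace_at x y t} \<le> 1"
      then obtain x z where "x \<in> F" "\<omega> \<in> trace_at x y t" "z \<in> F" "\<omega> \<in> trace_at z y t" "x \<noteq> z"
        using F by (auto simp: card_le_Suc0_iff_eq)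
      moreover from this have "\<omega> (True, x, 0) \<noteq> \<omega> (True, z, 0)" using elim by blast
      ultimately show False
        using trace_at_unique[of \<omega> x y t z] trace_at_unique[of \<omega> z y t x] by linarith
    qed
    moreover have "(\<Sum>x\<in>F. indicator (trace_at x y t) \<omega> :: ennreal) = of_nat (card {x \<in> F. \<omega> \<in> trace_at x y t})"
      using F by (simp add: indicator_def sum.If_cases Int_def)
    moreover have "of_nat (card {x \<in> F. \<omega> \<in> trace_at x y t}) \<le> (of_nat 1 :: ennreal)"
      by (simp only: of_nat_le_iff calculation(1))
    ultimately show ?case by simp
  qed
  then have "(\<integral>\<^sup>+\<omega>. (\<Sum>x\<in>F. indicator (trace_at x y t) \<omega>) \<partial>inputs) \<le> (\<integral>\<^sup>+\<omega>. 1 \<partial>(inputs :: (bool \<times> 'v \<times> nat \<Rightarrow> real) measure))"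
    by (rule nn_integral_mono_AE)
  also have "\<dots> = 1" by simp
  also have "(\<integral>\<^sup>+\<omega>. (\<Sum>x\<in>F. indicator (trace_at x y t) \<omega>) \<partial>inputs) = (\<Sum>x\<in>F. emeasure inputs (trace_at x y t))"
    by (subst nn_integral_sum) (simp_all only: nn_integral_indicator borel_measurable_indicator trace_at_sets)
  finally show ?thesis .
qed

definition unif :: "real measure" where
  "unif = uniform_measure lborel {0..1}"

lemma prob_space_unif: "prob_space unif"
  unfolding unif_def by (rule prob_space_uniform_measure) auto

lemma sets_unif [measurable_cong]: "sets unif = sets borel"
  by (simp add: unif_def)

lemma coord_law_unif: "coord_law (True, x, n) = unif"
  by (simp add: coord_law_def unif_def)

text \<open>Whether \<open>x\<close> is pivotal at level \<open>p\<close> does not depend on the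
  uniform variable of \<open>x\<close>. Resampling this variable therefore lets it play the role of
  \<open>p\<close>.\<close>

lemma emeasure_trace_at:
  "emeasure inputs (trace_at x y t) = (\<integral>\<^sup>+p. emeasure inputs {\<omega>. pivotal p \<omega> x y t} \<partial>unif)"
proof -
  have piv: "{\<omega>. pivotal p \<omega> x y t} \<in> sets inputs" for p
  proof -
    have "Measurable.pred inputs (\<lambda>\<omega>. pivotal p \<omega> x y t)" by (rule measurable_pivotal) simp_all
    then show ?thesis by (simp add: pred_def)
  qed
  have *: "fun_upd \<omega> (True, x, 0) p \<in> trace_at x y t \<longleftrightarrow> pivotal p \<omega> x y t" for p \<omega>
  proof -
    have "fun_upd (spin p (fun_upd \<omega> (True, x, 0) p)) x b = fun_upd (spin p \<omega>) x b" for b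
      by (intro ext) (simp add: spin_def)
    moreover have "clock (fun_upd \<omega> (True, x, 0) p) = clock \<omega>"
      by (intro ext) (simp add: clock_def)
    ultimately show ?thesis by (simp add: trace_at_def pivotal_def)
  qed
  have "emeasure inputs (trace_at x y t) = (\<integral>\<^sup>+\<omega>. indicator (trace_at x y t) \<omega> \<partial>inputs)"
    by (simp add: trace_at_sets)
  also have "\<dots> = (\<integral>\<^sup>+p. \<integral>\<^sup>+\<omega>. indicator (trace_at x y t) (fun_upd \<omega> (True, x, 0) p) \<partial>inputs \<partial>coord_law (True, x, 0))"
    by (rule inputs.nn_integral_resample[symmetric]) (rule borel_measurable_indicator[OF trace_at_sets])
  also have "\<dots> = (\<integral>\<^sup>+p. \<integral>\<^sup>+\<omega>. indicator {\<omega>. pivotal p \<omega> x y t} \<omega> \<partial>inputs \<partial>unif)"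
    unfolding coord_law_unif by (simp add: * indicator_def)
  also have "\<dots> = (\<integral>\<^sup>+p. emeasure inputs {\<omega>. pivotal p \<omega> x y t} \<partial>unif)"
    using piv by simp
  finally show ?thesis .
qed

lemma pivotal_swap:
  "emeasure inputs {\<omega>. pivotal p \<omega> x y t} = emeasure inputs {\<omega>. pivotal p \<omega> y x t}"
proof -
  obtain \<phi> where \<phi>: "automorphism \<phi>" "\<phi> x = y" "\<phi> y = x" by (rule swapping_automorphism)
  have inj: "\<phi> a = \<phi> b \<longleftrightarrow> a = b" for a b
    using \<phi>(1) by (simp add: automorphism_def bij_is_inj inj_eq)
  have "fun_upd (\<lambda>z. spin p \<omega> (\<phi> z)) x b = (\<lambda>z. fun_upd (spin p \<omega>) y b (\<phi> z))" for b \<omega>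
    using inj \<phi>(2) by (auto simp: fun_eq_iff)
  note upd = this
  have "pivotal p (\<lambda>i. \<omega> (relabel \<phi> i)) x y t \<longleftrightarrow> pivotal p \<omega> y x t" for \<omega>
    unfolding pivotal_def spin_relabel clock_relabel upd left_spin_automorphism[OF \<phi>(1)] \<phi>(3) ..
  moreover have "{\<omega>. pivotal p \<omega> x y t} \<in> sets inputs"
  proof -
    have "Measurable.pred inputs (\<lambda>\<omega>. pivotal p \<omega> x y t)" by (rule measurable_pivotal) simp_all
    then show ?thesis by (simp add: pred_def)
  qed
  ultimately show ?thesis
    using inputs.prob_reindex[OF inj_relabel[OF \<phi>(1)] coord_law_relabel, of "{\<omega>. pivotal p \<omega> x y t}"]
    by (simp add: inputs.emeasure_eq_measure)
qed

end

lemma nn_integral_of_bool: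
  assumes "Measurable.pred M P"
  shows "(\<integral>\<^sup>+\<omega>. of_bool (P \<omega>) \<partial>M) = emeasure M {\<omega> \<in> space M. P \<omega>}"
proof -
  have "(\<integral>\<^sup>+\<omega>. of_bool (P \<omega>) \<partial>M) = (\<integral>\<^sup>+\<omega>. indicator {\<omega> \<in> space M. P \<omega>} \<omega> \<partial>M)"
    by (intro nn_integral_cong) (simp add: indicator_def)
  also have "\<dots> = emeasure M {\<omega> \<in> space M. P \<omega>}"
    using assms by (intro nn_integral_indicator) (simp add: pred_def)
  finally show ?thesis .
qed

lemma finite_diff_trans:
  assumes "finite {y. f y \<noteq> g y}" "finite {y. g y \<noteq> h y}"
  shows "finite {y. f y \<noteq> h y}"
  by (rule finite_subset[OF _ finite_UnI[OF assms]]) auto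

lemma finite_diff_sym: "finite {y. f y \<noteq> g y} \<Longrightarrow> finite {y. g y \<noteq> f y}"
  by (simp add: eq_commute)

context cubic_tree
begin

lemma nn_integral_pivotal_sum:
  assumes F: "finite F"
  shows "(\<integral>\<^sup>+z. (\<Sum>y\<in>F. of_bool (pivotal (fst z) (snd z) x y t)) \<partial>(unif \<Otimes>\<^sub>M inputs)) \<le> 1"
proof -
  have m: "Measurable.pred (unif \<Otimes>\<^sub>M inputs) (\<lambda>z. pivotal (fst z) (snd z) x y t)" for y
    by (rule measurable_pivotal) measurable
  have m': "Measurable.pred inputs (\<lambda>\<omega>. pivotal p \<omega> x y t)" for p y
    by (rule measurable_pivotal) simp_all
  have "(\<integral>\<^sup>+z. of_bool (pivotal (fst z) (snd z) x y t) \<partial>(unif \<Otimes>\<^sub>M inputs))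
      = emeasure inputs (trace_at y x t)" for y
  proof -
    have "(\<integral>\<^sup>+z. of_bool (pivotal (fst z) (snd z) x y t) \<partial>(unif \<Otimes>\<^sub>M inputs))
        = (\<integral>\<^sup>+p. \<integral>\<^sup>+\<omega>. of_bool (pivotal p \<omega> x y t) \<partial>inputs \<partial>unif)"
      using inputs.nn_integral_fst[OF measurable_of_bool[OF m[of y]]] by simp
    also have "\<dots> = (\<integral>\<^sup>+p. emeasure inputs {\<omega>. pivotal p \<omega> x y t} \<partial>unif)"
      using m' by (simp add: nn_integral_of_bool)
    also have "\<dots> = emeasure inputs (trace_at y x t)"
      unfolding emeasure_trace_at by (simp only: pivotal_swap[of _ x y])
    finally show ?thesis .
  qed
  then have "(\<integral>\<^sup>+z. (\<Sum>y\<in>F. of_bool (pivotal (fst z) (snd z) x y t)) \<partial>(unif \<Otimes>\<^sub>M inputs))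
      = (\<Sum>y\<in>F. emeasure inputs (trace_at y x t))"
    using m by (subst nn_integral_sum) (simp_all only: measurable_of_bool)
  then show ?thesis using sum_trace_at[OF F] by simp
qed

text \<open>The level and the inputs are treated as one random pair: the expected number of vertices
  for which \<open>x\<close> stays pivotal is at most 1, so this number is finite for almost every
  pair, and Fubini separates the level.\<close>

lemma AE_finitely_many_pivotal:
  "AE p in unif. AE \<omega> in inputs. finite {y. \<exists>N. \<forall>m\<ge>N. pivotal p \<omega> x y (real m)}"
proof -
  interpret unif: prob_space unif by (rule prob_space_unif)
  interpret pair_sigma_finite unif inputs ..
  let ?R = "unif \<Otimes>\<^sub>M inputs"
  let ?e = "\<lambda>z y. \<exists>N. \<forall>m\<ge>N. pivotal (fst z) (snd z) x y (real m)"
  have [measurable]: "Measurable.pred ?R (\<lambda>z. pivotal (fst z) (snd z) x y t)" for y t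
    by (rule measurable_pivotal) measurable
  let ?g = "\<lambda>F z. \<Sum>y\<in>F. of_bool (?e z y) :: ennreal"
  have g1: "(\<integral>\<^sup>+z. ?g F z \<partial>?R) \<le> 1" if F: "finite F" for F
  proof -
    let ?f = "\<lambda>m z. \<Sum>y\<in>F. of_bool (pivotal (fst z) (snd z) x y (real m)) :: ennreal"
    \<comment> \<open>Being pivotal at all late integer times is bounded by the lower limit of the
      indicators, the form that Fatou's lemma needs.\<close>
    have "?g F z \<le> liminf (\<lambda>m. ?f m z)" for z
    proof (rule Liminf_bounded)
      have "eventually (\<lambda>m. \<forall>y\<in>F. of_bool (?e z y) \<le> (of_bool (pivotal (fst z) (snd z) x y (real m)) :: ennreal)) sequentially"
      proof (intro eventually_ball_finite F ballI)
        fix y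
        show "eventually (\<lambda>m. of_bool (?e z y) \<le> (of_bool (pivotal (fst z) (snd z) x y (real m)) :: ennreal)) sequentially"
        proof (cases "?e z y")
          case True
          then have "eventually (\<lambda>m. pivotal (fst z) (snd z) x y (real m)) sequentially"
            by (simp add: eventually_sequentially)
          then show ?thesis by eventually_elim simp
        next
          case False
          then have "(of_bool (?e z y) :: ennreal) = 0" by (subst of_bool_eq_0_iff)
          then show ?thesis by (simp only: zero_le eventually_True)
        qed
      qed
      then show "eventually (\<lambda>m. ?g F z \<le> ?f m z) sequentially"
        by eventually_elim (intro sum_mono, simp)
    qed
    then have "(\<integral>\<^sup>+z. ?g F z \<partial>?R) \<le> (\<integral>\<^sup>+z. liminf (\<lambda>m. ?f m z) \<partial>?R)"
      by (intro nn_integral_mono)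
    also have "\<dots> \<le> liminf (\<lambda>m. \<integral>\<^sup>+z. ?f m z \<partial>?R)"
      by (rule nn_integral_liminf) measurable
    also have "\<dots> \<le> liminf (\<lambda>m :: nat. 1)"
      using nn_integral_pivotal_sum[OF F] by (intro Liminf_mono always_eventually) blast
    also have "\<dots> = 1" by (simp add: Liminf_const)
    finally show ?thesis .
  qed
  \<comment> \<open>An exhaustion by finite sets; the bound 1 does not depend on the set.\<close>
  define F where "F k = from_nat_into (UNIV :: 'v set) ` {..<k}" for k :: nat
  have "(\<integral>\<^sup>+z. (SUP k. ?g (F k) z) \<partial>?R) = (SUP k. \<integral>\<^sup>+z. ?g (F k) z \<partial>?R)"
  proof (intro nn_integral_monotone_convergence_SUP)
    show "incseq (\<lambda>k. ?g (F k))"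
      by (intro incseq_SucI le_funI sum_mono2) (auto simp: F_def)
    show "\<And>k. ?g (F k) \<in> borel_measurable ?R" by measurable
  qed
  also have "\<dots> \<le> 1" by (intro SUP_least g1) (simp add: F_def)
  finally have "(\<integral>\<^sup>+z. (SUP k. ?g (F k) z) \<partial>?R) \<noteq> \<infinity>"
    by (metis ennreal_one_neq_top infinity_ennreal_def top.extremum_uniqueI)
  then have "AE z in ?R. (SUP k. ?g (F k) z) \<noteq> \<infinity>"
    by (intro nn_integral_PInf_AE) measurable
  then have "AE z in ?R. finite {y. ?e z y}"
  proof eventually_elim
    case (elim z)
    show "finite {y. ?e z y}"
    proof (rule ccontr)
      assume inf: "infinite {y. ?e z y}"
      have "of_nat K \<le> (SUP k. ?g (F k) z)" for K
      proof -
        obtain S where S: "S \<subseteq> {y. ?e z y}" "finite S" "card S = K"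
          using infinite_arbitrarily_large[OF inf] by blast
        have "S \<subseteq> range (from_nat_into (UNIV :: 'v set))"
          using range_from_nat_into[OF _ countable_vertices] by simp
        then obtain C where C: "finite C" "S = from_nat_into UNIV ` C"
          using finite_subset_image[OF S(2)] by blast
        obtain k where "C \<subseteq> {..<k}" using finite_nat_iff_bounded C(1) by blast
        then have "S \<subseteq> F k" using C(2) by (auto simp: F_def)
        have "(of_nat K :: ennreal) = ?g S z" using S by (simp add: subset_eq)
        also have "\<dots> \<le> ?g (F k) z"
          using \<open>S \<subseteq> F k\<close> by (intro sum_mono2) (auto simp: F_def)
        also have "\<dots> \<le> (SUP k. ?g (F k) z)" by (rule SUP_upper) simp
        finally show ?thesis .
      qed
      then have "(SUP k. ?g (F k) z) = \<infinity>"
        by (rule ennreal_eq_infinityI)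
      with elim show False by blast
    qed
  qed
  from AE_pair[OF this] show ?thesis by simp
qed

text \<open>This is all that the sequel uses about the level. The endpoints are excluded because
  forcing a spin to either value relies on \<open>0 < p < 1\<close>.\<close>

definition stable :: "real \<Rightarrow> bool" where
  "stable p \<longleftrightarrow> 0 < p \<and> p < 1 \<and> (\<forall>x. AE \<omega> in inputs.
     finite {y. final (fun_upd (spin p \<omega>) x True) (clock \<omega>) y \<noteq> final (fun_upd (spin p \<omega>) x False) (clock \<omega>) y})"

theorem AE_stable: "AE p in unif. stable p"
proof -
  have "AE p in unif. \<forall>x\<in>UNIV. AE \<omega> in inputs. finite {y. \<exists>N. \<forall>m\<ge>N. pivotal p \<omega> x y (real m)}"
    by (subst AE_ball_countable[OF countable_vertices]) (intro ballI AE_finitely_many_pivotal)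
  moreover have "AE p in unif. 0 < p \<and> p < 1"
    unfolding unif_def
  proof (rule AE_uniform_measureI)
    show "AE p in lborel. p \<in> {0..1} \<longrightarrow> 0 < p \<and> p < (1 :: real)"
      using AE_lborel_singleton[of 0] AE_lborel_singleton[of 1] by eventually_elim auto
  qed simp
  ultimately show ?thesis
  proof eventually_elim
    case (elim p)
    have "AE \<omega> in inputs. finite {y. final (fun_upd (spin p \<omega>) x True) (clock \<omega>) y
        \<noteq> final (fun_upd (spin p \<omega>) x False) (clock \<omega>) y}" for x
    proof -
      have 1: "AE \<omega> in inputs. finite {y. \<exists>N. \<forall>m\<ge>N. pivotal p \<omega> x y (real m)}"
        using elim by blast
      have 2: "AE \<omega> in inputs. \<forall>b y. fixates (fun_upd (spin p \<omega>) x b) (clock \<omega>) y"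
        using AE_set_spin[of p "\<lambda>\<xi> T. \<forall>y. fixates \<xi> T y", OF _ _ AE_fixates] elim by blast
      from 1 2 AE_admissible show ?thesis
      proof eventually_elim
        case (elim \<omega>)
        let ?s = "\<lambda>b. fun_upd (spin p \<omega>) x b"
        \<comment> \<open>Once both evolutions have fixated at \<open>y\<close>, a difference in the
          limit is a difference at every later time, and monotonicity gives it the sign required for
          pivotality.\<close>
        have "\<exists>N. \<forall>m\<ge>N. pivotal p \<omega> x y (real m)"
          if ne: "final (?s True) (clock \<omega>) y \<noteq> final (?s False) (clock \<omega>) y" for y
        proof -
          have "\<forall>b. \<exists>t0. \<forall>t>t0. left_spin (?s b) (clock \<omega>) y t = final (?s b) (clock \<omega>) y"
            using fixates_final[OF elim(3)] elim(2) by blast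
          then obtain t0 where t0: "\<And>b t. t > t0 b \<Longrightarrow> left_spin (?s b) (clock \<omega>) y t = final (?s b) (clock \<omega>) y"
            by metis
          obtain N :: nat where N: "max (t0 True) (t0 False) < real N" using reals_Archimedean2 by blast
          have "pivotal p \<omega> x y (real m)" if "m \<ge> N" for m
          proof -
            have m: "real m > t0 True" "real m > t0 False" using that N by auto
            have "left_spin (?s False) (clock \<omega>) y (real m) \<Longrightarrow> left_spin (?s True) (clock \<omega>) y (real m)"
              by (rule left_spin_mono[of "?s False" "?s True"]) (simp_all split: if_splits)
            then show ?thesis
              using ne t0[of True, OF m(1)] t0[of False, OF m(2)] unfolding pivotal_def by blast
          qed
          then show ?thesis by blast
        qed
        then show ?case by (intro finite_subset[OF _ elim(1)]) blast
      qed
    qed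
    then show ?case using elim by (simp add: stable_def)
  qed
qed

text \<open>Spins are changed one at a time. The induction hypothesis must then hold at the altered
  configuration, where it remains almost sure because both values of a spin have positive
  probability. There are only countably many finite sets to consider.\<close>

lemma stable_finite_change:
  assumes p: "stable p"
  shows "AE \<omega> in inputs. \<forall>\<xi>. finite {x. \<xi> x \<noteq> spin p \<omega> x} \<longrightarrow>
    finite {y. final \<xi> (clock \<omega>) y \<noteq> final (spin p \<omega>) (clock \<omega>) y}"
proof -
  have p01: "0 < p" "p < 1" using p by (auto simp: stable_def)
  have *: "AE \<omega> in inputs. \<forall>\<xi>. (\<forall>x. x \<notin> F \<longrightarrow> \<xi> x = spin p \<omega> x) \<longrightarrow>
      finite {y. final \<xi> (clock \<omega>) y \<noteq> final (spin p \<omega>) (clock \<omega>) y}" if "finite F" for F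
    using that
  proof (induction F rule: finite_induct)
    case empty
    show ?case
    proof (intro AE_I2 allI impI)
      fix \<omega> and \<xi> :: "'v \<Rightarrow> bool" assume "\<forall>x. x \<notin> {} \<longrightarrow> \<xi> x = spin p \<omega> x"
      then have "\<xi> = spin p \<omega>" by (intro ext) simp
      then show "finite {y. final \<xi> (clock \<omega>) y \<noteq> final (spin p \<omega>) (clock \<omega>) y}" by simp
    qed
  next
    case (insert x F)
    let ?Q = "\<lambda>\<eta> T. \<forall>\<xi>. (\<forall>z. z \<notin> F \<longrightarrow> \<xi> z = \<eta> z) \<longrightarrow> finite {y. final \<xi> T y \<noteq> final \<eta> T y}"
    have 1: "AE \<omega> in inputs. \<forall>b. ?Q (fun_upd (spin p \<omega>) x b) (clock \<omega>)"
      using AE_set_spin[of p ?Q x, OF p01 insert.IH] .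
    have 2: "AE \<omega> in inputs. finite {y. final (fun_upd (spin p \<omega>) x True) (clock \<omega>) y
        \<noteq> final (fun_upd (spin p \<omega>) x False) (clock \<omega>) y}"
      using p unfolding stable_def by blast
    from 1 2 show ?case
    proof eventually_elim
      case (elim \<omega>)
      let ?s = "\<lambda>b. fun_upd (spin p \<omega>) x b"
      have flip: "finite {y. final (?s b) (clock \<omega>) y \<noteq> final (?s b') (clock \<omega>) y}" for b b'
        using elim(2) finite_diff_sym[OF elim(2)] by (cases b; cases b') auto
      show ?case
      proof (intro allI impI)
        fix \<xi> assume \<xi>: "\<forall>z. z \<notin> insert x F \<longrightarrow> \<xi> z = spin p \<omega> z"
        have "\<forall>z. z \<notin> F \<longrightarrow> \<xi> z = ?s (\<xi> x) z" using \<xi> by simp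
        with elim(1) have "finite {y. final \<xi> (clock \<omega>) y \<noteq> final (?s (\<xi> x)) (clock \<omega>) y}"
          by blast
        from finite_diff_trans[OF this flip[of "\<xi> x" "spin p \<omega> x"]]
        show "finite {y. final \<xi> (clock \<omega>) y \<noteq> final (spin p \<omega>) (clock \<omega>) y}" by simp
      qed
    qed
  qed
  have "countable {F :: 'v set. finite F \<and> F \<subseteq> UNIV}"
    by (rule countable_Collect_finite_subset[OF countable_vertices])
  then have "AE \<omega> in inputs. \<forall>F\<in>{F. finite F \<and> F \<subseteq> UNIV}. \<forall>\<xi>. (\<forall>x. x \<notin> F \<longrightarrow> \<xi> x = spin p \<omega> x) \<longrightarrow>
      finite {y. final \<xi> (clock \<omega>) y \<noteq> final (spin p \<omega>) (clock \<omega>) y}"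
    using * by (subst AE_ball_countable) auto
  then show ?thesis
  proof eventually_elim
    case (elim \<omega>)
    show ?case
    proof (intro allI impI)
      fix \<xi> assume "finite {x. \<xi> x \<noteq> spin p \<omega> x}"
      then have "{x. \<xi> x \<noteq> spin p \<omega> x} \<in> {F. finite F \<and> F \<subseteq> UNIV}" by simp
      from bspec[OF elim this]
      show "finite {y. final \<xi> (clock \<omega>) y \<noteq> final (spin p \<omega>) (clock \<omega>) y}" by blast
    qed
  qed
qed

section \<open>Exchanging finitely many inputs\<close>

text \<open>From index \<open>N\<close> on, the exchange maps the waiting times up to ring
  \<open>k\<close> onto themselves, so their sum is unchanged.\<close>

lemma clock_exchange_late:
  assumes inj: "inj \<pi>" and form: "\<And>b x n. \<exists>m. \<pi> (b, x, n) = (b, x, m)"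
    and N: "\<And>b x n. \<pi> (b, x, n) \<noteq> (b, x, n) \<Longrightarrow> n \<le> N" and k: "k \<ge> N"
  shows "clock (\<lambda>i. \<omega> (\<pi> i)) x k = clock \<omega> x k"
proof -
  let ?S = "(\<lambda>n. (False, x, n)) ` {..k}"
  have "\<pi> ` ?S \<subseteq> ?S"
  proof
    fix i assume "i \<in> \<pi> ` ?S"
    then obtain n where n: "n \<le> k" "i = \<pi> (False, x, n)" by auto
    obtain m where m: "\<pi> (False, x, n) = (False, x, m)" using form by blast
    have "m \<le> k"
    proof (cases "m = n")
      case False
      have "\<pi> (False, x, m) \<noteq> (False, x, m)"
        using False m inj by (metis Pair_inject injD)
      then show ?thesis using N k by force
    qed (use n in simp)
    then show "i \<in> ?S" using n m by auto
  qed
  then have img: "\<pi> ` ?S = ?S"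
    using inj by (intro endo_inj_surj) (auto intro: inj_on_subset)
  have "clock (\<lambda>i. \<omega> (\<pi> i)) x k = (\<Sum>i\<in>?S. \<omega> (\<pi> i))"
    unfolding clock_def by (subst sum.reindex) (auto simp: inj_on_def)
  also have "\<dots> = (\<Sum>i\<in>\<pi> ` ?S. \<omega> i)"
    using inj by (subst sum.reindex) (auto intro: inj_on_subset)
  also have "\<dots> = clock \<omega> x k"
    unfolding img clock_def by (subst sum.reindex) (auto simp: inj_on_def)
  finally show ?thesis .
qed

lemma stable_exchange:
  assumes p: "stable p" and inj: "inj \<pi>" and fin: "finite {i. \<pi> i \<noteq> i}"
    and form: "\<And>b x n. \<exists>m. \<pi> (b, x, n) = (b, x, m)"
  shows "AE \<omega> in inputs. finite {y. final (spin p (\<lambda>i. \<omega> (\<pi> i))) (clock (\<lambda>i. \<omega> (\<pi> i))) y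
    \<noteq> final (spin p \<omega>) (clock \<omega>) y}"
proof -
  have law: "coord_law (\<pi> i) = coord_law i" for i
    using form[of "fst i" "fst (snd i)" "snd (snd i)"] by (auto simp: coord_law_def)
  define F where "F = (\<lambda>i. fst (snd i)) ` {i. \<pi> i \<noteq> i}"
  have F: "finite F" unfolding F_def using fin by simp
  have id: "\<pi> (b, x, n) = (b, x, n)" if "x \<notin> F" for b x n
    using that unfolding F_def by force
  obtain N where "(\<lambda>i. snd (snd i)) ` {i. \<pi> i \<noteq> i} \<subseteq> {..N}"
    using finite_nat_iff_bounded_le fin by blast
  then have N: "n \<le> N" if "\<pi> (b, x, n) \<noteq> (b, x, n)" for b x n
    using that by force
  note change = stable_finite_change[OF p]
  from change inputs.AE_reindex[OF inj law change] AE_admissible inputs.AE_reindex[OF inj law AE_admissible]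
  show ?thesis
  proof eventually_elim
    case (elim \<omega>)
    let ?\<omega> = "\<lambda>i. \<omega> (\<pi> i)"
    let ?T = "clock \<omega>" and ?T' = "clock ?\<omega>"
    have out: "?T' x = ?T x" "spin p ?\<omega> x = spin p \<omega> x" if "x \<notin> F" for x
      by (intro ext) (simp_all add: clock_def spin_def id[OF that])
    have late: "?T' x k = ?T x k" if "k \<ge> N" for x k
      using inj form N that by (rule clock_exchange_late)
    \<comment> \<open>By this time every affected clock has passed ring \<open>N\<close>, so the
      altered rings are over.\<close>
    define t where "t = Max (insert 0 ((\<lambda>x. ?T x N) ` F))"
    have t: "?T x N \<le> t" if "x \<in> F" for x
      unfolding t_def using F that by (intro Max_ge) auto
    have "\<forall>y. \<exists>B. finite B \<and> (\<forall>\<xi>. (\<forall>z\<in>B. \<xi> z) \<longrightarrow> (\<forall>s\<le>t. left_spin \<xi> ?T y s))"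
      using left_spin_plus_near[OF elim(3)] by blast
    then obtain B where B: "\<And>y. finite (B y)"
      "\<And>y \<xi> s. (\<forall>z\<in>B y. \<xi> z) \<Longrightarrow> s \<le> t \<Longrightarrow> left_spin \<xi> ?T y s" by metis
    \<comment> \<open>Plus on the sets \<open>B y\<close> keeps the affected vertices and their
      neighbours plus up to time \<open>t\<close>. The set \<open>F\<close> itself is included to
      mask the exchanged initial spins.\<close>
    define C where "C = F \<union> (\<Union>y\<in>F. B y) \<union> (\<Union>x\<in>F. \<Union>y\<in>{y. adj x y}. B y)"
    have C: "finite C" unfolding C_def using F B(1) finite_neighbours by auto
    \<comment> \<open>A bridge between the two evolutions: it differs at finitely many vertices from
      the original and from the exchanged initial spins, and the two clocks act on it
      identically.\<close>
    define \<xi> where "\<xi> z \<longleftrightarrow> z \<in> C \<or> spin p \<omega> z" for z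
    have same: "left_spin \<xi> ?T' = left_spin \<xi> ?T"
    proof (rule left_spin_clock_change[OF elim(3) elim(4), of F N t])
      show "left_spin \<xi> ?T x s" if "x \<in> F" "s \<le> t" for x s
        using that by (intro B(2)) (auto simp: \<xi>_def C_def)
      show "left_spin \<xi> ?T y s" if "x \<in> F" "adj x y" "s \<le> t" for x y s
        using that by (intro B(2)) (auto simp: \<xi>_def C_def)
    qed (use out late t in auto)
    \<comment> \<open>Final spins are read off at ring times, and these agree from ring
      \<open>N\<close> on.\<close>
    have "final \<xi> ?T' x = final \<xi> ?T x" for x
      unfolding final_def same using late
      by (metis (no_types, lifting) dual_order.trans nle_le)
    moreover have "finite {y. final \<xi> ?T y \<noteq> final (spin p \<omega>) ?T y}"
    proof -
      have "finite {x. \<xi> x \<noteq> spin p \<omega> x}"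
        by (rule finite_subset[OF _ C]) (auto simp: \<xi>_def)
      with elim(1) show ?thesis by blast
    qed
    moreover have "finite {x. \<xi> x \<noteq> spin p ?\<omega> x}"
      by (rule finite_subset[OF _ C]) (use out in \<open>auto simp: \<xi>_def C_def\<close>)
    then have "finite {y. final \<xi> ?T' y \<noteq> final (spin p ?\<omega>) ?T' y}" using elim(2) by blast
    ultimately show ?case
      using finite_diff_trans[OF finite_diff_sym, of "final \<xi> ?T'" "final (spin p ?\<omega>) ?T'"] by simp
  qed
qed

end

section \<open>Decorrelation from near\<close>

lemma (in prob_space) prob_diff_le:
  assumes "X \<in> events" "Y \<in> events" "D \<in> events" "X - Y \<union> (Y - X) \<subseteq> D"
  shows "\<bar>prob X - prob Y\<bar> \<le> prob D"
proof -
  have "prob X \<le> prob (Y \<union> D)" "prob Y \<le> prob (X \<union> D)"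
    using assms by (auto intro!: finite_measure_mono)
  moreover have "prob (Y \<union> D) \<le> prob Y + prob D" "prob (X \<union> D) \<le> prob X + prob D"
    using assms by (auto intro!: measure_Un_le)
  ultimately show ?thesis by linarith
qed

text \<open>The average of the indicators of the \<open>C j\<close> is close to the constant \<open>c\<close> in mean square.\<close>

lemma (in prob_space) average_decorrelation:
  fixes m :: nat and h c :: real
  assumes C: "\<And>j. j < m \<Longrightarrow> C j \<in> events" "\<And>j. j < m \<Longrightarrow> prob (C j) = c"
    and indep: "\<And>i j. i < m \<Longrightarrow> j < m \<Longrightarrow> i \<noteq> j \<Longrightarrow> prob (C i \<inter> C j) = c * c"
    and B: "B \<in> events" and h: "0 < h" "1 \<le> h * h * m"
  shows "\<bar>\<Sum>j<m. prob (C j \<inter> B) - c * prob B\<bar> \<le> h * m"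
proof -
  define Z where "Z j \<omega> = indicator (C j) \<omega> - c" for j \<omega>
  have m: "0 < m" using h by (cases m) auto
  have c: "0 \<le> c" "c \<le> 1" using C(2)[OF m] by auto
  have Zm [measurable]: "Z j \<in> borel_measurable M" if "j < m" for j
    unfolding Z_def[abs_def] using C(1)[OF that] by measurable
  have Zb: "\<bar>Z j \<omega>\<bar> \<le> 1" for j \<omega>
    using c by (auto simp: Z_def indicator_def abs_le_iff)
  have ZZ: "\<bar>Z i \<omega> * Z j \<omega>\<bar> \<le> 1" for i j \<omega>
    using mult_mono[OF Zb Zb, of i \<omega> j \<omega>] by (simp add: abs_mult mult.commute)
  have intZZ: "integrable M (\<lambda>\<omega>. Z i \<omega> * Z j \<omega>)" if "i < m" "j < m" for i j
    using that ZZ by (intro integrable_const_bound[of _ 1]) auto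
  have EZZ: "expectation (\<lambda>\<omega>. Z i \<omega> * Z j \<omega>) = prob (C i \<inter> C j) - c * c" if ij: "i < m" "j < m" for i j
  proof -
    have "Z i \<omega> * Z j \<omega> = indicator (C i \<inter> C j) \<omega> - c * indicator (C i) \<omega> - c * indicator (C j) \<omega> + c * c" for \<omega>
      by (simp add: Z_def algebra_simps indicator_def)
    then have "expectation (\<lambda>\<omega>. Z i \<omega> * Z j \<omega>)
        = expectation (\<lambda>\<omega>. indicator (C i \<inter> C j) \<omega> - c * indicator (C i) \<omega> - c * indicator (C j) \<omega> + c * c)"
      by simp
    also have "\<dots> = prob (C i \<inter> C j) - c * prob (C i) - c * prob (C j) + c * c"
    proof -
      have I: "integrable M (indicat_real E)" "expectation (indicat_real E) = prob E" if "E \<in> events" for E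
        using that by (auto simp: integrable_real_indicator emeasure_eq_measure)
      note Ii = I[OF C(1)[OF ij(1)]] and Ij = I[OF C(1)[OF ij(2)]]
        and Iij = I[OF sets.Int[OF C(1)[OF ij(1)] C(1)[OF ij(2)]]]
      show ?thesis
        by (subst Bochner_Integration.integral_add Bochner_Integration.integral_diff,
            (intro Bochner_Integration.integrable_diff integrable_mult_right Ii Ij Iij integrable_const)+)+
          (simp add: C(1)[OF ij(1)] C(1)[OF ij(2)] prob_space sets.Int_space_eq2 sets.Int)
    qed
    finally show ?thesis using C(2) ij by simp
  qed
  define S where "S \<omega> = (\<Sum>j<m. Z j \<omega>)" for \<omega>
  have S2: "S \<omega> * S \<omega> = (\<Sum>i<m. \<Sum>j<m. Z i \<omega> * Z j \<omega>)" for \<omega>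
    unfolding S_def by (rule sum_product)
  have intS2: "integrable M (\<lambda>\<omega>. S \<omega> * S \<omega>)"
    unfolding S2 by (intro Bochner_Integration.integrable_sum intZZ) auto
  have "expectation (\<lambda>\<omega>. S \<omega> * S \<omega>) = (\<Sum>i<m. \<Sum>j<m. prob (C i \<inter> C j) - c * c)"
  proof -
    have "expectation (\<lambda>\<omega>. S \<omega> * S \<omega>) = (\<Sum>i<m. expectation (\<lambda>\<omega>. \<Sum>j<m. Z i \<omega> * Z j \<omega>))"
      unfolding S2
      by (intro Bochner_Integration.integral_sum Bochner_Integration.integrable_sum intZZ) auto
    also have "\<dots> = (\<Sum>i<m. \<Sum>j<m. expectation (\<lambda>\<omega>. Z i \<omega> * Z j \<omega>))"
      by (intro sum.cong refl Bochner_Integration.integral_sum intZZ) auto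
    also have "\<dots> = (\<Sum>i<m. \<Sum>j<m. prob (C i \<inter> C j) - c * c)"
      by (intro sum.cong refl EZZ) auto
    finally show ?thesis .
  qed
  \<comment> \<open>Pairwise independence removes the off-diagonal covariances.\<close>
  also have "\<dots> = (\<Sum>i<m. \<Sum>j<m. if i = j then c - c * c else 0)"
    using indep C(2) by (intro sum.cong refl) auto
  also have "\<dots> = m * (c - c * c)" by simp
  also have "\<dots> \<le> real m * 1"
  proof (rule mult_left_mono)
    have "0 \<le> c * c" by simp
    then show "c - c * c \<le> 1" using c by linarith
  qed simp
  finally have ES2: "expectation (\<lambda>\<omega>. S \<omega> * S \<omega>) \<le> m" by simp
  have Sm [measurable]: "S \<in> borel_measurable M" unfolding S_def[abs_def] by measurable
  have intIS: "integrable M (\<lambda>\<omega>. indicator B \<omega> * Z j \<omega>)" if "j < m" for j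
    using that B Zb by (intro integrable_const_bound[of _ 1]) (auto simp: indicator_def)
  have "(\<Sum>j<m. prob (C j \<inter> B) - c * prob B) = expectation (\<lambda>\<omega>. indicator B \<omega> * S \<omega>)"
  proof -
    have "expectation (\<lambda>\<omega>. indicator B \<omega> * Z j \<omega>) = prob (C j \<inter> B) - c * prob B" if j: "j < m" for j
    proof -
      have "indicator B \<omega> * Z j \<omega> = indicator (C j \<inter> B) \<omega> - c * indicator B \<omega>" for \<omega>
        by (auto simp: Z_def indicator_def)
      then have "expectation (\<lambda>\<omega>. indicator B \<omega> * Z j \<omega>)
          = expectation (\<lambda>\<omega>. indicator (C j \<inter> B) \<omega> - c * indicator B \<omega>)" by simp
      also have "\<dots> = expectation (indicator (C j \<inter> B)) - expectation (\<lambda>\<omega>. c * indicator B \<omega>)"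
        using C(1)[OF j] B
        by (intro Bochner_Integration.integral_diff integrable_mult_right integrable_real_indicator)
          (auto simp: emeasure_eq_measure)
      finally show ?thesis using C(1)[OF j] B by (simp add: sets.Int_space_eq2 sets.Int)
    qed
    then show ?thesis
      unfolding S_def sum_distrib_left using intIS by (subst Bochner_Integration.integral_sum) auto
  qed
  also have "\<bar>\<dots>\<bar> \<le> expectation (\<lambda>\<omega>. \<bar>indicator B \<omega> * S \<omega>\<bar>)" by (rule integral_abs_bound)
  also have "\<dots> \<le> expectation (\<lambda>\<omega>. (S \<omega> * S \<omega> / (h * m) + h * m) / 2)"
  proof (rule integral_mono)
    show "integrable M (\<lambda>\<omega>. \<bar>indicator B \<omega> * S \<omega>\<bar>)"
      unfolding S_def sum_distrib_left
      by (intro integrable_abs Bochner_Integration.integrable_sum intIS) auto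
    show "integrable M (\<lambda>\<omega>. (S \<omega> * S \<omega> / (h * m) + h * m) / 2)" using intS2 by simp
    fix \<omega>
    have "\<bar>indicator B \<omega> * S \<omega>\<bar> \<le> \<bar>S \<omega>\<bar>" by (simp add: indicator_def)
    also have "\<dots> \<le> (S \<omega> * S \<omega> / (h * m) + h * m) / 2"
    proof -
      \<comment> \<open>The inequality between arithmetic and geometric mean with weight
        \<open>q\<close>. Since the second moment is at most \<open>m\<close>, and
        \<open>1 \<le> h * h * m\<close>, both resulting terms are at most
        \<open>h * m\<close>.\<close>
      define q where "q = h * m"
      have q: "0 < q" using h m by (simp add: q_def)
      have "0 \<le> (\<bar>S \<omega>\<bar> - q) * (\<bar>S \<omega>\<bar> - q)" by simp
      then have "2 * \<bar>S \<omega>\<bar> * q \<le> S \<omega> * S \<omega> + q * q" by (simp add: algebra_simps)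
      then have "2 * \<bar>S \<omega>\<bar> \<le> (S \<omega> * S \<omega> + q * q) / q" using q by (simp only: pos_le_divide_eq)
      also have "\<dots> = S \<omega> * S \<omega> / q + q" using q by (simp add: add_divide_distrib)
      finally show ?thesis by (simp add: q_def)
    qed
    finally show "\<bar>indicator B \<omega> * S \<omega>\<bar> \<le> (S \<omega> * S \<omega> / (h * m) + h * m) / 2" .
  qed
  also have "\<dots> = (expectation (\<lambda>\<omega>. S \<omega> * S \<omega>) / (h * m) + h * m) / 2"
    using intS2 by (simp add: prob_space)
  also have "\<dots> \<le> (m / (h * m) + h * m) / 2"
    using ES2 h by (intro divide_right_mono add_right_mono) auto
  also have "\<dots> \<le> h * m"
  proof -
    have "m / (h * m) \<le> h * m" using h m by (simp add: field_simps)
    then show ?thesis by simp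
  qed
  finally show ?thesis .
qed

text \<open>The images of the block \<open>{..<N}\<close> are disjoint for different \<open>j\<close>, and as the waiting times are only
  permuted, late ring times do not change.\<close>

definition exchange :: "'v set \<Rightarrow> nat \<Rightarrow> nat \<Rightarrow> bool \<times> 'v \<times> nat \<Rightarrow> bool \<times> 'v \<times> nat" where
  "exchange X N j = (\<lambda>(b, x, n). (b, x,
     if x \<in> X then if n < N then n + j * N else if j * N \<le> n \<and> n < Suc j * N then n - j * N else n else n))"

text \<open>For \<open>j > 0\<close> two disjoint blocks of length \<open>N\<close> trade places.
  The case \<open>j = 0\<close> is separate because the blocks coincide there and the map is the
  identity.\<close>

lemma exchange_involution: "exchange X N j (exchange X N j i) = i"
proof (cases "j = 0")
  case True
  then show ?thesis by (cases i) (auto simp: exchange_def)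
next
  case False
  define a where "a = j * N"
  have a: "Suc j * N = N + a" "N \<le> a" using False by (simp_all add: a_def)
  show ?thesis
    using a(2) by (cases i) (auto simp: exchange_def a(1) a_def[symmetric] simp del: mult_Suc)
qed

lemma inj_exchange: "inj (exchange X N j)"
  by (metis exchange_involution injI)

lemma coord_law_exchange: "coord_law (exchange X N j i) = coord_law i"
  by (cases i) (simp add: exchange_def coord_law_def)

lemma finite_exchange: assumes "finite X" shows "finite {i. exchange X N j i \<noteq> i}"
proof (rule finite_subset)
  show "{i. exchange X N j i \<noteq> i} \<subseteq> UNIV \<times> X \<times> {..<Suc j * N}"
    by (auto simp: exchange_def split: if_splits)
qed (use assms in simp)

section \<open>Mixing of the final configuration for the canonical inputs\<close>

context cubic_tree
begin

definition final_config :: "real \<Rightarrow> (bool \<times> 'v \<times> nat \<Rightarrow> real) \<Rightarrow> 'v \<Rightarrow> bool" where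
  "final_config p \<omega> = final (spin p \<omega>) (clock \<omega>)"

lemma final_config_measurable [measurable]: "Measurable.pred inputs (\<lambda>\<omega>. final_config p \<omega> x)"
  unfolding final_config_def by (rule measurable_final) measurable

text \<open>Almost surely the set of changed vertices is finite, so it lies in a large finite set
  with high probability, by continuity from above. All supersets are included because one set will
  have to serve several exchanges.\<close>

lemma exchange_far:
  assumes p: "stable p" and X: "finite X" and \<delta>: "\<delta> > 0"
  shows "\<exists>G. finite G \<and> (\<forall>G'. G \<subseteq> G' \<longrightarrow>
    {\<omega>. \<exists>x. x \<notin> G' \<and> final_config p (\<lambda>i. \<omega> (exchange X N j i)) x \<noteq> final_config p \<omega> x} \<in> sets inputs
    \<and> inputs.prob {\<omega>. \<exists>x. x \<notin> G' \<and> final_config p (\<lambda>i. \<omega> (exchange X N j i)) x \<noteq> final_config p \<omega> x} < \<delta>)"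
proof -
  let ?d = "\<lambda>\<omega> x. final_config p (\<lambda>i. \<omega> (exchange X N j i)) x \<noteq> final_config p \<omega> x"
  let ?D = "\<lambda>G. {\<omega>. \<exists>x. x \<notin> G \<and> ?d \<omega> x}"
  have d: "{\<omega>. ?d \<omega> x} \<in> sets inputs" for x
  proof -
    have [measurable]: "Measurable.pred inputs (\<lambda>\<omega>. final_config p (\<lambda>i. \<omega> (exchange X N j i)) x)"
      by (rule measurable_compose[OF inputs.reindex_measurable final_config_measurable])
    have "Measurable.pred inputs (\<lambda>\<omega>. ?d \<omega> x)" by measurable
    then show ?thesis by (simp add: pred_def)
  qed
  have D: "?D G \<in> sets inputs" for G
  proof -
    have "(\<Union>x\<in>- G. {\<omega>. ?d \<omega> x}) \<in> sets inputs"
      using d countable_subset[OF _ countable_vertices] by (intro sets.countable_UN') auto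
    moreover have "(\<Union>x\<in>- G. {\<omega>. ?d \<omega> x}) = ?D G" by auto
    ultimately show ?thesis by simp
  qed
  define F where "F k = from_nat_into (UNIV :: 'v set) ` {..<k}" for k :: nat
  have surj: "range (from_nat_into (UNIV :: 'v set)) = UNIV"
    using range_from_nat_into[OF _ countable_vertices] by simp
  have "(\<lambda>k. inputs.prob (?D (F k))) \<longlonglongrightarrow> inputs.prob (\<Inter>k. ?D (F k))"
  proof (rule inputs.finite_Lim_measure_decseq)
    show "range (\<lambda>k. ?D (F k)) \<subseteq> sets inputs" using D by blast
    show "decseq (\<lambda>k. ?D (F k))"
    proof (rule decseq_SucI)
      fix k
      have "F k \<subseteq> F (Suc k)" by (auto simp: F_def)
      then show "?D (F (Suc k)) \<subseteq> ?D (F k)" by blast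
    qed
  qed
  moreover have "inputs.prob (\<Inter>k. ?D (F k)) = 0"
  proof -
    have "AE \<omega> in inputs. finite {x. ?d \<omega> x}"
      using stable_exchange[OF p inj_exchange finite_exchange[OF X]]
      unfolding final_config_def by (auto simp: exchange_def)
    then have "AE \<omega> in inputs. \<omega> \<notin> (\<Inter>k. ?D (F k))"
    proof eventually_elim
      case (elim \<omega>)
      obtain C where C: "finite C" "{x. ?d \<omega> x} = from_nat_into UNIV ` C"
        using finite_subset_image[OF elim, of "from_nat_into UNIV" UNIV] surj by auto
      obtain k where "C \<subseteq> {..<k}" using finite_nat_iff_bounded C(1) by blast
      then have "{x. ?d \<omega> x} \<subseteq> F k" using C(2) by (auto simp: F_def)
      then have "\<omega> \<notin> ?D (F k)" by blast
      then show ?case by blast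
    qed
    moreover have "(\<Inter>k. ?D (F k)) \<in> sets inputs" by (intro sets.countable_INT) (use D in blast, simp)
    ultimately show ?thesis by (simp only: inputs.prob_eq_0)
  qed
  ultimately have "eventually (\<lambda>k. inputs.prob (?D (F k)) < \<delta>) sequentially"
    using \<delta> by (auto intro: order_tendstoD)
  then obtain k where k: "inputs.prob (?D (F k)) < \<delta>" by (auto simp: eventually_sequentially)
  have "inputs.prob (?D G') < \<delta>" if "F k \<subseteq> G'" for G'
  proof -
    have "inputs.prob (?D G') \<le> inputs.prob (?D (F k))"
      using that D by (intro inputs.finite_measure_mono) blast+
    with k show ?thesis by simp
  qed
  then show ?thesis using D by (intro exI[of _ "F k"]) (simp add: F_def)
qed

text \<open>The order of quantifiers is the point: the exchanges are determined by \<open>J\<close>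
  and \<open>\<epsilon>\<close>, so \<open>G\<close> depends neither on the cylinder event nor on
  the far event.\<close>

lemma cylinder_mixing:
  assumes p: "stable p" and C: "\<And>a. a \<in> \<A> \<Longrightarrow> C a \<in> sets inputs" "\<And>a. a \<in> \<A> \<Longrightarrow> depends_on J (C a)"
    and J: "finite J" and \<epsilon>: "\<epsilon> > 0"
  shows "\<exists>G. finite G \<and> (\<forall>a\<in>\<A>. \<forall>S. {\<omega>. final_config p \<omega> \<in> S} \<in> sets inputs \<longrightarrow>
    (\<forall>f g. (\<forall>x. x \<notin> G \<longrightarrow> f x = g x) \<longrightarrow> f \<in> S \<longleftrightarrow> g \<in> S) \<longrightarrow>
    \<bar>inputs.prob (C a \<inter> {\<omega>. final_config p \<omega> \<in> S}) - inputs.prob (C a) * inputs.prob {\<omega>. final_config p \<omega> \<in> S}\<bar> \<le> \<epsilon>)"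
proof -
  define X where "X = (\<lambda>i. fst (snd i)) ` J"
  have X: "finite X" unfolding X_def using J by simp
  obtain N where "(\<lambda>i. snd (snd i)) ` J \<subseteq> {..<N}"
    using finite_nat_iff_bounded[of "(\<lambda>i. snd (snd i)) ` J"] J by auto
  then have JN: "x \<in> X" "n < N" if "(b, x, n) \<in> J" for b x n
    using that by (force simp: X_def)+
  let ?\<pi> = "exchange X N"
  \<comment> \<open>One half of the error is spent on replacing the event by its copies, the other
    half on the fluctuation of their average.\<close>
  define h where "h = \<epsilon> / 2"
  have h: "0 < h" using \<epsilon> by (simp add: h_def)
  obtain m :: nat where "1 / (h * h) \<le> real m" using real_arch_simple by blast
  then have m: "1 \<le> h * h * m" using h by (simp add: field_simps)
  then have m0: "0 < m" by (cases m) auto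
  define bad where "bad j G' = {\<omega>. \<exists>x. x \<notin> G' \<and> final_config p (\<lambda>i. \<omega> (?\<pi> j i)) x \<noteq> final_config p \<omega> x}" for j G'
  have "\<forall>j. \<exists>G. finite G \<and> (\<forall>G'. G \<subseteq> G' \<longrightarrow> bad j G' \<in> sets inputs \<and> inputs.prob (bad j G') < h)"
    using exchange_far[OF p X h] unfolding bad_def by blast
  from choice[OF this] obtain G where
    G: "\<forall>j. finite (G j) \<and> (\<forall>G'. G j \<subseteq> G' \<longrightarrow> bad j G' \<in> sets inputs \<and> inputs.prob (bad j G') < h)"
    by (elim exE)
  let ?G = "\<Union>j<m. G j"
  show ?thesis
  proof (intro exI[of _ ?G] conjI ballI allI impI)
    show "finite ?G" using G by simp
    fix a S
    assume a: "a \<in> \<A>" and S: "{\<omega>. final_config p \<omega> \<in> S} \<in> sets inputs"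
      and far: "\<forall>f g. (\<forall>x. x \<notin> ?G \<longrightarrow> f x = g x) \<longrightarrow> f \<in> S \<longleftrightarrow> g \<in> S"
    let ?B = "{\<omega>. final_config p \<omega> \<in> S}"
    let ?C = "\<lambda>j. {\<omega>. (\<lambda>i. \<omega> (?\<pi> j i)) \<in> C a}"
    let ?K = "\<lambda>j. UNIV \<times> X \<times> {j * N..<Suc j * N} :: (bool \<times> 'v \<times> nat) set"
    define c where "c = inputs.prob (C a)"
    have vim: "{\<omega>. (\<lambda>i. \<omega> (?\<pi> j i)) \<in> E} \<in> sets inputs" if "E \<in> sets inputs" for j E
      using measurable_sets[OF inputs.reindex_measurable that, of "?\<pi> j"] by (simp add: vimage_def)
    have Cs: "?C j \<in> sets inputs" for j using C(1)[OF a] by (rule vim)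
    have Cp: "inputs.prob (?C j) = c" for j
      unfolding c_def by (rule inputs.prob_reindex[OF inj_exchange coord_law_exchange C(1)[OF a]])
    have Cd: "depends_on (?K j) (?C j)" for j
    proof (rule depends_on_mono[OF depends_on_vimage[OF C(2)[OF a]]])
      show "?\<pi> j ` J \<subseteq> ?K j"
      proof
        fix i assume "i \<in> ?\<pi> j ` J"
        then obtain b x n where "(b, x, n) \<in> J" "i = ?\<pi> j (b, x, n)" by auto
        with JN[of b x n] show "i \<in> ?K j" by (auto simp: exchange_def)
      qed
    qed
    have indep: "inputs.prob (?C i \<inter> ?C j) = c * c" if "i \<noteq> j" for i j
    proof -
      have "{i * N..<Suc i * N} \<inter> {j * N..<Suc j * N} = {}"
      proof (rule ccontr)
        assume "{i * N..<Suc i * N} \<inter> {j * N..<Suc j * N} \<noteq> {}"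
        then obtain n where "n \<in> {i * N..<Suc i * N} \<inter> {j * N..<Suc j * N}" by blast
        then have n: "i * N \<le> n" "n < Suc i * N" "j * N \<le> n" "n < Suc j * N" by simp_all
        have "n div N = i" using n by (intro div_nat_eqI) (simp_all add: mult.commute)
        moreover have "n div N = j" using n by (intro div_nat_eqI) (simp_all add: mult.commute)
        ultimately show False using that by simp
      qed
      then have "?K i \<inter> ?K j = {}" by blast
      from inputs.prob_Int_depends_on[OF Cs Cd Cs Cd this] show ?thesis by (simp only: Cp)
    qed
    have avg: "\<bar>\<Sum>j<m. inputs.prob (?C j \<inter> ?B) - c * inputs.prob ?B\<bar> \<le> h * m"
      by (rule inputs.average_decorrelation[where C = ?C]) (use Cs Cp indep S h m in simp_all)
    have swap: "\<bar>inputs.prob (C a \<inter> ?B) - inputs.prob (?C j \<inter> ?B)\<bar> \<le> h" if j: "j < m" for j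
    proof -
      let ?D = "bad j ?G"
      let ?B' = "{\<omega>. (\<lambda>i. \<omega> (?\<pi> j i)) \<in> ?B}"
      have sub: "G j \<subseteq> ?G" using j by auto
      \<comment> \<open>The exchange preserves the law and moves both events; undoing it on the far
        event alone costs at most the probability of a change outside \<open>?G\<close>.\<close>
      have "inputs.prob (C a \<inter> ?B) = inputs.prob {\<omega>. (\<lambda>i. \<omega> (?\<pi> j i)) \<in> C a \<inter> ?B}"
        using C(1)[OF a] S by (intro inputs.prob_reindex[symmetric] inj_exchange coord_law_exchange sets.Int)
      also have "{\<omega>. (\<lambda>i. \<omega> (?\<pi> j i)) \<in> C a \<inter> ?B} = ?C j \<inter> ?B'" by auto
      finally have eq: "inputs.prob (C a \<inter> ?B) = inputs.prob (?C j \<inter> ?B')" .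
      have "\<bar>inputs.prob (?C j \<inter> ?B') - inputs.prob (?C j \<inter> ?B)\<bar> \<le> inputs.prob ?D"
      proof (rule inputs.prob_diff_le)
        show "?C j \<inter> ?B' \<in> sets inputs" by (intro sets.Int Cs vim S)
        show "?C j \<inter> ?B \<in> sets inputs" by (intro sets.Int Cs S)
        show "?D \<in> sets inputs" using G sub by blast
        have "\<omega> \<in> ?D" if "(\<omega> \<in> ?B') \<noteq> (\<omega> \<in> ?B)" for \<omega>
        proof (rule ccontr)
          assume "\<omega> \<notin> ?D"
          then have "\<forall>x. x \<notin> ?G \<longrightarrow> final_config p (\<lambda>i. \<omega> (?\<pi> j i)) x = final_config p \<omega> x"
            unfolding bad_def by blast
          then have "final_config p (\<lambda>i. \<omega> (?\<pi> j i)) \<in> S \<longleftrightarrow> final_config p \<omega> \<in> S"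
            by (intro far[rule_format]) blast
          with that show False by simp
        qed
        then show "?C j \<inter> ?B' - ?C j \<inter> ?B \<union> (?C j \<inter> ?B - ?C j \<inter> ?B') \<subseteq> ?D" by blast
      qed
      also have "\<dots> \<le> h" using G sub by (blast intro: less_imp_le)
      finally show ?thesis unfolding eq .
    qed
    have "m * (inputs.prob (C a \<inter> ?B) - c * inputs.prob ?B)
        = (\<Sum>j<m. inputs.prob (C a \<inter> ?B) - inputs.prob (?C j \<inter> ?B)) + (\<Sum>j<m. inputs.prob (?C j \<inter> ?B) - c * inputs.prob ?B)"
      by (simp add: sum_subtractf algebra_simps)
    then have "\<bar>m * (inputs.prob (C a \<inter> ?B) - c * inputs.prob ?B)\<bar>
        \<le> \<bar>\<Sum>j<m. inputs.prob (C a \<inter> ?B) - inputs.prob (?C j \<inter> ?B)\<bar> + \<bar>\<Sum>j<m. inputs.prob (?C j \<inter> ?B) - c * inputs.prob ?B\<bar>"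
      by linarith
    also have "\<bar>\<Sum>j<m. inputs.prob (C a \<inter> ?B) - inputs.prob (?C j \<inter> ?B)\<bar> \<le> (\<Sum>j<m. h)"
      using swap by (intro order_trans[OF sum_abs] sum_mono) simp
    also note avg
    finally have "\<bar>m * (inputs.prob (C a \<inter> ?B) - c * inputs.prob ?B)\<bar> \<le> m * \<epsilon>"
      by (simp add: h_def algebra_simps)
    then have "m * \<bar>inputs.prob (C a \<inter> ?B) - c * inputs.prob ?B\<bar> \<le> m * \<epsilon>" by (simp add: abs_mult)
    then show "\<bar>inputs.prob (C a \<inter> ?B) - inputs.prob (C a) * inputs.prob ?B\<bar> \<le> \<epsilon>"
      using m0 by (simp add: c_def)
  qed
qed

text \<open>An event on finitely many vertices is a Boolean combination of single spins.
  Approximating each spin by a cylinder hence approximates all near events at once, outside one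
  exceptional event.\<close>

theorem final_config_mixing:
  assumes p: "stable p" and K: "finite K" and \<epsilon>: "\<epsilon> > 0"
  shows "\<exists>G. finite G \<and> (\<forall>S S'. {\<omega>. final_config p \<omega> \<in> S} \<in> sets inputs \<longrightarrow>
    {\<omega>. final_config p \<omega> \<in> S'} \<in> sets inputs \<longrightarrow>
    (\<forall>f g. (\<forall>x\<in>K. f x = g x) \<longrightarrow> f \<in> S \<longleftrightarrow> g \<in> S) \<longrightarrow>
    (\<forall>f g. (\<forall>x. x \<notin> G \<longrightarrow> f x = g x) \<longrightarrow> f \<in> S' \<longleftrightarrow> g \<in> S') \<longrightarrow>
    \<bar>inputs.prob ({\<omega>. final_config p \<omega> \<in> S} \<inter> {\<omega>. final_config p \<omega> \<in> S'})
      - inputs.prob {\<omega>. final_config p \<omega> \<in> S} * inputs.prob {\<omega>. final_config p \<omega> \<in> S'}\<bar> \<le> \<epsilon>)"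
proof -
  \<comment> \<open>The exceptional event then has probability at most
    \<open>\<epsilon> / 4\<close>. It is paid twice, in the intersection and in the product, and the
    cylinder estimate takes the remaining \<open>\<epsilon> / 2\<close>.\<close>
  define \<delta> where "\<delta> = \<epsilon> / (4 * (real (card K) + 1))"
  have \<delta>: "\<delta> > 0" using \<epsilon> by (simp add: \<delta>_def)
  have Fs: "{\<omega>. final_config p \<omega> x} \<in> sets inputs" for x
    using final_config_measurable[of p x] by (simp add: pred_def)
  have "\<forall>x. \<exists>J C. finite J \<and> C \<in> sets inputs \<and> depends_on J C \<and>
    inputs.prob ({\<omega>. final_config p \<omega> x} - C \<union> (C - {\<omega>. final_config p \<omega> x})) < \<delta>"
    using inputs.cylinder_approx[OF Fs \<delta>] by blast
  then obtain J C where J: "\<And>x. finite (J x)" and C: "\<And>x. C x \<in> sets inputs" "\<And>x. depends_on (J x) (C x)"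
    and CF: "\<And>x. inputs.prob ({\<omega>. final_config p \<omega> x} - C x \<union> (C x - {\<omega>. final_config p \<omega> x})) < \<delta>"
    by metis
  let ?J = "\<Union>x\<in>K. J x"
  let ?E = "\<Union>x\<in>K. {\<omega>. final_config p \<omega> x} - C x \<union> (C x - {\<omega>. final_config p \<omega> x})"
  have E: "?E \<in> sets inputs" using Fs C(1) K by (intro sets.finite_UN sets.Un sets.Diff) auto
  have "inputs.prob ?E \<le> (\<Sum>x\<in>K. inputs.prob ({\<omega>. final_config p \<omega> x} - C x \<union> (C x - {\<omega>. final_config p \<omega> x})))"
    using Fs C(1) K by (intro inputs.finite_measure_subadditive_finite) auto
  also have "\<dots> \<le> (\<Sum>x\<in>K. \<delta>)" using CF by (intro sum_mono less_imp_le)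
  also have "\<dots> \<le> \<epsilon> / 4" using \<epsilon> by (simp add: \<delta>_def field_simps)
  finally have PE: "inputs.prob ?E \<le> \<epsilon> / 4" .
  \<comment> \<open>The near event evaluated at the cylinder approximations of the spins. As
    \<open>K\<close> is finite, this is a finite union of cylinders, whatever the set
    \<open>S\<close> is.\<close>
  define D where "D S = {\<omega>. (\<lambda>x. x \<in> K \<and> \<omega> \<in> C x) \<in> S}" for S :: "('v \<Rightarrow> bool) set"
  have Ds: "D S \<in> sets inputs" for S
  proof -
    let ?Z = "{Z. Z \<subseteq> K \<and> (\<lambda>x. x \<in> Z) \<in> S}"
    have "D S = (\<Union>Z\<in>?Z. {\<omega>. \<forall>x\<in>K. \<omega> \<in> C x \<longleftrightarrow> x \<in> Z})"
    proof (intro equalityI subsetI)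
      fix \<omega> assume "\<omega> \<in> D S"
      then show "\<omega> \<in> (\<Union>Z\<in>?Z. {\<omega>. \<forall>x\<in>K. \<omega> \<in> C x \<longleftrightarrow> x \<in> Z})"
        by (intro UN_I[of "{x \<in> K. \<omega> \<in> C x}"]) (auto simp: D_def)
    next
      fix \<omega> assume "\<omega> \<in> (\<Union>Z\<in>?Z. {\<omega>. \<forall>x\<in>K. \<omega> \<in> C x \<longleftrightarrow> x \<in> Z})"
      then obtain Z where Z: "Z \<subseteq> K" "(\<lambda>x. x \<in> Z) \<in> S" "\<forall>x\<in>K. \<omega> \<in> C x \<longleftrightarrow> x \<in> Z" by blast
      then have "(\<lambda>x. x \<in> K \<and> \<omega> \<in> C x) = (\<lambda>x. x \<in> Z)" by (intro ext) blast
      then show "\<omega> \<in> D S" using Z(2) by (simp add: D_def)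
    qed
    moreover have "{\<omega>. \<forall>x\<in>K. \<omega> \<in> C x \<longleftrightarrow> x \<in> Z} \<in> sets inputs" for Z
    proof -
      have [measurable]: "Measurable.pred inputs (\<lambda>\<omega>. \<omega> \<in> C x)" for x
        using C(1)[of x] by (simp add: pred_def)
      have "Measurable.pred inputs (\<lambda>\<omega>. \<forall>x\<in>K. \<omega> \<in> C x \<longleftrightarrow> x \<in> Z)"
        by (rule pred_intros_finite(3)[OF K]) measurable
      then show ?thesis by (simp add: pred_def)
    qed
    moreover have "finite ?Z" using K by (auto intro: finite_subset[of _ "Pow K"])
    ultimately show ?thesis by (simp only:) (intro sets.finite_UN, auto)
  qed
  have Dd: "depends_on ?J (D S)" for S
    unfolding depends_on_def
  proof (intro allI impI)
    fix \<omega> \<omega>' :: "bool \<times> 'v \<times> nat \<Rightarrow> real" assume "\<forall>i\<in>?J. \<omega> i = \<omega>' i"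
    then have "\<omega> \<in> C x \<longleftrightarrow> \<omega>' \<in> C x" if "x \<in> K" for x
      using that by (intro depends_onD[OF C(2)]) auto
    then have "(\<lambda>x. x \<in> K \<and> \<omega> \<in> C x) = (\<lambda>x. x \<in> K \<and> \<omega>' \<in> C x)" by (intro ext) blast
    then show "\<omega> \<in> D S \<longleftrightarrow> \<omega>' \<in> D S" by (simp add: D_def)
  qed
  have "finite ?J" using K J by auto
  from cylinder_mixing[OF p, of UNIV D, OF Ds Dd this, of "\<epsilon> / 2"] \<epsilon>
  obtain G where G: "finite G" "\<And>S S'. {\<omega>. final_config p \<omega> \<in> S'} \<in> sets inputs \<Longrightarrow>
    \<forall>f g. (\<forall>x. x \<notin> G \<longrightarrow> f x = g x) \<longrightarrow> f \<in> S' \<longleftrightarrow> g \<in> S' \<Longrightarrow>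
    \<bar>inputs.prob (D S \<inter> {\<omega>. final_config p \<omega> \<in> S'}) - inputs.prob (D S) * inputs.prob {\<omega>. final_config p \<omega> \<in> S'}\<bar> \<le> \<epsilon> / 2"
    by auto
  show ?thesis
  proof (intro exI[of _ G] conjI allI impI)
    fix S S'
    let ?A = "{\<omega>. final_config p \<omega> \<in> S}" and ?B = "{\<omega>. final_config p \<omega> \<in> S'}"
    assume A: "?A \<in> sets inputs" and B: "?B \<in> sets inputs"
      and near: "\<forall>f g. (\<forall>x\<in>K. f x = g x) \<longrightarrow> f \<in> S \<longleftrightarrow> g \<in> S"
      and far: "\<forall>f g. (\<forall>x. x \<notin> G \<longrightarrow> f x = g x) \<longrightarrow> f \<in> S' \<longleftrightarrow> g \<in> S'"
    have AD: "\<omega> \<in> ?A \<longleftrightarrow> \<omega> \<in> D S" if "\<omega> \<notin> ?E" for \<omega>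
    proof -
      have "\<forall>x\<in>K. final_config p \<omega> x = (x \<in> K \<and> \<omega> \<in> C x)" using that by blast
      from near[rule_format, OF bspec[OF this]] show ?thesis unfolding D_def mem_Collect_eq .
    qed
    have 1: "\<bar>inputs.prob ?A - inputs.prob (D S)\<bar> \<le> \<epsilon> / 4"
      by (rule order_trans[OF inputs.prob_diff_le[OF A Ds E] PE]) (use AD in blast)
    have 2: "\<bar>inputs.prob (?A \<inter> ?B) - inputs.prob (D S \<inter> ?B)\<bar> \<le> \<epsilon> / 4"
      by (rule order_trans[OF inputs.prob_diff_le[OF sets.Int[OF A B] sets.Int[OF Ds B] E] PE]) (use AD in blast)
    have "\<bar>(inputs.prob (D S) - inputs.prob ?A) * inputs.prob ?B\<bar> \<le> \<epsilon> / 4 * 1"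
      unfolding abs_mult using 1 \<epsilon> by (intro mult_mono) (auto simp: abs_minus_commute)
    moreover have "inputs.prob (?A \<inter> ?B) - inputs.prob ?A * inputs.prob ?B
        = (inputs.prob (?A \<inter> ?B) - inputs.prob (D S \<inter> ?B))
        + (inputs.prob (D S \<inter> ?B) - inputs.prob (D S) * inputs.prob ?B)
        + (inputs.prob (D S) - inputs.prob ?A) * inputs.prob ?B"
      by (simp add: algebra_simps)
    ultimately show "\<bar>inputs.prob (?A \<inter> ?B) - inputs.prob ?A * inputs.prob ?B\<bar> \<le> \<epsilon>"
      using 2 G(2)[OF B far, of S] by linarith
  qed (fact G(1))
qed

end

section \<open>Glauber paths solve the recursion\<close>

context cubic_tree
begin

lemma majority_signs:
  "majority {y. adj x y} (\<lambda>y. if P y then 1 else -1) = (if maj x P then 1 else (-1 :: int))"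
proof -
  let ?f = "\<lambda>y. if P y then 1 else (-1 :: int)"
  let ?q = "\<lambda>s. 2 * card {y \<in> {y. adj x y}. ?f y = s} > card {y. adj x y}"
  have "{y \<in> {y. adj x y}. ?f y = 1} = {y. adj x y \<and> P y}"
    "{y \<in> {y. adj x y}. ?f y = -1} = {y. adj x y \<and> \<not> P y}" by auto
  then have "?q (if maj x P then 1 else -1)"
    using maj_iff_card[of x P] maj_iff_card_not[of x P] by (simp add: regular)
  moreover have "s = s'" if "?q s" "?q s'" for s s'
  proof (rule ccontr)
    assume "s \<noteq> s'"
    then have "card {y \<in> {y. adj x y}. ?f y = s} + card {y \<in> {y. adj x y}. ?f y = s'}
        = card ({y \<in> {y. adj x y}. ?f y = s} \<union> {y \<in> {y. adj x y}. ?f y = s'})"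
      by (intro card_Un_disjoint[symmetric]) (auto simp: finite_neighbours)
    also have "\<dots> \<le> card {y. adj x y}" by (intro card_mono finite_neighbours) auto
    finally show False using that by linarith
  qed
  ultimately show ?thesis unfolding majority_def by (intro the_equality) blast+
qed

text \<open>The left limits of a Glauber path solve the recursion, so by uniqueness they are the
  constructed spins, and fixation turns the limit in time into \<open>final\<close>.\<close>

lemma glauber_path_final:
  fixes s :: "'v \<Rightarrow> real \<Rightarrow> int"
  assumes T: "admissible T"
    and vals: "\<And>x t. t \<ge> 0 \<Longrightarrow> s x t \<in> {-1, 1}"
    and const: "\<And>x a b. 0 \<le> a \<Longrightarrow> a \<le> b \<Longrightarrow> (\<And>n. T x n \<notin> {a<..b}) \<Longrightarrow> s x b = s x a"
    and maj: "\<And>x n. s x (T x n) = majority {y. adj x y} (\<lambda>y. Lim (at_left (T x n)) (s y))"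
    and fixed: "fixates (\<lambda>x. s x 0 = 1) T x"
  shows "Lim at_top (s x) = (if final (\<lambda>x. s x 0 = 1) T x then 1 else -1)"
proof -
  define \<xi> where "\<xi> x \<longleftrightarrow> s x 0 = 1" for x
  \<comment> \<open>The spin set by the last ring strictly before \<open>t\<close>, which by
    constancy between rings is the left limit at \<open>t\<close>.\<close>
  define f where "f x t \<longleftrightarrow> (if t \<le> T x 0 then \<xi> x else s x (T x (last_ring (T x) t)) = 1)" for x t
  have mono: "T x m \<le> T x n \<longleftrightarrow> m \<le> n" for x m n
    using admissibleD(1)[OF T] by (rule strict_mono_less_eq)
  have pos: "0 < T x n" for x n using admissibleD(2)[OF T, of x] mono[of x 0 n] by simp
  have sgn: "s x t = (if s x t = 1 then 1 else -1)" if "t \<ge> 0" for x t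
    using vals[OF that, of x] by auto
  have between: "s x t = s x (T x k)" if "T x k \<le> t" "t < T x (Suc k)" for x t k
  proof (rule const)
    fix n show "T x n \<notin> {T x k<..t}"
      using that mono[of x n k] mono[of x "Suc k" n] by (cases "n \<le> k") auto
  qed (use that pos[of x k] in auto)
  have left: "Lim (at_left t) (s y) = (if f y t then 1 else -1)" if t: "0 < t" for y t
  proof -
    have "eventually (\<lambda>u. s y u = (if f y t then 1 else -1)) (at_left t)"
    proof (cases "t \<le> T y 0")
      case True
      have "eventually (\<lambda>u. u \<in> {0<..<t}) (at_left t)" using t by (rule eventually_at_left_real)
      then show ?thesis
      proof eventually_elim
        case (elim u)
        have "T y n \<notin> {0<..u}" for n using elim True mono[of y 0 n] by auto
        then have "s y u = s y 0" using elim by (intro const) auto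
        then show ?case using True sgn[of 0 y] by (simp add: f_def \<xi>_def)
      qed
    next
      case False
      let ?k = "last_ring (T y) t"
      have k: "T y ?k < t" "t \<le> T y (Suc ?k)" using admissible_last_ring[OF T, of y t] False by auto
      have "eventually (\<lambda>u. u \<in> {T y ?k<..<t}) (at_left t)" using k(1) by (rule eventually_at_left_real)
      then show ?thesis
      proof eventually_elim
        case (elim u)
        then have "s y u = s y (T y ?k)" using k(2) by (intro between) auto
        then show ?case using False sgn[of "T y ?k" y] pos[of y ?k] by (simp add: f_def)
      qed
    qed
    then have "(s y \<longlongrightarrow> (if f y t then 1 else -1)) (at_left t)" by (rule tendsto_eventually)
    then show ?thesis by (intro tendsto_Lim) simp_all
  qed
  have "is_solution \<xi> T f"
    unfolding is_solution_def
  proof (intro allI)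
    fix x :: 'v and t :: real
    show "f x t = (if t \<le> T x 0 then \<xi> x else maj x (\<lambda>y. f y (T x (last_ring (T x) t))))"
    proof (cases "t \<le> T x 0")
      case False
      let ?\<tau> = "T x (last_ring (T x) t)"
      have "s x ?\<tau> = majority {y. adj x y} (\<lambda>y. if f y ?\<tau> then 1 else -1)"
        unfolding maj by (simp only: left[OF pos])
      then have "s x ?\<tau> = (if maj x (\<lambda>y. f y ?\<tau>) then 1 else -1)"
        by (simp only: majority_signs)
      then show ?thesis using False by (simp add: f_def)
    qed (simp add: f_def)
  qed
  then have f: "f = left_spin \<xi> T" by (rule solution_unique[OF T])
  have "fixates \<xi> T x" using fixed by (simp add: \<xi>_def[abs_def])
  from fixates_final[OF T this] obtain t0 where t0: "\<And>t. t > t0 \<Longrightarrow> f x t = final \<xi> T x"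
    unfolding f by blast
  have ev: "s x t = (if final \<xi> T x then 1 else -1)" if t: "max t0 (T x 0) < t" for t
  proof -
    let ?j = "last_ring (T x) t"
    have j: "T x ?j < t" "t \<le> T x (Suc ?j)" using admissible_last_ring[OF T, of x t] t by auto
    \<comment> \<open>Here a ring at time \<open>t\<close> itself counts, unlike in
      \<open>last_ring\<close>; the two indices differ exactly when \<open>t\<close> is a ring
      time.\<close>
    obtain k where k: "T x k \<le> t" "t < T x (Suc k)"
    proof (cases "t < T x (Suc ?j)")
      case True
      then show ?thesis using j that[of ?j] by simp
    next
      case False
      then have "T x (Suc ?j) \<le> t" "t < T x (Suc (Suc ?j))"
        using j mono[of x "Suc (Suc ?j)" "Suc ?j"] by auto
      then show ?thesis by (rule that)
    qed
    have "last_ring (T x) (T x (Suc k)) = k"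
      using k by (intro last_ring_eqI admissibleD(1)[OF T]) auto
    moreover have "\<not> T x (Suc k) \<le> T x 0" using mono[of x "Suc k" 0] by simp
    ultimately have "f x (T x (Suc k)) \<longleftrightarrow> s x (T x k) = 1" by (simp add: f_def)
    moreover have "f x (T x (Suc k)) = final \<xi> T x" using t k by (intro t0) auto
    ultimately show ?thesis using between[OF k] sgn[of "T x k" x] pos[of x k] by simp
  qed
  have "eventually (\<lambda>t. s x t = (if final \<xi> T x then 1 else -1)) at_top"
    using eventually_gt_at_top[of "max t0 (T x 0)"] by eventually_elim (rule ev)
  then have "(s x \<longlongrightarrow> (if final \<xi> T x then 1 else -1)) at_top" by (rule tendsto_eventually)
  then have "Lim at_top (s x) = (if final \<xi> T x then 1 else -1)" by (intro tendsto_Lim) simp_all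
  then show ?thesis by (simp add: \<xi>_def[abs_def])
qed

end

section \<open>The law of the inputs\<close>

text \<open>Clocks are recorded by waiting times, because these are the independent coordinates. Two
  processes on different spaces can then be compared through one product law.\<close>

definition encode :: "('v \<Rightarrow> bool) \<Rightarrow> ('v \<Rightarrow> nat \<Rightarrow> real) \<Rightarrow> 'v + 'v \<times> nat \<Rightarrow> real" where
  "encode \<xi> T i = (case i of Inl x \<Rightarrow> of_bool (\<xi> x)
     | Inr (x, n) \<Rightarrow> T x n - (if n = 0 then 0 else T x (n - 1)))"

definition decode_spin :: "('v + 'v \<times> nat \<Rightarrow> real) \<Rightarrow> 'v \<Rightarrow> bool" where
  "decode_spin r x \<longleftrightarrow> r (Inl x) = 1"

definition decode_clock :: "('v + 'v \<times> nat \<Rightarrow> real) \<Rightarrow> 'v \<Rightarrow> nat \<Rightarrow> real" where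
  "decode_clock r x n = (\<Sum>k\<le>n. r (Inr (x, k)))"

lemma decode_spin_encode [simp]: "decode_spin (encode \<xi> T) = \<xi>"
  by (intro ext) (simp add: decode_spin_def encode_def)

lemma decode_clock_encode [simp]: "decode_clock (encode \<xi> T) = T"
proof (intro ext)
  show "decode_clock (encode \<xi> T) x n = T x n" for x n
    by (induction n) (simp_all add: decode_clock_def encode_def)
qed

abbreviation codes :: "('v + 'v \<times> nat \<Rightarrow> real) measure" where
  "codes \<equiv> PiM UNIV (\<lambda>_. borel)"

lemma decode_spin_measurable [measurable]: "Measurable.pred codes (\<lambda>r. decode_spin r x)"
proof -
  have [measurable]: "(\<lambda>r. r (Inl x)) \<in> borel_measurable codes"
    by (rule measurable_component_singleton) simp
  show ?thesis unfolding decode_spin_def by measurable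
qed

lemma decode_clock_measurable [measurable]: "(\<lambda>r. decode_clock r x n) \<in> borel_measurable codes"
  unfolding decode_clock_def
  by (intro borel_measurable_sum measurable_component_singleton) simp

lemma distr_of_bool_eq:
  assumes "prob_space M" "prob_space N" "Measurable.pred M P" "Measurable.pred N R"
    and eq: "measure M {\<omega> \<in> space M. P \<omega>} = measure N {\<omega> \<in> space N. R \<omega>}"
  shows "distr M borel (\<lambda>\<omega>. of_bool (P \<omega>) :: real) = distr N borel (\<lambda>\<omega>. of_bool (R \<omega>))"
proof -
  interpret M: prob_space M by fact
  interpret N: prob_space N by fact
  note [measurable] = assms(3,4)
  have b1: "(\<lambda>\<omega>. of_bool (P \<omega>) :: real) = (\<lambda>\<omega>. if P \<omega> then 1 else 0)" by auto
  have b2: "(\<lambda>\<omega>. of_bool (R \<omega>) :: real) = (\<lambda>\<omega>. if R \<omega> then 1 else 0)" by auto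
  have m: "(\<lambda>\<omega>. of_bool (P \<omega>) :: real) \<in> borel_measurable M" "(\<lambda>\<omega>. of_bool (R \<omega>) :: real) \<in> borel_measurable N"
    unfolding b1 b2 by measurable
  have neg: "measure M {\<omega> \<in> space M. \<not> P \<omega>} = measure N {\<omega> \<in> space N. \<not> R \<omega>}"
    using eq M.prob_neg[of P] N.prob_neg[of R] assms(3,4) by (simp add: pred_def)
  show ?thesis
  proof (rule measure_eqI)
    fix A :: "real set" assume "A \<in> sets (distr M borel (\<lambda>\<omega>. of_bool (P \<omega>)))"
    then have A: "A \<in> sets borel" by simp
    have s1: "(\<lambda>\<omega>. of_bool (P \<omega>) :: real) -` A \<inter> space M =
        (if 1 \<in> A then if 0 \<in> A then space M else {\<omega> \<in> space M. P \<omega>}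
         else if 0 \<in> A then {\<omega> \<in> space M. \<not> P \<omega>} else {})"
      unfolding b1 by (auto split: if_splits)
    have s2: "(\<lambda>\<omega>. of_bool (R \<omega>) :: real) -` A \<inter> space N =
        (if 1 \<in> A then if 0 \<in> A then space N else {\<omega> \<in> space N. R \<omega>}
         else if 0 \<in> A then {\<omega> \<in> space N. \<not> R \<omega>} else {})"
      unfolding b2 by (auto split: if_splits)
    show "emeasure (distr M borel (\<lambda>\<omega>. of_bool (P \<omega>) :: real)) A = emeasure (distr N borel (\<lambda>\<omega>. of_bool (R \<omega>))) A"
      unfolding emeasure_distr[OF m(1) A] emeasure_distr[OF m(2) A] s1 s2
      using eq neg by (simp add: M.emeasure_eq_measure N.emeasure_eq_measure M.prob_space N.prob_space)
  qed simp
qed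

lemma prob_spin:
  assumes "0 \<le> p" "p \<le> 1"
  shows "inputs.prob {\<omega>. spin p \<omega> x} = p"
proof -
  have "emeasure inputs {\<omega>. spin p \<omega> x} = emeasure (distr inputs borel (\<lambda>\<omega>. \<omega> (True, x, 0))) {..p}"
    by (subst emeasure_distr) (auto simp: inputs.coord_measurable spin_def vimage_def)
  also have "\<dots> = emeasure (uniform_measure lborel {0..1}) {..p}"
    unfolding inputs.distr_coord by (simp add: coord_law_def)
  also have "\<dots> = emeasure lborel {0..p}"
  proof -
    have "{0..1} \<inter> {..p} = {0..p}" using assms by auto
    then show ?thesis using assms by (simp add: min_def divide_ennreal_def)
  qed
  finally show ?thesis using assms by (simp add: inputs.emeasure_eq_measure)
qed

lemma encode_inputs:
  "encode (spin p \<omega>) (clock \<omega>) i = (case i of Inl x \<Rightarrow> of_bool (spin p \<omega> x) | Inr (x, n) \<Rightarrow> \<omega> (False, x, n))"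
proof -
  have "clock \<omega> x n - (if n = 0 then 0 else clock \<omega> x (n - 1)) = \<omega> (False, x, n)" for x n
    by (cases n) (simp_all add: clock_def)
  then show ?thesis by (simp add: encode_def split: sum.split prod.split)
qed

lemma encode_inputs_measurable:
  "(\<lambda>\<omega>. encode (spin p \<omega>) (clock \<omega>) i) \<in> borel_measurable inputs"
proof (cases i)
  case (Inl x)
  have "(\<lambda>\<omega>. of_bool (spin p \<omega> x) :: real) = (\<lambda>\<omega>. if spin p \<omega> x then 1 else 0)" by auto
  then show ?thesis unfolding encode_inputs Inl by simp
next
  case (Inr z)
  then show ?thesis unfolding encode_inputs by (cases z) (simp add: inputs.coord_measurable)
qed

lemma indep_vars_encode_inputs:
  "inputs.indep_vars (\<lambda>_. borel) (\<lambda>i \<omega>. encode (spin p \<omega>) (clock \<omega>) i) UNIV"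
  unfolding inputs.indep_vars_def2
proof (intro conjI ballI inputs.indep_setsI)
  let ?X = "\<lambda>i \<omega>. encode (spin p \<omega>) (clock \<omega>) i"
  let ?F = "\<lambda>i. {?X i -` A \<inter> space inputs |A. A \<in> sets borel}"
  show "?X i \<in> borel_measurable inputs" for i by (rule encode_inputs_measurable)
  show "?F i \<subseteq> sets inputs" for i
    using measurable_sets[OF encode_inputs_measurable] by blast
  fix A J
  assume J: "J \<noteq> {}" "finite J" and A: "\<forall>j\<in>J. A j \<in> ?F j"
  \<comment> \<open>The single input coordinate that each coordinate of the code reads.\<close>
  let ?g = "\<lambda>i. case i of Inl x \<Rightarrow> (True, x, 0) | Inr (x, n) \<Rightarrow> (False, x, n :: nat)"
  show "inputs.prob (\<Inter>j\<in>J. A j) = (\<Prod>j\<in>J. inputs.prob (A j))"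
  proof (rule inputs.prob_INT_depends_on[where J = "\<lambda>j. {?g j}"])
    show "finite J" by fact
    show "A j \<in> sets inputs" if "j \<in> J" for j
    proof -
      from bspec[OF A that] obtain S where "A j = ?X j -` S \<inter> space inputs" "S \<in> sets borel"
        by (elim CollectE exE conjE)
      then show ?thesis by (simp only: measurable_sets[OF encode_inputs_measurable])
    qed
    show "depends_on {?g j} (A j)" if "j \<in> J" for j
    proof -
      from bspec[OF A that] obtain S where S: "A j = ?X j -` S \<inter> space inputs"
        by (elim CollectE exE conjE)
      have "?X j \<omega> = ?X j \<omega>'" if "\<omega> (?g j) = \<omega>' (?g j)" for \<omega> \<omega>'
      proof (cases j)
        case (Inl x)
        then show ?thesis using that unfolding encode_inputs by (simp add: spin_def)
      next
        case (Inr z)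
        then show ?thesis using that unfolding encode_inputs by (cases z) simp
      qed
      note X = this
      show ?thesis
        unfolding S depends_on_def
      proof (intro allI impI)
        fix \<omega> \<omega>' :: "_ \<Rightarrow> real" assume "\<forall>i\<in>{?g j}. \<omega> i = \<omega>' i"
        then have "?X j \<omega> = ?X j \<omega>'" by (intro X) blast
        then show "\<omega> \<in> ?X j -` S \<inter> space inputs \<longleftrightarrow> \<omega>' \<in> ?X j -` S \<inter> space inputs"
          by (simp only: vimage_eq Int_iff inputs.space_joint UNIV_I simp_thms)
      qed
    qed
    show "disjoint_family_on (\<lambda>j. {?g j}) J"
      by (auto simp: disjoint_family_on_def split: sum.splits)
  qed
qed

lemma (in prob_space) distr_eq_PiM_borel:
  fixes X :: "'i \<Rightarrow> 'a \<Rightarrow> real"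
  assumes "indep_vars (\<lambda>_. borel) X UNIV"
  shows "distr M (PiM UNIV (\<lambda>_. borel)) (\<lambda>\<omega> i. X i \<omega>) = PiM UNIV (\<lambda>i. distr M borel (X i))"
proof -
  have "\<And>i. random_variable borel (X i)" using assms by (simp add: indep_vars_def2)
  with assms show ?thesis
    by (subst (asm) indep_vars_iff_distr_eq_PiM') (simp_all add: restrict_def)
qed

section \<open>Transfer to the Glauber dynamics\<close>

lemma (in prob_space) measure_completion_AE:
  assumes "A \<subseteq> space M" "A' \<in> events" "AE \<omega> in M. \<omega> \<in> A \<longleftrightarrow> \<omega> \<in> A'"
  shows "measure (completion M) A = prob A'"
proof -
  from assms(3) obtain N where N: "N \<in> null_sets M" "{\<omega> \<in> space M. \<not> (\<omega> \<in> A \<longleftrightarrow> \<omega> \<in> A')} \<subseteq> N"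
    by (auto simp: eventually_ae_filter)
  have sub: "A - A' \<subseteq> N" "A' - A \<subseteq> N" using N(2) assms(1) sets.sets_into_space[OF assms(2)] by auto
  note null = null_sets_completion[OF N(1) sub(1)] null_sets_completion[OF N(1) sub(2)]
  have "(A' \<union> (A - A')) - (A' - A) \<in> sets (completion M)"
    by (rule sets.Diff[OF sets.Un[OF sets_completionI_sets[OF assms(2)] null(1)] null(2)])
  moreover have "(A' \<union> (A - A')) - (A' - A) = A" by blast
  ultimately have A: "A \<in> sets (completion M)" by simp
  have "emeasure (completion M) A = emeasure (completion M) A'"
    using A assms(2) AE_completion[OF assms(3)] by (intro emeasure_eq_AE) auto
  then have "measure (completion M) A = measure (completion M) A'" by (simp only: measure_def)
  then show ?thesis using assms(2) by simp
qed

text \<open>Holds pathwise and requires no measurability of \<open>X\<close>, which final spins have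
  only up to null sets. The set of configurations keeps the information which coordinates
  matter.\<close>

lemma generated_sigma_configurations:
  fixes X :: "'i \<Rightarrow> 'a \<Rightarrow> int"
  assumes "B \<in> generated_sigma \<Omega> (count_space UNIV) X I"
  shows "\<exists>S\<in>sets (PiM UNIV (\<lambda>_. count_space UNIV)). B = {\<omega> \<in> \<Omega>. (\<lambda>i. X i \<omega>) \<in> S}
    \<and> (\<forall>f g. (\<forall>i\<in>I. f i = g i) \<longrightarrow> f \<in> S \<longleftrightarrow> g \<in> S)"
  using assms unfolding generated_sigma_def
proof (induction rule: sigma_sets.induct)
  case (Basic a)
  then obtain i S where i: "i \<in> I" "a = X i -` S \<inter> \<Omega>" by blast
  have "{f. f i \<in> S} \<in> sets (PiM UNIV (\<lambda>_. count_space UNIV))"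
    using measurable_sets[OF measurable_component_singleton[of i UNIV "\<lambda>_. count_space UNIV"], of S]
    by (simp add: vimage_def space_PiM)
  then show ?case using i by (intro bexI[of _ "{f. f i \<in> S}"]) auto
next
  case Empty
  show ?case by (intro bexI[of _ "{}"]) auto
next
  case (Compl a)
  then obtain S where S: "S \<in> sets (PiM UNIV (\<lambda>_. count_space UNIV))" "a = {\<omega> \<in> \<Omega>. (\<lambda>i. X i \<omega>) \<in> S}"
    "\<forall>f g. (\<forall>i\<in>I. f i = g i) \<longrightarrow> f \<in> S \<longleftrightarrow> g \<in> S" by blast
  have "- S \<in> sets (PiM UNIV (\<lambda>_. count_space UNIV))"
    using sets.compl_sets[OF S(1)] by (simp add: space_PiM Compl_eq_Diff_UNIV)
  then show ?case using S(2,3) by (intro bexI[of _ "- S"]) auto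
next
  case (Union a)
  have "\<forall>n. \<exists>S. S \<in> sets (PiM UNIV (\<lambda>_. count_space UNIV)) \<and> a n = {\<omega> \<in> \<Omega>. (\<lambda>i. X i \<omega>) \<in> S}
    \<and> (\<forall>f g. (\<forall>i\<in>I. f i = g i) \<longrightarrow> f \<in> S \<longleftrightarrow> g \<in> S)"
    using Union.IH unfolding Bex_def by (rule allI)
  from choice[OF this] obtain S where S: "\<forall>n. S n \<in> sets (PiM UNIV (\<lambda>_. count_space UNIV)) \<and> a n = {\<omega> \<in> \<Omega>. (\<lambda>i. X i \<omega>) \<in> S n}
    \<and> (\<forall>f g. (\<forall>i\<in>I. f i = g i) \<longrightarrow> f \<in> S n \<longleftrightarrow> g \<in> S n)" by (elim exE)
  have "(\<Union>n. S n) \<in> sets (PiM UNIV (\<lambda>_. count_space UNIV))" using S by blast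
  moreover have "(\<Union>n. a n) = {\<omega> \<in> \<Omega>. (\<lambda>i. X i \<omega>) \<in> (\<Union>n. S n)}"
  proof -
    have "a n = {\<omega> \<in> \<Omega>. (\<lambda>i. X i \<omega>) \<in> S n}" for n using S by blast
    then show ?thesis by auto
  qed
  moreover have "f \<in> (\<Union>n. S n) \<longleftrightarrow> g \<in> (\<Union>n. S n)" if "\<forall>i\<in>I. f i = g i" for f g
  proof -
    have "f \<in> S n \<longleftrightarrow> g \<in> S n" for n using S that by blast
    then show ?thesis by simp
  qed
  ultimately show ?case by (intro bexI[of _ "\<Union>n. S n"] conjI allI impI)
qed

lemma generated_sigma_sigma:
  fixes \<Omega> :: "'a set" and N :: "'b measure" and X :: "'i \<Rightarrow> 'a \<Rightarrow> 'b" and I :: "'i set"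
  defines "W \<equiv> sigma \<Omega> (\<Union>i\<in>I. {X i -` S \<inter> \<Omega> | S. S \<in> sets N})"
  shows "sets W = generated_sigma \<Omega> N X I" "space W = \<Omega>"
    and "i \<in> I \<Longrightarrow> space N = UNIV \<Longrightarrow> X i \<in> measurable W N"
proof -
  have sub: "(\<Union>i\<in>I. {X i -` S \<inter> \<Omega> | S. S \<in> sets N}) \<subseteq> Pow \<Omega>" by blast
  show W: "sets W = generated_sigma \<Omega> N X I" "space W = \<Omega>"
    unfolding W_def generated_sigma_def by (simp_all add: sets_measure_of[OF sub] space_measure_of[OF sub])
  show "X i \<in> measurable W N" if "i \<in> I" "space N = UNIV"
  proof (rule measurableI)
    fix S assume "S \<in> sets N"
    then show "X i -` S \<inter> space W \<in> sets W"
      unfolding W generated_sigma_def using that by (intro sigma_sets.Basic) blast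
  qed (use that in simp)
qed

section \<open>The law of an arbitrary Glauber process on the tree\<close>

locale cubic_glauber = cubic_tree adj + glauber_dynamics adj p M T \<sigma>
  for adj :: "'v \<Rightarrow> 'v \<Rightarrow> bool" and p :: real and M :: "'a measure"
    and T :: "'v \<Rightarrow> nat \<Rightarrow> 'a \<Rightarrow> real" and \<sigma> :: "'v \<Rightarrow> real \<Rightarrow> 'a \<Rightarrow> int"
begin

definition gap :: "'v \<Rightarrow> nat \<Rightarrow> 'a \<Rightarrow> real" where
  "gap x n \<omega> = T x n \<omega> - (if n = 0 then 0 else T x (n - 1) \<omega>)"

definition code :: "'a \<Rightarrow> 'v + 'v \<times> nat \<Rightarrow> real" where
  "code \<omega> = encode (\<lambda>x. \<sigma> x 0 \<omega> = 1) (\<lambda>x n. T x n \<omega>)"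

lemma code_simps: "code \<omega> (Inl x) = of_bool (\<sigma> x 0 \<omega> = 1)" "code \<omega> (Inr (x, n)) = gap x n \<omega>"
  by (simp_all add: code_def encode_def gap_def)

lemma gap_indep: "indep_vars (\<lambda>_. borel) (gap x) UNIV"
  and gap_exponential: "distributed M lborel (gap x n) (exponential_density 1)"
  using clocks[of x] unfolding poisson_arrivals_def Let_def gap_def[abs_def] by auto

lemma gap_measurable [measurable]: "gap x n \<in> borel_measurable M"
  using distributed_measurable[OF gap_exponential[of x n]] by simp

lemma initial_measurable [measurable]: "Measurable.pred M (\<lambda>\<omega>. \<sigma> x 0 \<omega> = 1)"
proof -
  have [measurable]: "\<sigma> x 0 \<in> measurable M (count_space UNIV)" using spin_measurable[of 0 x] by simp
  show ?thesis by measurable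
qed

lemma code_measurable: "(\<lambda>\<omega>. code \<omega> i) \<in> borel_measurable M"
proof (cases i)
  case (Inl x)
  have "(\<lambda>\<omega>. of_bool (\<sigma> x 0 \<omega> = 1) :: real) = (\<lambda>\<omega>. if \<sigma> x 0 \<omega> = 1 then 1 else 0)" by auto
  then show ?thesis unfolding Inl code_simps by simp
next
  case (Inr z)
  then show ?thesis by (cases z) (simp add: code_simps)
qed

text \<open>Gathers the waiting times of one clock, since \<open>independent\<close> speaks about
  whole clocks.\<close>

abbreviation site :: "'v + 'v \<times> nat \<Rightarrow> 'v + 'v" where
  "site \<equiv> map_sum id fst"

abbreviation site_sigma :: "'v + 'v \<Rightarrow> 'a set set" where
  "site_sigma \<equiv> case_sum (\<lambda>x. generated_sigma (space M) (count_space UNIV) (\<lambda>x. \<sigma> x 0) {x})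
                   (\<lambda>x. generated_sigma (space M) borel (T x) UNIV)"

lemma code_site_sigma:
  assumes "S \<in> sets borel"
  shows "(\<lambda>\<omega>. code \<omega> i) -` S \<inter> space M \<in> site_sigma (site i)"
proof (cases i)
  case (Inl x)
  have eq: "(\<lambda>\<omega>. code \<omega> (Inl x)) -` S \<inter> space M = \<sigma> x 0 -` {s. of_bool (s = 1) \<in> S} \<inter> space M"
    unfolding code_simps by auto
  have "\<sigma> x 0 -` {s. of_bool (s = 1) \<in> S} \<inter> space M \<in> generated_sigma (space M) (count_space UNIV) (\<lambda>x. \<sigma> x 0) {x}"
    unfolding generated_sigma_def
    by (rule sigma_sets.Basic, rule UN_I[of x], simp, rule CollectI, rule exI, rule conjI, rule refl, simp)
  then show ?thesis unfolding Inl eq by (simp only: map_sum.simps sum.case id_apply)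
next
  case (Inr z)
  obtain x n where z: "z = (x, n)" by (cases z)
  note W = generated_sigma_sigma[where \<Omega> = "space M" and I = UNIV and X = "T x" and N = borel]
  let ?W = "sigma (space M) (\<Union>i\<in>UNIV. {T x i -` S \<inter> space M | S. S \<in> sets (borel :: real measure)})"
  have [measurable]: "T x k \<in> borel_measurable ?W" for k by (rule W(3)) simp_all
  have "gap x n \<in> borel_measurable ?W" unfolding gap_def[abs_def] by (cases n) simp_all
  from measurable_sets[OF this assms] show ?thesis
    unfolding Inr z code_simps W(2) by (simp add: W(1))
qed

lemma site_sigma_INT:
  assumes "finite J" "J \<noteq> {}" "\<And>j. j \<in> J \<Longrightarrow> A j \<in> site_sigma a"
  shows "(\<Inter>j\<in>J. A j) \<in> site_sigma a"
proof (cases a)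
  case (Inl x)
  note W = generated_sigma_sigma(1)[where \<Omega> = "space M" and I = "{x}" and X = "\<lambda>x. \<sigma> x 0" and N = "count_space UNIV"]
  show ?thesis using assms unfolding Inl sum.case W[symmetric] by (intro sets.finite_INT)
next
  case (Inr x)
  note W = generated_sigma_sigma(1)[where \<Omega> = "space M" and I = UNIV and X = "T x" and N = borel]
  show ?thesis using assms unfolding Inr sum.case W[symmetric] by (intro sets.finite_INT)
qed

lemma prob_INT_site:
  assumes J: "finite J" "J \<noteq> {}" "\<And>j. j \<in> J \<Longrightarrow> site j = a"
    and A: "\<And>j. j \<in> J \<Longrightarrow> A j \<in> {(\<lambda>\<omega>. code \<omega> j) -` S \<inter> space M |S. S \<in> sets borel}"
  shows "prob (\<Inter>j\<in>J. A j) = (\<Prod>j\<in>J. prob (A j))"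
proof (cases a)
  case (Inl x)
  have "j = Inl x" if "j \<in> J" for j using J(3)[OF that] Inl by (cases j) auto
  then have "J = {Inl x}" using J(2) by blast
  then show ?thesis by simp
next
  case (Inr x)
  define K where "K = {n. Inr (x, n) \<in> J}"
  have JK: "J = (\<lambda>n. Inr (x, n)) ` K"
  proof (intro equalityI subsetI)
    fix j assume j: "j \<in> J"
    show "j \<in> (\<lambda>n. Inr (x, n)) ` K"
    proof (cases j)
      case (Inr z)
      then show ?thesis using J(3)[OF j] \<open>a = Inr x\<close> j by (cases z) (auto simp: K_def)
    qed (use J(3)[OF j] Inr in simp)
  qed (auto simp: K_def)
  have inj: "inj_on (\<lambda>n. Inr (x, n) :: 'v + 'v \<times> nat) K" by (auto simp: inj_on_def)
  have K: "finite K" "K \<noteq> {}" using J(1,2) finite_imageD[OF _ inj] unfolding JK by auto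
  have "indep_sets (\<lambda>n. {gap x n -` S \<inter> space M |S. S \<in> sets borel}) UNIV"
    using gap_indep[of x] by (simp add: indep_vars_def2)
  moreover have "A (Inr (x, n)) \<in> {gap x n -` S \<inter> space M |S. S \<in> sets borel}" if "n \<in> K" for n
    using A[of "Inr (x, n)"] that unfolding code_simps K_def by blast
  ultimately have "prob (\<Inter>n\<in>K. A (Inr (x, n))) = (\<Prod>n\<in>K. prob (A (Inr (x, n))))"
    using K by (intro indep_setsD) auto
  then show ?thesis unfolding JK prod.reindex[OF inj] by (simp add: comp_def)
qed

text \<open>Two layers: different sites are independent by hypothesis, and within a clock the
  waiting times are independent by the Poisson property. Grouping the factors by site combines
  them.\<close>

lemma indep_vars_code: "indep_vars (\<lambda>_. borel) (\<lambda>i \<omega>. code \<omega> i) UNIV"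
  unfolding indep_vars_def2
proof (intro conjI ballI indep_setsI)
  let ?F = "\<lambda>i. {(\<lambda>\<omega>. code \<omega> i) -` S \<inter> space M |S. S \<in> sets borel}"
  show "(\<lambda>\<omega>. code \<omega> i) \<in> borel_measurable M" for i by (rule code_measurable)
  show "?F i \<subseteq> events" for i using measurable_sets[OF code_measurable] by blast
  fix A J
  assume J: "J \<noteq> {}" "finite J" and A: "\<forall>j\<in>J. A j \<in> ?F j"
  define E where "E a = (\<Inter>j\<in>{j \<in> J. site j = a}. A j)" for a
  have A': "A j \<in> site_sigma (site j)" if "j \<in> J" for j
  proof -
    from bspec[OF A that] obtain S where "A j = (\<lambda>\<omega>. code \<omega> j) -` S \<inter> space M" "S \<in> sets borel"
      by (elim CollectE exE conjE)
    then show ?thesis by (simp only: code_site_sigma)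
  qed
  have "E a \<in> site_sigma a" if "a \<in> site ` J" for a
    unfolding E_def
  proof (rule site_sigma_INT)
    fix j assume "j \<in> {j \<in> J. site j = a}"
    then show "A j \<in> site_sigma a" using A' by blast
  qed (use J that in auto)
  then have "prob (\<Inter>a\<in>site ` J. E a) = (\<Prod>a\<in>site ` J. prob (E a))"
    using J by (intro indep_setsD[OF independent]) auto
  also have "\<dots> = (\<Prod>a\<in>site ` J. \<Prod>j\<in>{j \<in> J. site j = a}. prob (A j))"
  proof (rule prod.cong[OF refl])
    fix a assume "a \<in> site ` J"
    then show "prob (E a) = (\<Prod>j\<in>{j \<in> J. site j = a}. prob (A j))"
      unfolding E_def using J A by (intro prob_INT_site[of _ a]) auto
  qed
  also have "\<dots> = (\<Prod>j\<in>J. prob (A j))" using J(2) by (intro prod.group) auto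
  also have "(\<Inter>a\<in>site ` J. E a) = (\<Inter>j\<in>J. A j)" by (auto simp: E_def)
  finally show "prob (\<Inter>j\<in>J. A j) = (\<Prod>j\<in>J. prob (A j))" .
qed

lemma code_measurable_codes [measurable]: "code \<in> measurable M codes"
  by (rule measurable_PiM_single') (simp_all add: code_measurable)

lemma encode_measurable_codes: "(\<lambda>\<omega>. encode (spin p \<omega>) (clock \<omega>)) \<in> measurable inputs codes"
  by (rule measurable_PiM_single') (simp_all add: encode_inputs_measurable)

text \<open>Both codes have independent coordinates, so it is enough to compare marginals.\<close>

lemma distr_code:
  assumes p: "0 \<le> p" "p \<le> 1"
  shows "distr M codes code = distr inputs codes (\<lambda>\<omega>. encode (spin p \<omega>) (clock \<omega>))"
proof -
  have "distr M borel (\<lambda>\<omega>. code \<omega> i) = distr inputs borel (\<lambda>\<omega>. encode (spin p \<omega>) (clock \<omega>) i)" for i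
  proof (cases i)
    case (Inl x)
    show ?thesis unfolding Inl code_simps encode_inputs sum.case
    proof (rule distr_of_bool_eq)
      show "prob {\<omega> \<in> space M. \<sigma> x 0 \<omega> = 1} = inputs.prob {\<omega> \<in> space inputs. spin p \<omega> x}"
        using initial_plus[of x] prob_spin[OF p, of x] by simp
      show "Measurable.pred inputs (\<lambda>\<omega>. spin p \<omega> x)" by (rule spin_pred_measurable)
    qed (simp_all add: prob_space_axioms inputs.prob_space_axioms)
  next
    case (Inr z)
    obtain x n where z: "z = (x, n)" by (cases z)
    have "distr M borel (gap x n) = distr M lborel (gap x n)" by (rule distr_cong) simp_all
    also have "\<dots> = density lborel (exponential_density 1)"
      by (rule distributed_distr_eq_density[OF gap_exponential])
    also have "\<dots> = coord_law (False, x, n)" by (simp add: coord_law_def)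
    also have "\<dots> = distr inputs borel (\<lambda>\<omega>. \<omega> (False, x, n))" by (rule inputs.distr_coord[symmetric])
    finally show ?thesis unfolding Inr z code_simps encode_inputs by simp
  qed
  note marginals = this
  have "distr inputs codes (\<lambda>\<omega> :: bool \<times> 'v \<times> nat \<Rightarrow> real. encode (spin p \<omega>) (clock \<omega>))
      = PiM UNIV (\<lambda>i. distr inputs borel (\<lambda>\<omega>. encode (spin p \<omega>) (clock \<omega>) i))"
    by (rule inputs.distr_eq_PiM_borel[OF indep_vars_encode_inputs])
  then show ?thesis
    using distr_eq_PiM_borel[OF indep_vars_code] by (simp only: marginals)
qed

lemma AE_code:
  assumes p: "0 \<le> p" "p \<le> 1" and Q: "Measurable.pred codes Q"
    and AE: "AE \<omega> in inputs. Q (encode (spin p \<omega>) (clock \<omega>))"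
  shows "AE \<omega> in M. Q (code \<omega>)"
proof -
  have "AE r in distr inputs codes (\<lambda>\<omega>. encode (spin p \<omega>) (clock \<omega>)). Q r"
    using Q AE by (subst AE_distr_iff[OF encode_measurable_codes]) (simp_all add: pred_def)
  then have "AE r in distr M codes code. Q r" by (simp only: distr_code[OF p])
  then show ?thesis by (rule AE_distrD[OF code_measurable_codes])
qed

lemma final_spin_code:
  assumes p: "0 \<le> p" "p \<le> 1"
  shows "AE \<omega> in M. \<forall>x. final_spin \<sigma> x \<omega>
    = (if final (decode_spin (code \<omega>)) (decode_clock (code \<omega>)) x then 1 else -1)"
proof -
  note [measurable] = measurable_admissible[OF decode_clock_measurable]
    pred_all_vertices[OF measurable_fixates[OF decode_spin_measurable decode_clock_measurable]]
  have Q: "Measurable.pred codes (\<lambda>r. admissible (decode_clock r) \<and> (\<forall>x. fixates (decode_spin r) (decode_clock r) x))"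
    by measurable
  have "AE \<omega> in inputs. admissible (clock \<omega>) \<and> (\<forall>x. fixates (spin p \<omega>) (clock \<omega>) x)"
    using AE_admissible AE_fixates[of p] by eventually_elim blast
  \<comment> \<open>Admissibility and fixation are properties of the code alone, so they transfer
    from the canonical inputs through its law.\<close>
  then have "AE \<omega> in M. admissible (decode_clock (code \<omega>)) \<and> (\<forall>x. fixates (decode_spin (code \<omega>)) (decode_clock (code \<omega>)) x)"
    by (intro AE_code[OF p Q]) (simp only: decode_spin_encode decode_clock_encode)
  moreover have "AE \<omega> in M. \<omega> \<in> space M" by (rule AE_space)
  ultimately show ?thesis using constant_between_rings majority_at_rings
  proof eventually_elim
    case (elim \<omega>)
    have good: "admissible (\<lambda>x n. T x n \<omega>)" "\<And>x. fixates (\<lambda>x. \<sigma> x 0 \<omega> = 1) (\<lambda>x n. T x n \<omega>) x"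
      using elim(1) by (auto simp: code_def)
    show ?case
    proof
      fix x
      have "Lim at_top (\<lambda>t. \<sigma> x t \<omega>)
          = (if final (\<lambda>x. \<sigma> x 0 \<omega> = 1) (\<lambda>x n. T x n \<omega>) x then 1 else -1)"
      proof (rule glauber_path_final[where s = "\<lambda>x t. \<sigma> x t \<omega>"])
        show "\<sigma> x t \<omega> \<in> {-1, 1}" if "t \<ge> 0" for x t using spin_values[OF that elim(2)] .
        show "\<sigma> x b \<omega> = \<sigma> x a \<omega>" if "0 \<le> a" "a \<le> b" "\<And>n. T x n \<omega> \<notin> {a<..b}" for x a b
          using elim(3) that by blast
        show "\<sigma> x (T x n \<omega>) \<omega> = majority {y. adj x y} (\<lambda>y. Lim (at_left (T x n \<omega>)) (\<lambda>t. \<sigma> y t \<omega>))" for x n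
          using elim(4) by blast
      qed (use good in auto)
      then show "final_spin \<sigma> x \<omega> = (if final (decode_spin (code \<omega>)) (decode_clock (code \<omega>)) x then 1 else -1)"
        by (simp add: final_spin_def code_def)
    qed
  qed
qed

definition signs :: "('v \<Rightarrow> bool) \<Rightarrow> 'v \<Rightarrow> int" where
  "signs f x = (if f x then 1 else -1)"

lemma measure_final_spin:
  assumes p: "0 \<le> p" "p \<le> 1" and S: "S \<in> sets (PiM UNIV (\<lambda>_. count_space UNIV))"
  shows "{\<omega>. final_config p \<omega> \<in> signs -` S} \<in> sets inputs"
    and "measure (completion M) {\<omega> \<in> space M. (\<lambda>x. final_spin \<sigma> x \<omega>) \<in> S}
      = inputs.prob {\<omega>. final_config p \<omega> \<in> signs -` S}"
proof -
  let ?F = "\<lambda>r. final (decode_spin r) (decode_clock r)"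
  let ?e = "\<lambda>\<omega>. encode (spin p \<omega>) (clock \<omega>)"
  have "(\<lambda>r. signs (?F r)) \<in> measurable codes (PiM UNIV (\<lambda>_. count_space UNIV))"
  proof (rule measurable_PiM_single')
    fix x
    have [measurable]: "Measurable.pred codes (\<lambda>r. ?F r x)"
      by (rule measurable_final) measurable
    show "(\<lambda>r. signs (?F r) x) \<in> measurable codes (count_space UNIV)"
      unfolding signs_def by measurable
  qed simp
  from measurable_sets[OF this S] have R: "{r. ?F r \<in> signs -` S} \<in> sets codes"
    by (simp add: vimage_def space_PiM)
  have eq: "?e -` {r. ?F r \<in> signs -` S} \<inter> space inputs = {\<omega>. final_config p \<omega> \<in> signs -` S}"
    by (simp add: final_config_def vimage_def)
  show "{\<omega>. final_config p \<omega> \<in> signs -` S} \<in> sets inputs"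
    using measurable_sets[OF encode_measurable_codes R] unfolding eq .
  let ?A = "code -` {r. ?F r \<in> signs -` S} \<inter> space M"
  have "measure (completion M) {\<omega> \<in> space M. (\<lambda>x. final_spin \<sigma> x \<omega>) \<in> S} = prob ?A"
  proof (rule measure_completion_AE)
    show "?A \<in> events" by (rule measurable_sets[OF code_measurable_codes R])
    show "AE \<omega> in M. \<omega> \<in> {\<omega> \<in> space M. (\<lambda>x. final_spin \<sigma> x \<omega>) \<in> S} \<longleftrightarrow> \<omega> \<in> ?A"
      using final_spin_code[OF p]
    proof eventually_elim
      case (elim \<omega>)
      then have "(\<lambda>x. final_spin \<sigma> x \<omega>) = signs (?F (code \<omega>))" by (intro ext) (simp add: signs_def)
      then show ?case by auto
    qed
  qed blast
  also have "prob ?A = measure (distr M codes code) {r. ?F r \<in> signs -` S}"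
    by (rule measure_distr[OF code_measurable_codes R, symmetric])
  also have "\<dots> = inputs.prob (?e -` {r. ?F r \<in> signs -` S} \<inter> space inputs)"
    unfolding distr_code[OF p] by (rule measure_distr[OF encode_measurable_codes R])
  finally show "measure (completion M) {\<omega> \<in> space M. (\<lambda>x. final_spin \<sigma> x \<omega>) \<in> S}
      = inputs.prob {\<omega>. final_config p \<omega> \<in> signs -` S}" unfolding eq .
qed

lemma mixing_alpha_tendsto:
  assumes stable: "stable p"
  shows "(\<lambda>R. mixing_alpha adj v0 M \<sigma> r R) \<longlonglongrightarrow> 0"
proof (rule LIMSEQ_I)
  fix \<epsilon> :: real assume "0 < \<epsilon>"
  then have \<epsilon>: "0 < \<epsilon> / 2" by simp
  have p: "0 \<le> p" "p \<le> 1" using stable by (auto simp: stable_def)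
  from final_config_mixing[OF stable finite_ball[of v0 r] \<epsilon>] obtain G where G: "finite G"
    "\<forall>S S'. {\<omega>. final_config p \<omega> \<in> S} \<in> sets inputs \<longrightarrow>
    {\<omega>. final_config p \<omega> \<in> S'} \<in> sets inputs \<longrightarrow>
    (\<forall>f g. (\<forall>x\<in>{y. graph_dist adj v0 y \<le> r}. f x = g x) \<longrightarrow> f \<in> S \<longleftrightarrow> g \<in> S) \<longrightarrow>
    (\<forall>f g. (\<forall>x. x \<notin> G \<longrightarrow> f x = g x) \<longrightarrow> f \<in> S' \<longleftrightarrow> g \<in> S') \<longrightarrow>
    \<bar>inputs.prob ({\<omega>. final_config p \<omega> \<in> S} \<inter> {\<omega>. final_config p \<omega> \<in> S'})
      - inputs.prob {\<omega>. final_config p \<omega> \<in> S} * inputs.prob {\<omega>. final_config p \<omega> \<in> S'}\<bar> \<le> \<epsilon> / 2"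
    by (elim exE conjE)
  \<comment> \<open>Beyond this radius the distant vertices avoid \<open>G\<close>, so every far
    event is among those covered.\<close>
  obtain R0 where R0: "\<And>x. x \<in> G \<Longrightarrow> graph_dist adj v0 x < R0"
    using finite_nat_iff_bounded[of "graph_dist adj v0 ` G"] G(1) by auto
  have "norm (mixing_alpha adj v0 M \<sigma> r R - 0) < \<epsilon>" if R: "R \<ge> R0" for R
  proof -
    let ?V = "{\<bar>measure (completion M) (A \<inter> B) - measure (completion M) A * measure (completion M) B\<bar>
          | A B. A \<in> Sigma_le adj v0 M \<sigma> r \<and> B \<in> Sigma_ge adj v0 M \<sigma> R}"
    have bound: "v \<le> \<epsilon> / 2" if v: "v \<in> ?V" for v
    proof -
      from v obtain A B where AB: "A \<in> Sigma_le adj v0 M \<sigma> r" "B \<in> Sigma_ge adj v0 M \<sigma> R"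
        "v = \<bar>measure (completion M) (A \<inter> B) - measure (completion M) A * measure (completion M) B\<bar>"
        by blast
      from generated_sigma_configurations[OF AB(1)[unfolded Sigma_le_def]] obtain S where
        S: "S \<in> sets (PiM UNIV (\<lambda>_. count_space UNIV))" "A = {\<omega> \<in> space M. (\<lambda>x. final_spin \<sigma> x \<omega>) \<in> S}"
        "\<forall>f g. (\<forall>x\<in>{x. graph_dist adj v0 x \<le> r}. f x = g x) \<longrightarrow> f \<in> S \<longleftrightarrow> g \<in> S"
        by (elim bexE conjE)
      from generated_sigma_configurations[OF AB(2)[unfolded Sigma_ge_def]] obtain S' where
        S': "S' \<in> sets (PiM UNIV (\<lambda>_. count_space UNIV))" "B = {\<omega> \<in> space M. (\<lambda>x. final_spin \<sigma> x \<omega>) \<in> S'}"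
        "\<forall>f g. (\<forall>x\<in>{x. graph_dist adj v0 x \<ge> R}. f x = g x) \<longrightarrow> f \<in> S' \<longleftrightarrow> g \<in> S'"
        by (elim bexE conjE)
      have AB': "A \<inter> B = {\<omega> \<in> space M. (\<lambda>x. final_spin \<sigma> x \<omega>) \<in> S \<inter> S'}"
        unfolding S(2) S'(2) by blast
      have near: "\<forall>f g. (\<forall>x\<in>{y. graph_dist adj v0 y \<le> r}. f x = g x) \<longrightarrow> f \<in> signs -` S \<longleftrightarrow> g \<in> signs -` S"
      proof (intro allI impI)
        fix f g :: "'v \<Rightarrow> bool" assume "\<forall>x\<in>{y. graph_dist adj v0 y \<le> r}. f x = g x"
        then have "\<forall>x\<in>{x. graph_dist adj v0 x \<le> r}. signs f x = signs g x" by (simp add: signs_def)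
        then show "f \<in> signs -` S \<longleftrightarrow> g \<in> signs -` S" using S(3) by (simp only: vimage_eq)
      qed
      have far: "\<forall>f g. (\<forall>x. x \<notin> G \<longrightarrow> f x = g x) \<longrightarrow> f \<in> signs -` S' \<longleftrightarrow> g \<in> signs -` S'"
      proof (intro allI impI)
        fix f g :: "'v \<Rightarrow> bool" assume fg: "\<forall>x. x \<notin> G \<longrightarrow> f x = g x"
        have "\<forall>x\<in>{x. graph_dist adj v0 x \<ge> R}. signs f x = signs g x"
        proof
          fix x assume "x \<in> {x. graph_dist adj v0 x \<ge> R}"
          then have "x \<notin> G" using R0[of x] R by auto
          then show "signs f x = signs g x" using fg by (simp add: signs_def)
        qed
        then show "f \<in> signs -` S' \<longleftrightarrow> g \<in> signs -` S'" using S'(3) by (simp only: vimage_eq)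
      qed
      have int: "{\<omega>. final_config p \<omega> \<in> signs -` (S \<inter> S')}
          = {\<omega>. final_config p \<omega> \<in> signs -` S} \<inter> {\<omega>. final_config p \<omega> \<in> signs -` S'}" by blast
      have "v = \<bar>inputs.prob ({\<omega>. final_config p \<omega> \<in> signs -` S} \<inter> {\<omega>. final_config p \<omega> \<in> signs -` S'})
        - inputs.prob {\<omega>. final_config p \<omega> \<in> signs -` S} * inputs.prob {\<omega>. final_config p \<omega> \<in> signs -` S'}\<bar>"
        unfolding AB(3) AB' measure_final_spin(2)[OF p sets.Int[OF S(1) S'(1)]] int
        unfolding S(2) S'(2) measure_final_spin(2)[OF p S(1)] measure_final_spin(2)[OF p S'(1)] ..
      also have "\<dots> \<le> \<epsilon> / 2"
        by (rule mp[OF mp[OF mp[OF mp[OF spec[OF spec[OF G(2)]] measure_final_spin(1)[OF p S(1)]]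
              measure_final_spin(1)[OF p S'(1)]] near] far])
      finally show ?thesis .
    qed
    have "{} \<in> Sigma_le adj v0 M \<sigma> r" "{} \<in> Sigma_ge adj v0 M \<sigma> R"
      unfolding Sigma_le_def Sigma_ge_def generated_sigma_def by (rule sigma_sets.Empty)+
    \<comment> \<open>Empty events supply a value: it makes the set nonempty, so that its supremum
      obeys the bound, and it shows that the supremum is not negative.\<close>
    then have zero: "0 \<in> ?V" by (intro CollectI exI[of _ "{}"] conjI) simp_all
    have "?V \<noteq> {}" by (rule notI, use zero in \<open>simp only: empty_iff\<close>)
    then have "Sup ?V \<le> \<epsilon> / 2" by (rule cSup_least) (rule bound)
    moreover have "0 \<le> Sup ?V" using zero by (rule cSup_upper) (rule bdd_aboveI[OF bound])
    ultimately show ?thesis using \<open>0 < \<epsilon>\<close> by (simp add: mixing_alpha_def)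
  qed
  then show "\<exists>no. \<forall>R\<ge>no. norm (mixing_alpha adj v0 M \<sigma> r R - 0) < \<epsilon>" by blast
qed

end

theorem theorem1p2:
  fixes adj :: "'v \<Rightarrow> 'v \<Rightarrow> bool"
    and v0 :: 'v
    and P :: "real \<Rightarrow> 'a measure"
    and T :: "'v \<Rightarrow> nat \<Rightarrow> 'a \<Rightarrow> real"
    and \<sigma> :: "'v \<Rightarrow> real \<Rightarrow> 'a \<Rightarrow> int"
  assumes "regular_tree adj 3"
    and "\<And>p. p \<in> {0..1} \<Longrightarrow> glauber_dynamics adj p (P p) T \<sigma>"
  shows "AE p in lebesgue_on {0..1}. \<forall>r. (\<lambda>R. mixing_alpha adj v0 (P p) \<sigma> r R) \<longlonglongrightarrow> 0"
proof -
  interpret cubic_tree adj using assms(1) by (rule cubic_tree.intro)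
  have "AE p in uniform_measure lborel {0..1}. stable p" using AE_stable unfolding unif_def .
  then have "AE p in lborel. p \<in> {0..1} \<longrightarrow> stable p" by (subst (asm) AE_uniform_measure) auto
  then have "AE p in lebesgue. p \<in> {0..1} \<longrightarrow> stable p" by (rule AE_completion)
  \<comment> \<open>Stability does not mention \<open>r\<close>, so the exceptional set of levels is
    the same for all radii.\<close>
  then have "AE p in lebesgue. p \<in> {0..1} \<longrightarrow> (\<forall>r. (\<lambda>R. mixing_alpha adj v0 (P p) \<sigma> r R) \<longlonglongrightarrow> 0)"
  proof eventually_elim
    case (elim p)
    show ?case
    proof (intro impI allI)
      fix r assume p: "p \<in> {0..1}"
      interpret glauber_dynamics adj p "P p" T \<sigma> using p by (rule assms(2))
      interpret cubic_glauber adj p "P p" T \<sigma> ..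
      show "(\<lambda>R. mixing_alpha adj v0 (P p) \<sigma> r R) \<longlonglongrightarrow> 0"
        using elim p by (intro mixing_alpha_tendsto) simp
    qed
  qed
  then show ?thesis by (subst AE_restrict_space_iff) auto
qed

end
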